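(* Let $\Omega=(\mathbf{R}^{d_1}\setminus\{0\})\times\mathbf{R}^{d_2}$, write $x=(x_1,x_2)$ with $x_1\in\mathbf{R}^{d_1}$, $x_2\in\mathbf{R}^{d_2}$, so $d_\Omega(x)=|x_1|$. Let $\delta,\delta'\geq0$, $c(s)=s^\delta(1+s)^{\delta'-\delta}$ for $s>0$, $c_\Omega=c\circ d_\Omega$, and let $h$ be the Dirichlet form of Grushin type on $L_2(\Omega)$ defined in the context. If $d_1+(\delta\wedge\delta')-2>0$ then $$h(\varphi)\geq a_1\,(c_\Omega^{1/2}d_\Omega^{-1}\varphi,\,c_\Omega^{1/2}d_\Omega^{-1}\varphi)$$ for all $\varphi\in D(h)$ with $a_1=(d_1+(\delta\wedge\delta')-2)^2/4$. The value of $a_1$ is optimal.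
   Context: $L_2(\Omega)$ is the real $L_2$-space with respect to Lebesgue measure, with inner product $(\cdot,\cdot)$. The form $h$ is the closure of $$\varphi\in C_c^\infty(\Omega)\mapsto h(\varphi)=(\nabla_{x_1}\varphi,c_\Omega\,\nabla_{x_1}\varphi)+(\nabla_{x_2}\varphi,b\,\nabla_{x_2}\varphi),$$ where $b$ is the operator of multiplication by a positive bounded (measurable) function of the variable $x_1$ only. $\wedge$ denotes minimum. "Optimal" means that $a_1$ is the largest constant for which the inequality holds for all $\varphi\in D(h)$. *)

theory Defs
  imports "HOL-Analysis.Analysis"
begin

section \<open>Square-integrable functions\<close>

text \<open>Elements of \<open>L\<^sub>2(S)\<close> are represented by functions on the whole space; only their
  values on \<open>S\<close> matter, and only up to null sets.\<close>

definition L2 :: "'a::euclidean_space set \<Rightarrow> ('a \<Rightarrow> real) set" where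
  "L2 S = {f. f \<in> borel_measurable (lebesgue_on S) \<and> integrable (lebesgue_on S) (\<lambda>x. (f x)\<^sup>2)}"

definition L2_inner ::
  "'a::euclidean_space set \<Rightarrow> ('a \<Rightarrow> 'c::euclidean_space) \<Rightarrow> ('a \<Rightarrow> 'c) \<Rightarrow> real" where
  "L2_inner S f g = (LINT x|lebesgue_on S. f x \<bullet> g x)"


section \<open>Test functions\<close>

fun C_k :: "nat \<Rightarrow> ('a::euclidean_space \<Rightarrow> real) \<Rightarrow> bool" where
  "C_k 0 f \<longleftrightarrow> continuous_on UNIV f"
| "C_k (Suc k) f \<longleftrightarrow> (\<forall>x. f differentiable at x) \<and>
     (\<forall>i\<in>Basis. C_k k (\<lambda>x. frechet_derivative f (at x) i))"

text \<open>Smooth functions with compact support in the open set \<open>S\<close>, extended by zero.\<close>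

definition test_functions :: "'a::euclidean_space set \<Rightarrow> ('a \<Rightarrow> real) set" where
  "test_functions S =
     {f. (\<forall>k. C_k k f) \<and> compact (closure {x. f x \<noteq> 0}) \<and> closure {x. f x \<noteq> 0} \<subseteq> S}"


section \<open>Closure of a quadratic form\<close>

text \<open>\<open>form_approx S D q u f\<close>: the sequence \<open>u\<close> in the form domain \<open>D\<close> converges to \<open>f\<close> in
  \<open>L\<^sub>2(S)\<close> and is Cauchy with respect to the quadratic form \<open>q\<close>.\<close>

definition form_approx ::
  "'a::euclidean_space set \<Rightarrow> ('a \<Rightarrow> real) set \<Rightarrow> (('a \<Rightarrow> real) \<Rightarrow> real) \<Rightarrow>
   (nat \<Rightarrow> 'a \<Rightarrow> real) \<Rightarrow> ('a \<Rightarrow> real) \<Rightarrow> bool" where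
  "form_approx S D q u f \<longleftrightarrow>
     (\<forall>n. u n \<in> D) \<and>
     (\<lambda>n. L2_inner S (\<lambda>x. u n x - f x) (\<lambda>x. u n x - f x)) \<longlonglongrightarrow> 0 \<and>
     (\<forall>e>0. \<exists>N. \<forall>m\<ge>N. \<forall>n\<ge>N. q (\<lambda>x. u m x - u n x) < e)"

definition closure_dom ::
  "'a::euclidean_space set \<Rightarrow> ('a \<Rightarrow> real) set \<Rightarrow> (('a \<Rightarrow> real) \<Rightarrow> real) \<Rightarrow> ('a \<Rightarrow> real) set" where
  "closure_dom S D q = {f \<in> L2 S. \<exists>u. form_approx S D q u f}"

text \<open>For a closable form the limit below exists and does not depend on the approximating
  sequence.\<close>

definition closure_form ::
  "'a::euclidean_space set \<Rightarrow> ('a \<Rightarrow> real) set \<Rightarrow> (('a \<Rightarrow> real) \<Rightarrow> real) \<Rightarrow> ('a \<Rightarrow> real) \<Rightarrow> real" where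
  "closure_form S D q f = (THE v. \<forall>u. form_approx S D q u f \<longrightarrow> (\<lambda>n. q (u n)) \<longlonglongrightarrow> v)"


section \<open>The Grushin-type form\<close>

definition Omega :: "('a::euclidean_space \<times> 'b::euclidean_space) set" where
  "Omega = (UNIV - {0}) \<times> UNIV"

definition d_Omega :: "'a::euclidean_space \<times> 'b::euclidean_space \<Rightarrow> real" where
  "d_Omega x = infdist x (frontier Omega)"

definition c_fun :: "real \<Rightarrow> real \<Rightarrow> real \<Rightarrow> real" where
  "c_fun \<delta> \<delta>' s = s powr \<delta> * (1 + s) powr (\<delta>' - \<delta>)"

definition c_Omega :: "real \<Rightarrow> real \<Rightarrow> 'a::euclidean_space \<times> 'b::euclidean_space \<Rightarrow> real" where
  "c_Omega \<delta> \<delta>' x = c_fun \<delta> \<delta>' (d_Omega x)"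

definition grad1 ::
  "('a::euclidean_space \<times> 'b::euclidean_space \<Rightarrow> real) \<Rightarrow> 'a \<times> 'b \<Rightarrow> 'a" where
  "grad1 f x = (\<Sum>i\<in>Basis. frechet_derivative f (at x) (i, 0) *\<^sub>R i)"

definition grad2 ::
  "('a::euclidean_space \<times> 'b::euclidean_space \<Rightarrow> real) \<Rightarrow> 'a \<times> 'b \<Rightarrow> 'b" where
  "grad2 f x = (\<Sum>j\<in>Basis. frechet_derivative f (at x) (0, j) *\<^sub>R j)"

definition grushin_form0 ::
  "real \<Rightarrow> real \<Rightarrow> ('a::euclidean_space \<Rightarrow> real) \<Rightarrow>
   ('a \<times> 'b::euclidean_space \<Rightarrow> real) \<Rightarrow> real" where
  "grushin_form0 \<delta> \<delta>' b f =
     L2_inner Omega (grad1 f) (\<lambda>x. c_Omega \<delta> \<delta>' x *\<^sub>R grad1 f x) +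
     L2_inner Omega (grad2 f) (\<lambda>x. b (fst x) *\<^sub>R grad2 f x)"

definition grushin_dom ::
  "real \<Rightarrow> real \<Rightarrow> ('a::euclidean_space \<Rightarrow> real) \<Rightarrow> ('a \<times> 'b::euclidean_space \<Rightarrow> real) set" where
  "grushin_dom \<delta> \<delta>' b = closure_dom Omega (test_functions Omega) (grushin_form0 \<delta> \<delta>' b)"

definition grushin_form ::
  "real \<Rightarrow> real \<Rightarrow> ('a::euclidean_space \<Rightarrow> real) \<Rightarrow>
   ('a \<times> 'b::euclidean_space \<Rightarrow> real) \<Rightarrow> real" where
  "grushin_form \<delta> \<delta>' b = closure_form Omega (test_functions Omega) (grushin_form0 \<delta> \<delta>' b)"

definition hardy_weighted ::
  "real \<Rightarrow> real \<Rightarrow> ('a::euclidean_space \<times> 'b::euclidean_space \<Rightarrow> real) \<Rightarrow> 'a \<times> 'b \<Rightarrow> real" where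
  "hardy_weighted \<delta> \<delta>' f x = sqrt (c_Omega \<delta> \<delta>' x) * inverse (d_Omega x) * f x"

lemma frontier_Omega:
  "frontier (Omega :: ('a::euclidean_space \<times> 'b::euclidean_space) set) = {0} \<times> UNIV"
proof -
  have "closure (UNIV - {0::'a}) = UNIV"
    using closure_complement[of "{0::'a}"] by (simp add: Compl_eq_Diff_UNIV)
  then have "closure (Omega :: ('a \<times> 'b) set) = UNIV"
    by (simp add: Omega_def closure_Times)
  moreover have "interior (Omega :: ('a \<times> 'b) set) = Omega"
    unfolding Omega_def by (intro interior_open open_Times) auto
  ultimately show ?thesis by (auto simp: frontier_def Omega_def)
qed

lemma d_Omega_eq: "d_Omega (x :: 'a::euclidean_space \<times> 'b::euclidean_space) = norm (fst x)"
proof (rule antisym)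
  have "d_Omega x \<le> dist x (0, snd x)"
    unfolding d_Omega_def frontier_Omega by (rule infdist_le) auto
  then show "d_Omega x \<le> norm (fst x)" by (simp add: dist_prod_def)
next
  show "norm (fst x) \<le> d_Omega x"
    unfolding d_Omega_def frontier_Omega infdist_def
  proof (simp, rule cINF_greatest)
    fix y :: "'a \<times> 'b" assume "y \<in> {0} \<times> UNIV"
    then show "norm (fst x) \<le> dist x y"
      using dist_fst_le[of x y] by auto
  qed auto
qed

end

theory Submission
  imports Defs
begin

text \<open>Write \<open>\<mu> = min \<delta> \<delta>'\<close>, \<open>m = d\<^sub>1 + \<mu> - 2\<close> and \<open>s = |x\<^sub>1|\<close>. The vector field \<open>c(s) x\<^sub>1 / s\<^sup>2\<close> has
  \<open>x\<^sub>1\<close>-divergence at least \<open>m c(s) / s\<^sup>2\<close>, because \<open>s c'(s) \<ge> \<mu> c(s)\<close>. Integrating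
  \<open>c |\<nabla>\<^sub>1\<phi> + (m/2) \<phi> x\<^sub>1 / s\<^sup>2|\<^sup>2 \<ge> 0\<close> by parts gives the Hardy inequality for test functions, and Fatou's
  lemma along an almost everywhere convergent subsequence carries it over to the closure. The
  form is closable because it is the form of the symmetric operator
  \<open>-div\<^sub>1 (c \<nabla>\<^sub>1) - b \<Delta>\<^sub>2\<close> on the test functions: \<open>b\<close> may be degenerate, but it does not depend on \<open>x\<^sub>2\<close>.

  For optimality, take \<open>s\<^sup>-\<^sup>m\<^sup>/\<^sup>2 \<eta>(\<epsilon> (ln s - t)) \<eta>(|x\<^sub>2| / R)\<close> with a bump function \<open>\<eta>\<close>. The term with \<open>b\<close>
  disappears as \<open>R \<rightarrow> \<infinity>\<close>. Choosing \<open>t\<close> near \<open>-\<infinity>\<close> if \<open>\<delta> \<le> \<delta>'\<close> and near \<open>\<infinity>\<close> otherwise makes \<open>c\<close> almost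
  proportional to \<open>s\<^sup>\<mu>\<close> on the support. The quotient then tends to \<open>m\<^sup>2 / 4\<close> as \<open>\<epsilon> \<rightarrow> 0\<close>, since the
  measure \<open>|x\<^sub>1|\<^sup>-\<^sup>d dx\<^sub>1\<close>, \<open>d = d\<^sub>1\<close>, is invariant under dilations.\<close>

section \<open>Smoothness of finite order on open sets\<close>

text \<open>The coefficient \<open>m / 2\<close> is the best one: with \<open>l\<close> in its place
  the square yields the constant \<open>l * m - l\<^sup>2\<close>, largest at
  \<open>l = m / 2\<close>. The power \<open>s powr (- m / 2)\<close> annihilates the square, which
  is why the trial functions are cut off from it.

  Closability gives the statement its content: \<open>closure_form\<close> is a definite
  description, so its value is known only once the limit exists and is the same for all
  approximating sequences. The Hardy bound needs this to identify the limit met by Fatou's lemma,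
  optimality to compute the form on trial functions.

  The coefficient \<open>b\<close> is only measurable. It is replaced by a Borel version, and
  integration by parts moves difference quotients by translation along one basis vector, so a weight
  invariant in that direction is never differentiated.

  In the optimality argument the limits have an order. The support has logarithmic width
  \<open>2 / \<epsilon>\<close> and must lie where \<open>c\<close> is within a factor
  \<open>\<kappa>\<close> of a power, so \<open>t\<close> depends on \<open>\<epsilon>\<close> and
  \<open>\<kappa>\<close>. With these fixed \<open>R\<close> goes to infinity, and only then
  \<open>\<epsilon>\<close> goes to zero, with \<open>\<kappa> = 1 + \<epsilon>\<close>.\<close>

primrec C_on :: "nat \<Rightarrow> 'a::euclidean_space set \<Rightarrow> ('a \<Rightarrow> real) \<Rightarrow> bool" where
  "C_on 0 S f \<longleftrightarrow> continuous_on S f"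
| "C_on (Suc k) S f \<longleftrightarrow> (\<forall>x\<in>S. f differentiable at x) \<and>
     (\<forall>i\<in>Basis. C_on k S (\<lambda>x. frechet_derivative f (at x) i))"

text \<open>Test functions must satisfy \<open>C_k\<close> on the whole space, but their factors
  (powers, logarithms, norms) are smooth only away from the origin. \<open>C_on\<close> allows the
  work to be done on an open set and then carried back.\<close>

lemma C_k_iff_C_on: "C_k k f \<longleftrightarrow> C_on k UNIV f"
  by (induction k arbitrary: f) auto

lemma C_on_cong:
  assumes "open S" "\<And>x. x \<in> S \<Longrightarrow> f x = g x" "C_on k S f"
  shows "C_on k S g"
  using assms(2,3)
proof (induction k arbitrary: f g)
  case 0
  then show ?case by (simp cong: continuous_on_cong)
next
  case (Suc k)
  have D: "(g has_derivative frechet_derivative f (at x)) (at x)" if "x \<in> S" for x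
    using Suc.prems that \<open>open S\<close>
    by (auto intro: has_derivative_transform_within_open simp: frechet_derivative_works)
  then have "frechet_derivative f (at x) = frechet_derivative g (at x)" if "x \<in> S" for x
    using that frechet_derivative_at by blast
  then have "C_on k S (\<lambda>x. frechet_derivative g (at x) i)" if "i \<in> Basis" for i
    using Suc.IH[of "\<lambda>x. frechet_derivative f (at x) i"] Suc.prems(2) that by simp
  then show ?case
    using D by (auto simp: differentiable_def)
qed

text \<open>By uniqueness of the derivative, an explicit formula may stand in for the choice
  operator \<open>frechet_derivative\<close>. The sum, product and chain rules below all go through
  this.\<close>

lemma C_on_SucI:
  assumes "open S" "\<And>x. x \<in> S \<Longrightarrow> (f has_derivative f' x) (at x)"
    and "\<And>i. i \<in> Basis \<Longrightarrow> C_on k S (\<lambda>x. f' x i)"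
  shows "C_on (Suc k) S f"
proof -
  have "f' x = frechet_derivative f (at x)" if "x \<in> S" for x
    using assms(2) that frechet_derivative_at by blast
  then have "C_on k S (\<lambda>x. frechet_derivative f (at x) i)" if "i \<in> Basis" for i
    using C_on_cong[OF \<open>open S\<close> _ assms(3)[OF that]] by simp
  then show ?thesis
    using assms(2) by (auto simp: differentiable_def)
qed

lemma C_on_has_derivative:
  "C_on (Suc k) S f \<Longrightarrow> x \<in> S \<Longrightarrow> (f has_derivative frechet_derivative f (at x)) (at x)"
  by (simp add: frechet_derivative_works)

lemma C_on_Suc_imp: "C_on (Suc k) S f \<Longrightarrow> C_on k S f"
proof (induction k arbitrary: f)
  case 0
  then show ?case
    by (auto intro!: continuous_at_imp_continuous_on differentiable_imp_continuous_within)
next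
  case (Suc k)
  then show ?case by (metis C_on.simps(2))
qed

lemma C_on_imp_continuous_on: "C_on k S f \<Longrightarrow> continuous_on S f"
  by (induction k) (auto dest: C_on_Suc_imp simp del: C_on.simps(2))

lemma C_on_Un:
  assumes "open S" "open T" "C_on k S f" "C_on k T f"
  shows "C_on k (S \<union> T) f"
  using assms(3,4) by (induction k arbitrary: f) (auto intro: continuous_on_open_Un assms)

lemma C_on_subset: "C_on k S f \<Longrightarrow> T \<subseteq> S \<Longrightarrow> C_on k T f"
  by (induction k arbitrary: f) (auto intro: continuous_on_subset)

lemma C_on_const: "C_on k S (\<lambda>_. a)"
  by (induction k arbitrary: a) (auto simp: frechet_derivative_const)

lemma C_on_linear:
  assumes "bounded_linear f" "open S"
  shows "C_on k S f"
proof (cases k)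
  case 0
  then show ?thesis using assms by (simp add: linear_continuous_on)
next
  case (Suc j)
  then show ?thesis
    using assms C_on_SucI[of S f "\<lambda>_. f"] by (auto intro: bounded_linear_imp_has_derivative C_on_const)
qed

lemma C_on_add:
  assumes "open S" "C_on k S f" "C_on k S g"
  shows "C_on k S (\<lambda>x. f x + g x)"
  using assms(2,3)
proof (induction k arbitrary: f g)
  case 0
  then show ?case by (simp add: continuous_on_add continuous_on_mult)
next
  case (Suc k)
  show ?case
  proof (rule C_on_SucI[OF \<open>open S\<close>])
    show "((\<lambda>x. f x + g x) has_derivative
        (\<lambda>h. frechet_derivative f (at x) h + frechet_derivative g (at x) h)) (at x)"
      if "x \<in> S" for x
      using Suc.prems that by (intro has_derivative_add C_on_has_derivative)
  qed (use Suc in auto)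
qed

lemma C_on_mult:
  assumes "open S" "C_on k S f" "C_on k S g"
  shows "C_on k S (\<lambda>x. f x * g x)"
  using assms(2,3)
proof (induction k arbitrary: f g)
  case 0
  then show ?case by (simp add: continuous_on_add continuous_on_mult)
next
  case (Suc k)
  note fg = C_on_Suc_imp[OF Suc.prems(1)] C_on_Suc_imp[OF Suc.prems(2)]
  show ?case
  proof (rule C_on_SucI[OF \<open>open S\<close>])
    show "((\<lambda>x. f x * g x) has_derivative
        (\<lambda>h. f x * frechet_derivative g (at x) h + frechet_derivative f (at x) h * g x)) (at x)"
      if "x \<in> S" for x
      using Suc.prems that by (intro has_derivative_mult C_on_has_derivative)
  next
    fix i :: 'a assume i: "i \<in> Basis"
    show "C_on k S (\<lambda>x. f x * frechet_derivative g (at x) i + frechet_derivative f (at x) i * g x)"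
      using Suc fg i by (intro C_on_add Suc.IH) (auto simp: assms)
  qed
qed

lemma C_on_cmult: "open S \<Longrightarrow> C_on k S f \<Longrightarrow> C_on k S (\<lambda>x. a * f x)"
  by (intro C_on_mult C_on_const)

lemma C_on_diff: "open S \<Longrightarrow> C_on k S f \<Longrightarrow> C_on k S g \<Longrightarrow> C_on k S (\<lambda>x. f x - g x)"
  using C_on_add[of S k f "\<lambda>x. -1 * g x"] C_on_cmult[of S k g "-1"] by simp

lemma C_on_sum:
  "open S \<Longrightarrow> (\<And>i. i \<in> I \<Longrightarrow> C_on k S (f i)) \<Longrightarrow> C_on k S (\<lambda>x. \<Sum>i\<in>I. f i x)"
  by (induction I rule: infinite_finite_induct) (auto intro: C_on_add C_on_const)

lemma C_on_compose:
  fixes g :: "real \<Rightarrow> real"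
  assumes "open S" "open T" "f ` S \<subseteq> T" "C_on k T g" "C_on k S f"
  shows "C_on k S (\<lambda>x. g (f x))"
  using assms(4,5)
\<comment> \<open>Only \<open>g\<close> is generalized: the chain rule reproduces \<open>f\<close>
  unchanged inside the derivative of \<open>g\<close>, and the remaining factor is handled by
  \<open>C_on_mult\<close>.\<close>
proof (induction k arbitrary: g)
  case 0
  then show ?case
    using assms(3) by (auto intro: continuous_on_compose2)
next
  case (Suc k)
  show ?case
  proof (rule C_on_SucI[OF \<open>open S\<close>])
    fix x assume x: "x \<in> S"
    define D where "D = frechet_derivative g (at (f x)) 1"
    have Dg: "(g has_derivative frechet_derivative g (at (f x))) (at (f x))"
      using Suc.prems(1) x assms(3) by (intro C_on_has_derivative[where S = T]) auto
    then have "frechet_derivative g (at (f x)) h = D * h" for h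
      using linear_cmul[OF has_derivative_linear[OF Dg], of h 1] by (simp add: D_def)
    then show "((\<lambda>x. g (f x)) has_derivative
        (\<lambda>h. frechet_derivative g (at (f x)) 1 * frechet_derivative f (at x) h)) (at x)"
      using has_derivative_compose[OF C_on_has_derivative[OF Suc.prems(2) x] Dg]
      unfolding D_def[symmetric] by simp
  next
    fix i :: 'a assume i: "i \<in> Basis"
    show "C_on k S (\<lambda>x. frechet_derivative g (at (f x)) 1 * frechet_derivative f (at x) i)"
      using Suc.prems i C_on_Suc_imp[OF Suc.prems(2)]
      by (intro C_on_mult Suc.IH[of "\<lambda>y. frechet_derivative g (at y) 1"] \<open>open S\<close>) auto
  qed
qed

section \<open>Smooth functions of one real variable: powers, the logarithm, a flat function\<close>

lemma C_on_real_SucI: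
  fixes f :: "real \<Rightarrow> real"
  assumes "open S" "\<And>x. x \<in> S \<Longrightarrow> (f has_real_derivative f' x) (at x)" "C_on k S f'"
  shows "C_on (Suc k) S f"
  using assms by (intro C_on_SucI[where f' = "\<lambda>x h. f' x * h"]) (auto simp: has_field_derivative_def)

lemma C_on_powr: "C_on k {0<..} (\<lambda>y. y powr a :: real)"
proof (induction k arbitrary: a)
  case 0
  show ?case by (auto intro!: continuous_on_powr)
next
  case (Suc k)
  show ?case
  proof (rule C_on_real_SucI)
    show "((\<lambda>y. y powr a) has_real_derivative a * y powr (a - 1)) (at y)" if "y \<in> {0<..}" for y
      using that by (auto intro: has_real_derivative_powr)
  qed (auto intro: C_on_cmult Suc)
qed

lemma C_on_ln: "C_on k {0<..} (ln :: real \<Rightarrow> real)"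
proof (cases k)
  case 0
  then show ?thesis by (auto intro!: continuous_on_ln)
next
  case (Suc j)
  have "C_on (Suc j) {0<..} (ln :: real \<Rightarrow> real)"
  proof (rule C_on_real_SucI)
    show "(ln has_real_derivative y powr - 1) (at y)" if "y \<in> {0<..}" for y :: real
      using that DERIV_ln[of y] by (simp add: powr_minus)
  qed (rule open_greaterThan, rule C_on_powr)
  then show ?thesis using Suc by simp
qed

text \<open>The functions \<open>y\<^sup>-\<^sup>n exp (-1/y)\<close> on the positive half-line, extended by zero: their span is
  closed under differentiation, so all of them are smooth.\<close>

definition bump :: "nat \<Rightarrow> real \<Rightarrow> real" where
  "bump n y = (if y > 0 then inverse y ^ n * exp (- inverse y) else 0)"

text \<open>With \<open>z = inverse y\<close>, a single term of the exponential series gives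
  \<open>z ^ (n + 2) \<le> fact (n + 2) * exp z\<close>. Quadratic decay is exactly what makes the
  difference quotient at zero tend to zero; the explicit constant reappears in
  \<open>dcutoff_bound\<close>.\<close>

lemma bump_le_square: "bump n y \<le> fact (n + 2) * y\<^sup>2"
proof (cases "y > 0")
  case True
  define z where "z = inverse y"
  have z: "z > 0" "y = inverse z"
    using True by (simp_all add: z_def)
  have "(\<Sum>k\<in>{n + 2}. z ^ k /\<^sub>R fact k) \<le> exp z"
    unfolding exp_def using z by (intro sum_le_suminf summable_exp_generic) auto
  then have "z ^ (n + 2) \<le> fact (n + 2) * exp z"
    by (simp add: divide_simps mult.commute del: fact_Suc)
  then have "z ^ (n + 2) * (exp (- z) * y\<^sup>2) \<le> fact (n + 2) * exp z * (exp (- z) * y\<^sup>2)"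
    by (intro mult_right_mono) auto
  moreover have "z * (z * y\<^sup>2) = 1"
    using z by (simp add: power2_eq_square field_simps)
  then have "z ^ (n + 2) * (exp (- z) * y\<^sup>2) = bump n y"
    using True by (simp add: bump_def power_add z_def[symmetric] mult.assoc mult.left_commute[of _ "exp (- z)"] del: power_inverse)
  moreover have "fact (n + 2) * exp z * (exp (- z) * y\<^sup>2) = fact (n + 2) * y\<^sup>2"
    by (simp add: exp_minus del: fact_Suc)
  ultimately show ?thesis
    by linarith
qed (simp add: bump_def)

lemma bump_nonneg: "0 \<le> bump n y"
  by (simp add: bump_def)

lemma bump_has_derivative:
  "(bump n has_real_derivative bump (n + 2) y - n * bump (n + 1) y) (at y)"
proof -
  consider "y > 0" | "y < 0" | "y = 0" by linarith
  then show ?thesis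
  proof cases
    case 1
    have I: "(inverse has_real_derivative - (inverse y * inverse y)) (at y)"
      using DERIV_inverse[of y UNIV] 1 by (simp add: power2_eq_square)
    have P: "((\<lambda>y. inverse y ^ n) has_real_derivative - (n * inverse y ^ (n + 1))) (at y)" for n
    proof (induction n)
      case (Suc n)
      show ?case
        using DERIV_mult[OF I Suc] by (simp add: algebra_simps)
    qed simp
    have E: "((\<lambda>y. exp (- inverse y)) has_real_derivative exp (- inverse y) * (inverse y * inverse y)) (at y)"
      using DERIV_chain2[OF DERIV_exp DERIV_minus[OF I]] by simp
    have "((\<lambda>y. inverse y ^ n * exp (- inverse y)) has_real_derivative
        bump (n + 2) y - n * bump (n + 1) y) (at y)"
      by (rule DERIV_cong[OF DERIV_mult[OF P E]])
        (use 1 in \<open>simp add: bump_def algebra_simps power2_eq_square\<close>)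
    then show ?thesis
      by (rule has_field_derivative_transform_within_open[where S = "{0<..}"]) (use 1 in \<open>auto simp: bump_def\<close>)
  next
    case 2
    have "((\<lambda>_. 0) has_real_derivative bump (n + 2) y - n * bump (n + 1) y) (at y)"
      using 2 by (simp add: bump_def)
    then show ?thesis
      by (rule has_field_derivative_transform_within_open[where S = "{..<0}"]) (use 2 in \<open>auto simp: bump_def\<close>)
  next
    case 3
    have "((\<lambda>h. bump n h / h) \<longlongrightarrow> 0) (at 0)"
    proof (rule Lim_null_comparison)
      show "\<forall>\<^sub>F h in at 0. norm (bump n h / h) \<le> fact (n + 2) * \<bar>h\<bar>"
        unfolding eventually_at_filter
      proof (intro always_eventually allI impI)
        fix h :: real assume "h \<noteq> 0"
        then show "norm (bump n h / h) \<le> fact (n + 2) * \<bar>h\<bar>"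
          using bump_le_square[of n h] bump_nonneg[of n h]
          by (simp add: divide_simps power2_eq_square mult.assoc del: fact_Suc)
      qed
      show "((\<lambda>h. fact (n + 2) * \<bar>h\<bar>) \<longlongrightarrow> (0::real)) (at 0)"
        by (auto intro!: tendsto_eq_intros simp del: fact_Suc)
    qed
    then show ?thesis
      using 3 by (simp add: DERIV_def bump_def)
  qed
qed

lemma C_on_bump: "C_on k UNIV (bump n)"
proof (induction k arbitrary: n)
  case 0
  have "isCont (bump n) y" for y
    using bump_has_derivative by (rule DERIV_isCont)
  then show ?case
    by (simp add: continuous_at_imp_continuous_on)
next
  case (Suc k)
  show ?case
    by (rule C_on_real_SucI[OF _ bump_has_derivative])
      (auto intro!: C_on_diff C_on_cmult Suc)
qed

section \<open>Integration by parts\<close>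

abbreviation pd :: "('a::euclidean_space \<Rightarrow> real) \<Rightarrow> 'a \<Rightarrow> 'a \<Rightarrow> real" where
  "pd f v x \<equiv> frechet_derivative f (at x) v"

lemma pd_eq_0_outside:
  assumes "closed K" "\<And>x. x \<notin> K \<Longrightarrow> f x = 0" "x \<notin> K"
  shows "pd f v x = 0"
proof -
  have "(f has_derivative (\<lambda>_. 0)) (at x)"
    by (rule has_derivative_transform_within_open[where s = "- K" and f = "\<lambda>_. 0"])
      (use assms in \<open>auto simp: open_Compl\<close>)
  then show ?thesis
    using frechet_derivative_at by metis
qed

lemma bounded_if_compact_support:
  fixes f :: "'a::topological_space \<Rightarrow> real"
  assumes "continuous_on UNIV f" "compact K" "\<And>x. x \<notin> K \<Longrightarrow> f x = 0"
  obtains M where "M \<ge> 0" "\<And>x. \<bar>f x\<bar> \<le> M"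
proof -
  have "compact (f ` K)"
    using assms continuous_on_subset by (intro compact_continuous_image) blast+
  then obtain M where M: "\<And>y. y \<in> f ` K \<Longrightarrow> \<bar>y\<bar> \<le> M"
    using compact_imp_bounded bounded_iff by (metis real_norm_def)
  have "\<bar>f x\<bar> \<le> max M 0" for x
    using M[of "f x"] assms(3)[of x] by (cases "x \<in> K") auto
  then show ?thesis
    using that[of "max M 0"] by simp
qed

lemma integrable_compact_support:
  fixes f :: "'a::euclidean_space \<Rightarrow> real"
  assumes "continuous_on UNIV f" "compact K" "\<And>x. x \<notin> K \<Longrightarrow> f x = 0"
  shows "integrable lborel f"
proof -
  have "(\<lambda>x. indicator K x *\<^sub>R f x) = f"
    using assms(3) by (auto simp: indicator_def fun_eq_iff)
  then show ?thesis
    using borel_integrable_compact[OF assms(2) continuous_on_subset[OF assms(1), of K]] by simp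
qed

lemma integrable_bounded_mult:
  fixes f w :: "'a::euclidean_space \<Rightarrow> real"
  assumes "integrable lborel f" "w \<in> borel_measurable borel" "\<And>x. \<bar>w x\<bar> \<le> B"
  shows "integrable lborel (\<lambda>x. w x * f x)"
proof (rule Bochner_Integration.integrable_bound[where f = "\<lambda>x. B * f x"])
  show "integrable lborel (\<lambda>x. B * f x)"
    using assms(1) by simp
  show "(\<lambda>x. w x * f x) \<in> borel_measurable lborel"
    using assms(1,2) by (auto simp: integrable_iff_bounded)
  have "\<bar>w x\<bar> * \<bar>f x\<bar> \<le> \<bar>B\<bar> * \<bar>f x\<bar>" for x
    using assms(3)[of x] by (intro mult_right_mono) auto
  then show "AE x in lborel. norm (w x * f x) \<le> norm (B * f x)"
    by (auto simp: abs_mult)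
qed

lemma integral_lborel_translate:
  fixes f :: "'a::euclidean_space \<Rightarrow> real"
  assumes [measurable]: "f \<in> borel_measurable borel"
  shows "(\<integral>x. f (x + v) \<partial>lborel) = (\<integral>x. f x \<partial>lborel)"
proof -
  have "(\<integral>x. f x \<partial>lborel) = (\<integral>x. f x \<partial>distr lborel borel ((+) v))"
    by (simp add: lborel_distr_plus)
  also have "\<dots> = (\<integral>x. f (x + v) \<partial>lborel)"
    by (subst integral_distr) (auto simp: add.commute)
  finally show ?thesis ..
qed

text \<open>The weight has no derivative, but it is invariant along \<open>v\<close>. Translation
  invariance of Lebesgue measure therefore makes \<open>w\<close> times any difference quotient of
  \<open>F\<close> along \<open>v\<close> integrate to zero, and dominated convergence passes to the
  derivative.\<close>

lemma integral_pd_eq_0: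
  fixes F w :: "'a::euclidean_space \<Rightarrow> real"
  assumes F: "C_k (Suc 0) F" "compact K" "\<And>x. x \<notin> K \<Longrightarrow> F x = 0"
    and w [measurable]: "w \<in> borel_measurable borel" and wB: "\<And>x. \<bar>w x\<bar> \<le> B"
    and w_inv: "\<And>x t. w (x + t *\<^sub>R v) = w x" and v: "v \<in> Basis"
  shows "(\<integral>x. w x * pd F v x \<partial>lborel) = 0"
proof -
  have cont_F: "continuous_on UNIV F"
    using F(1) C_on_imp_continuous_on C_k_iff_C_on by blast
  have cont_pd: "continuous_on UNIV (pd F v)"
    using F(1) v by simp
  have dF: "(F has_derivative frechet_derivative F (at x)) (at x)" for x
    using F(1) by (simp add: frechet_derivative_works)
  have DF: "((\<lambda>t. F (x + t *\<^sub>R v)) has_real_derivative pd F v (x + t *\<^sub>R v)) (at t)" for x t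
  proof -
    have "((\<lambda>t. x + t *\<^sub>R v) has_derivative (\<lambda>h. h *\<^sub>R v)) (at t)"
      by (auto intro!: derivative_eq_intros)
    then have "((\<lambda>t. F (x + t *\<^sub>R v)) has_derivative
        (\<lambda>h. frechet_derivative F (at (x + t *\<^sub>R v)) (h *\<^sub>R v))) (at t)"
      by (rule has_derivative_compose) (rule dF)
    moreover have "frechet_derivative F (at y) (h *\<^sub>R v) = pd F v y * h" for y h
      using linear_cmul[OF has_derivative_linear[OF dF]] by (simp add: mult.commute)
    ultimately show ?thesis
      by (simp add: has_field_derivative_def)
  qed
  obtain M where M: "M \<ge> 0" "\<And>x. \<bar>pd F v x\<bar> \<le> M"
    using bounded_if_compact_support[OF cont_pd F(2) pd_eq_0_outside[OF compact_imp_closed[OF F(2)] F(3)]]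
    by blast
  obtain r where r: "\<And>x. x \<in> K \<Longrightarrow> norm x \<le> r"
    using F(2) compact_imp_bounded bounded_iff by metis
  define h where "h n = inverse (real (Suc n))" for n
  have h: "0 < h n" "h n \<le> 1" for n
    by (auto simp: h_def field_simps)
  have meas_F [measurable]: "F \<in> borel_measurable borel"
    using cont_F by (rule borel_measurable_continuous_onI)
  define s where "s n x = w x * ((F (x + h n *\<^sub>R v) - F x) / h n)" for n x
  have B: "B \<ge> 0"
    using wB[of undefined] by linarith
  have int_wF: "integrable lborel (\<lambda>x. w x * F x)"
    using integrable_bounded_mult[OF integrable_compact_support[OF cont_F F(2,3)] w wB] by simp
  have "(\<lambda>n. \<integral>x. s n x \<partial>lborel) \<longlonglongrightarrow> (\<integral>x. w x * pd F v x \<partial>lborel)"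
  proof (rule integral_dominated_convergence)
    show "(\<lambda>x. w x * pd F v x) \<in> borel_measurable lborel"
      using borel_measurable_continuous_onI[OF cont_pd] by measurable
    show "s n \<in> borel_measurable lborel" for n
      unfolding s_def by measurable
    \<comment> \<open>The increments have length at most 1, so every quotient vanishes outside the
      ball of radius \<open>r + 1\<close>; inside it the mean value theorem bounds the quotient by
      \<open>M\<close>.\<close>
    show "integrable lborel (\<lambda>x. indicator (cball 0 (r + 1)) x *\<^sub>R (B * M) :: real)"
      by (rule borel_integrable_compact) auto
    show "AE x in lborel. (\<lambda>n. s n x) \<longlonglongrightarrow> w x * pd F v x"
    proof (rule AE_I2)
      fix x
      have "((\<lambda>t. (F (x + t *\<^sub>R v) - F x) / t) \<longlongrightarrow> pd F v x) (at 0)"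
        using DF[of x 0] by (simp add: DERIV_def)
      moreover have "filterlim h (at 0) sequentially"
        unfolding filterlim_at h_def
        using LIMSEQ_inverse_real_of_nat by (auto simp del: of_nat_Suc)
      ultimately have "(\<lambda>n. (F (x + h n *\<^sub>R v) - F x) / h n) \<longlonglongrightarrow> pd F v x"
        by (rule filterlim_compose)
      then show "(\<lambda>n. s n x) \<longlonglongrightarrow> w x * pd F v x"
        unfolding s_def by (intro tendsto_mult tendsto_const)
    qed
    show "AE x in lborel. norm (s n x) \<le> indicator (cball 0 (r + 1)) x *\<^sub>R (B * M)" for n
    proof (rule AE_I2)
      fix x
      show "norm (s n x) \<le> indicator (cball 0 (r + 1)) x *\<^sub>R (B * M)"
      proof (cases "norm x \<le> r + 1")
        case True
        obtain z where "F (x + h n *\<^sub>R v) - F (x + 0 *\<^sub>R v) = (h n - 0) * pd F v (x + z *\<^sub>R v)"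
          using MVT2[OF h(1)[of n] DF[of x]] by blast
        then have "(F (x + h n *\<^sub>R v) - F x) / h n = pd F v (x + z *\<^sub>R v)"
          using h(1)[of n] by (simp add: field_simps)
        then have "\<bar>w x\<bar> * \<bar>(F (x + h n *\<^sub>R v) - F x) / h n\<bar> \<le> B * M"
          using M wB B by (intro mult_mono) auto
        then show ?thesis
          using True by (simp add: s_def abs_mult)
      next
        case False
        have "norm (x + h n *\<^sub>R v) \<ge> norm x - norm (h n *\<^sub>R v)"
          by (rule norm_diff_ineq)
        then have "x \<notin> K" "x + h n *\<^sub>R v \<notin> K"
          using False r[of x] r[of "x + h n *\<^sub>R v"] h[of n] v by auto
        then have "F x = 0" "F (x + h n *\<^sub>R v) = 0"
          using F(3) by auto
        then show ?thesis
          using B M by (simp add: s_def)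
      qed
    qed
  qed
  moreover have "(\<integral>x. s n x \<partial>lborel) = 0" for n
  proof -
    have int2: "integrable lborel (\<lambda>x. w x * F (x + h n *\<^sub>R v))"
    proof (rule integrable_bounded_mult[OF _ w wB])
      show "integrable lborel (\<lambda>x. F (x + h n *\<^sub>R v))"
      proof (rule integrable_compact_support)
        show "continuous_on UNIV (\<lambda>x. F (x + h n *\<^sub>R v))"
          by (intro continuous_on_compose2[OF cont_F] continuous_intros) auto
        show "compact ((\<lambda>x. x - h n *\<^sub>R v) ` K)"
          using F(2) by (rule compact_translation_subtract)
        show "F (x + h n *\<^sub>R v) = 0" if "x \<notin> (\<lambda>x. x - h n *\<^sub>R v) ` K" for x
          using that by (intro F(3)) (auto simp: image_iff algebra_simps)
      qed
    qed
    have "(\<integral>x. w x * F (x + h n *\<^sub>R v) \<partial>lborel) = (\<integral>x. w (x + h n *\<^sub>R v) * F (x + h n *\<^sub>R v) \<partial>lborel)"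
      by (simp add: w_inv)
    also have "\<dots> = (\<integral>x. w x * F x \<partial>lborel)"
      by (rule integral_lborel_translate[where f = "\<lambda>x. w x * F x"]) measurable
    finally have "(\<integral>x. w x * F (x + h n *\<^sub>R v) - w x * F x \<partial>lborel) = 0"
      using int2 int_wF by simp
    moreover have "s n x = (w x * F (x + h n *\<^sub>R v) - w x * F x) / h n" for x
      by (simp add: s_def right_diff_distrib diff_divide_distrib)
    ultimately show ?thesis
      by simp
  qed
  ultimately show ?thesis
    by (simp add: LIMSEQ_const_iff)
qed

section \<open>The domain and its test functions\<close>

lemma open_Omega: "open (Omega :: ('a::euclidean_space \<times> 'b::euclidean_space) set)"
  unfolding Omega_def by (intro open_Times) auto

lemma Omega_iff: "x \<in> Omega \<longleftrightarrow> fst x \<noteq> 0"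
  by (auto simp: Omega_def mem_Times_iff)

lemma sets_Omega [simp]: "(Omega :: ('a::euclidean_space \<times> 'b::euclidean_space) set) \<in> sets lebesgue"
  using sets_completionI_sets[of Omega lborel] borel_open[OF open_Omega] by simp

text \<open>A cylinder over a null set is null by Fubini. This lets a coefficient depending on the
  first variable be altered on a null set of that variable.\<close>

lemma AE_fst:
  assumes "AE y in lborel. P y"
  shows "AE x in (lborel :: ('a::euclidean_space \<times> 'b::euclidean_space) measure). P (fst x)"
proof -
  obtain N where N: "N \<in> null_sets lborel" "\<And>y. y \<notin> N \<Longrightarrow> P y"
    using AE_E3[OF assms] by auto
  have "AE x in lborel \<Otimes>\<^sub>M (lborel :: 'b measure). fst x \<notin> N"
  proof (rule lborel_pair.AE_pair_measure)
    have [measurable]: "N \<in> sets lborel"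
      using N(1) by auto
    show "{x \<in> space (lborel \<Otimes>\<^sub>M (lborel :: 'b measure)). fst x \<notin> N} \<in> sets (lborel \<Otimes>\<^sub>M lborel)"
      by measurable
    show "AE x in lborel. AE y in lborel. fst (x, y :: 'b) \<notin> N"
      using AE_not_in[OF N(1)] by auto
  qed
  then have "AE x in (lborel :: ('a \<times> 'b) measure). fst x \<notin> N"
    unfolding lborel_prod .
  then show ?thesis
    by (rule eventually_mono) (rule N(2))
qed

lemma AE_Omega: "AE x in lborel. x \<in> Omega"
  using AE_fst[OF AE_lborel_singleton[of 0]] by (simp add: Omega_iff)

text \<open>The forms are defined with Lebesgue measure on \<open>Omega\<close>, whereas
  translation, scaling and product formulas are used for \<open>lborel\<close> on the whole space.
  The passage is possible because the complement of \<open>Omega\<close> is a null set.\<close>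

lemma lebesgue_on_Omega_conv_lborel:
  fixes f g :: "'a::euclidean_space \<times> 'b::euclidean_space \<Rightarrow> real"
  assumes g: "g \<in> borel_measurable borel" and fg: "AE x in lborel. f x = g x"
  shows "integrable (lebesgue_on Omega) f \<longleftrightarrow> integrable lborel g"
    and "(LINT x|lebesgue_on Omega. f x) = (\<integral>x. g x \<partial>lborel)"
proof -
  have AE: "AE x in lebesgue. g x = indicator Omega x *\<^sub>R f x"
    using AE_completion[OF AE_Omega] AE_completion[OF fg] by eventually_elim simp
  have g': "g \<in> borel_measurable lebesgue"
    using g by (intro measurable_completion) simp
  \<comment> \<open>Completeness of Lebesgue measure: agreement almost everywhere with the Borel
    function \<open>g\<close> is enough for measurability.\<close>
  then have f': "(\<lambda>x. indicator Omega x *\<^sub>R f x) \<in> borel_measurable lebesgue"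
    using AE by (rule borel_measurable_AE)
  have "integrable (lebesgue_on Omega) f \<longleftrightarrow> integrable lebesgue (\<lambda>x. indicator Omega x *\<^sub>R f x)"
    by (intro integrable_restrict_space) simp
  also have "\<dots> \<longleftrightarrow> integrable lebesgue g"
    using g' f' AE by (intro integrable_cong_AE) auto
  also have "\<dots> \<longleftrightarrow> integrable lborel g"
    using g by (intro integrable_completion) simp
  finally show "integrable (lebesgue_on Omega) f \<longleftrightarrow> integrable lborel g" .
  have "(LINT x|lebesgue_on Omega. f x) = (\<integral>x. indicator Omega x *\<^sub>R f x \<partial>lebesgue)"
    by (intro integral_restrict_space) simp
  also have "\<dots> = (\<integral>x. g x \<partial>lebesgue)"
    using g' f' AE by (intro integral_cong_AE) auto
  also have "\<dots> = (\<integral>x. g x \<partial>lborel)"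
    using g by (intro integral_completion) simp
  finally show "(LINT x|lebesgue_on Omega. f x) = (\<integral>x. g x \<partial>lborel)" .
qed

text \<open>Clipping a Borel representative to the interval from 0 to \<open>\<bar>B\<bar>\<close>
  makes both bounds hold at every point, including the origin and the exceptional null set, where
  nothing is known about \<open>b\<close>.\<close>

lemma bounded_borel_version:
  fixes b :: "'a::euclidean_space \<Rightarrow> real"
  assumes "b \<in> borel_measurable (lebesgue_on (UNIV - {0}))"
    and "\<And>y. y \<noteq> 0 \<Longrightarrow> b y > 0" and "bounded (b ` (UNIV - {0}))"
  obtains b' B where "b' \<in> borel_measurable borel" "\<And>y. 0 \<le> b' y" "\<And>y. b' y \<le> B"
    "AE y in lborel. b y = b' y"
proof -
  obtain B where "\<forall>z\<in>b ` (UNIV - {0}). norm z \<le> B"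
    using assms(3) by (auto simp: bounded_iff)
  then have "\<bar>b y\<bar> \<le> B" if "y \<noteq> 0" for y
    using that by auto
  then have B: "b y \<le> B" if "y \<noteq> 0" for y
    using that abs_le_D1 by blast
  have "(\<lambda>y. if y \<in> UNIV - {0} then b y else 0) \<in> borel_measurable (completion lborel)"
    using assms(1) by (subst borel_measurable_if) (auto simp: lborelD open_delete)
  then obtain g where g: "g \<in> borel_measurable lborel"
      "AE y in lborel. (if y \<in> UNIV - {0} then b y else 0) = g y"
    using completion_ex_borel_measurable_real by blast
  have 1: "(\<lambda>y. max 0 (min \<bar>B\<bar> (g y))) \<in> borel_measurable borel"
    using g(1) by simp
  have "AE y in lborel. b y = max 0 (min \<bar>B\<bar> (g y))"
    using g(2) AE_lborel_singleton[of 0]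
  proof eventually_elim
    case (elim y)
    then show ?case
      using assms(2)[of y] B[of y] by auto
  qed
  then show ?thesis
    using that[OF 1, of "\<bar>B\<bar>"] by auto
qed

lemma test_functions_compact_support:
  assumes "f \<in> test_functions S"
  obtains K where "compact K" "K \<subseteq> S" "\<And>x. x \<notin> K \<Longrightarrow> f x = 0"
proof (rule that)
  show "compact (closure {x. f x \<noteq> 0})" "closure {x. f x \<noteq> 0} \<subseteq> S"
    using assms by (auto simp: test_functions_def)
  show "f x = 0" if "x \<notin> closure {x. f x \<noteq> 0}" for x
    using that closure_subset[of "{x. f x \<noteq> 0}"] by auto
qed

lemma test_functionsI:
  assumes "\<And>k. C_k k f" "compact K" "K \<subseteq> S" "\<And>x. x \<notin> K \<Longrightarrow> f x = 0"
  shows "f \<in> test_functions S"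
proof -
  have "closure {x. f x \<noteq> 0} \<subseteq> K"
    using assms by (intro closure_minimal) (auto simp: compact_imp_closed)
  moreover from this have "compact (closure {x. f x \<noteq> 0})"
    using compact_Int_closed[OF assms(2) closed_closure[of "{x. f x \<noteq> 0}"]] by (simp add: Int_absorb1)
  ultimately show ?thesis
    using assms by (auto simp: test_functions_def)
qed

lemma test_functions_smooth: "f \<in> test_functions S \<Longrightarrow> C_on k UNIV f"
  by (simp add: test_functions_def C_k_iff_C_on[symmetric])

lemma test_functions_has_derivative:
  "f \<in> test_functions S \<Longrightarrow> (f has_derivative frechet_derivative f (at x)) (at x)"
  by (rule C_on_has_derivative[of 0 UNIV]) (auto simp only: test_functions_smooth)

lemma test_functions_lincomb:
  assumes f: "f \<in> test_functions S" and g: "g \<in> test_functions S"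
  shows "(\<lambda>x. s * f x + t * g x) \<in> test_functions S"
proof -
  obtain K where K: "compact K" "K \<subseteq> S" "\<And>x. x \<notin> K \<Longrightarrow> f x = 0"
    using test_functions_compact_support[OF f] by metis
  obtain L where L: "compact L" "L \<subseteq> S" "\<And>x. x \<notin> L \<Longrightarrow> g x = 0"
    using test_functions_compact_support[OF g] by metis
  show ?thesis
  proof (rule test_functionsI)
    show "C_k k (\<lambda>x. s * f x + t * g x)" for k
      unfolding C_k_iff_C_on
      by (intro C_on_add C_on_cmult test_functions_smooth[OF f] test_functions_smooth[OF g] open_UNIV)
    show "compact (K \<union> L)" "K \<union> L \<subseteq> S"
      using K L by auto
  qed (use K L in auto)
qed

lemma pd_lincomb:
  assumes "f \<in> test_functions S" "g \<in> test_functions S"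
  shows "pd (\<lambda>x. s * f x + t * g x) v x = s * pd f v x + t * pd g v x"
proof -
  have "((\<lambda>x. s * f x + t * g x) has_derivative
      (\<lambda>h. s * frechet_derivative f (at x) h + t * frechet_derivative g (at x) h)) (at x)"
    by (intro derivative_intros test_functions_has_derivative[OF assms(1)] test_functions_has_derivative[OF assms(2)])
  then show ?thesis
    by (rule frechet_derivative_at[THEN fun_cong, symmetric])
qed

text \<open>\<open>S\<close> and the complement of \<open>K\<close> are open and cover the space,
  and on the second the function is constantly zero. Products with weights that are singular at
  \<open>x\<^sub>1 = 0\<close> become globally smooth in this way.\<close>

lemma C_on_extend:
  assumes "open S" "C_on k S f" "compact K" "K \<subseteq> S" "\<And>x. x \<notin> K \<Longrightarrow> f x = 0"
  shows "C_on k UNIV f"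
proof -
  have "open (- K)"
    using assms(3) by (intro open_Compl compact_imp_closed)
  moreover from this have "C_on k (- K) f"
    by (rule C_on_cong[OF _ _ C_on_const[of k _ 0]]) (simp add: assms(5))
  moreover have "S \<union> - K = UNIV"
    using assms(4) by auto
  ultimately show ?thesis
    using C_on_Un[of S "- K"] assms(1,2) by metis
qed

lemma C_on_mult_compact_support:
  assumes "open S" "C_on k S g" "C_on k UNIV f" "compact K" "K \<subseteq> S" "\<And>x. x \<notin> K \<Longrightarrow> f x = 0"
  shows "C_on k UNIV (\<lambda>x. g x * f x)"
  by (rule C_on_extend[OF assms(1) C_on_mult[OF assms(1,2) C_on_subset[OF assms(3)]] assms(4,5)])
    (simp_all add: assms(6))

text \<open>The norm is the square root of a polynomial that is positive on
  \<open>Omega\<close>.\<close>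

lemma C_on_norm_fst:
  "C_on k (Omega :: ('a::euclidean_space \<times> 'b::euclidean_space) set) (\<lambda>x. norm (fst x))"
proof -
  have "C_on k Omega (\<lambda>x :: 'a \<times> 'b. \<Sum>i\<in>Basis. (fst x \<bullet> i) * (fst x \<bullet> i))"
    by (intro C_on_sum C_on_mult C_on_linear open_Omega bounded_linear_inner_left_comp bounded_linear_fst)
  then have inner: "C_on k Omega (\<lambda>x :: 'a \<times> 'b. fst x \<bullet> fst x)"
    by (simp only: euclidean_inner[symmetric])
  have "C_on k Omega (\<lambda>x :: 'a \<times> 'b. (fst x \<bullet> fst x) powr (1/2))"
    by (rule C_on_compose[OF open_Omega open_greaterThan _ C_on_powr inner]) (auto simp: Omega_iff)
  then show ?thesis
    by (rule C_on_cong[OF open_Omega, rotated]) (simp add: powr_half_sqrt norm_eq_sqrt_inner)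
qed

lemma C_on_radial:
  assumes "C_on k {0<..} g"
  shows "C_on k (Omega :: ('a::euclidean_space \<times> 'b::euclidean_space) set) (\<lambda>x. g (norm (fst x)))"
  by (rule C_on_compose[OF open_Omega open_greaterThan _ assms C_on_norm_fst]) (auto simp: Omega_iff)

lemma C_on_c_fun: "C_on k {0<..} (c_fun \<delta> \<delta>')"
proof -
  have "C_on k {0<..} (\<lambda>s::real. 1 + s)"
    by (intro C_on_add C_on_const C_on_linear bounded_linear_ident open_greaterThan)
  then have "C_on k {0<..} (\<lambda>s::real. (1 + s) powr (\<delta>' - \<delta>))"
    by (rule C_on_compose[OF open_greaterThan open_greaterThan _ C_on_powr, rotated]) auto
  then show ?thesis
    unfolding c_fun_def by (intro C_on_mult C_on_powr open_greaterThan)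
qed

lemma C_on_c_Omega: "C_on k Omega (c_Omega \<delta> \<delta>')"
  unfolding c_Omega_def d_Omega_eq by (rule C_on_radial[OF C_on_c_fun])

lemma borel_measurable_c_Omega [measurable]:
  "(c_Omega \<delta> \<delta>' :: 'a::euclidean_space \<times> 'b::euclidean_space \<Rightarrow> real) \<in> borel_measurable borel"
proof -
  have [measurable]: "(\<lambda>x :: 'a \<times> 'b. norm (fst x)) \<in> borel_measurable borel"
    by (intro borel_measurable_continuous_onI continuous_intros)
  show ?thesis
    unfolding c_Omega_def d_Omega_eq c_fun_def by measurable
qed

lemma c_Omega_nonneg: "0 \<le> c_Omega \<delta> \<delta>' x"
  by (simp add: c_Omega_def c_fun_def)

section \<open>Closability of forms of symmetric operators\<close>

lemma L2_diff_sq_integrable: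
  assumes "f \<in> L2 S" "g \<in> L2 S"
  shows "integrable (lebesgue_on S) (\<lambda>x. (f x - g x)\<^sup>2)"
proof (rule Bochner_Integration.integrable_bound[where f = "\<lambda>x. 2 * (f x)\<^sup>2 + 2 * (g x)\<^sup>2"])
  show "integrable (lebesgue_on S) (\<lambda>x. 2 * (f x)\<^sup>2 + 2 * (g x)\<^sup>2)"
    using assms by (auto simp: L2_def)
  show "(\<lambda>x. (f x - g x)\<^sup>2) \<in> borel_measurable (lebesgue_on S)"
    using assms by (auto simp: L2_def)
  have "(f x - g x)\<^sup>2 \<le> 2 * (f x)\<^sup>2 + 2 * (g x)\<^sup>2" for x
    using zero_le_power2[of "f x + g x"] by (simp add: power2_eq_square algebra_simps)
  then show "AE x in lebesgue_on S. norm ((f x - g x)\<^sup>2) \<le> norm (2 * (f x)\<^sup>2 + 2 * (g x)\<^sup>2)"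
    by auto
qed

lemma L2_inner_self: "L2_inner S f f = (LINT x|lebesgue_on S. (f x)\<^sup>2)" for f :: "'a::euclidean_space \<Rightarrow> real"
  by (simp add: L2_inner_def power2_eq_square)

lemma L2_inner_self_nonneg: "0 \<le> L2_inner S f f" for f :: "'a::euclidean_space \<Rightarrow> real"
  by (simp add: L2_inner_self)

lemma L2_inner_diff_le:
  assumes "f \<in> L2 S" "g \<in> L2 S" "h \<in> L2 S"
  shows "L2_inner S (\<lambda>x. f x - g x) (\<lambda>x. f x - g x)
    \<le> 2 * L2_inner S (\<lambda>x. f x - h x) (\<lambda>x. f x - h x) + 2 * L2_inner S (\<lambda>x. g x - h x) (\<lambda>x. g x - h x)"
proof -
  have "(f x - g x)\<^sup>2 \<le> 2 * (f x - h x)\<^sup>2 + 2 * (g x - h x)\<^sup>2" for x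
    using zero_le_power2[of "(f x - h x) + (g x - h x)"] by (simp add: power2_eq_square algebra_simps)
  then have "(LINT x|lebesgue_on S. (f x - g x)\<^sup>2)
      \<le> (LINT x|lebesgue_on S. 2 * (f x - h x)\<^sup>2 + 2 * (g x - h x)\<^sup>2)"
    using assms by (intro integral_mono) (auto intro!: L2_diff_sq_integrable)
  then show ?thesis
    using assms by (simp add: L2_inner_self L2_diff_sq_integrable)
qed

text \<open>The assumption \<open>weak\<close> holds when \<open>q\<close> is the form of a symmetric operator with domain \<open>D\<close>;
  it is what makes the form closable.\<close>

locale symmetric_form =
  fixes S :: "'a::euclidean_space set" and D :: "('a \<Rightarrow> real) set"
    and q :: "('a \<Rightarrow> real) \<Rightarrow> real" and Q :: "('a \<Rightarrow> real) \<Rightarrow> ('a \<Rightarrow> real) \<Rightarrow> real"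
  assumes D_L2: "f \<in> D \<Longrightarrow> f \<in> L2 S"
    and D_lincomb: "f \<in> D \<Longrightarrow> g \<in> D \<Longrightarrow> (\<lambda>x. s * f x + t * g x) \<in> D"
    and q_lincomb: "f \<in> D \<Longrightarrow> g \<in> D \<Longrightarrow>
      q (\<lambda>x. s * f x + t * g x) = s\<^sup>2 * q f + 2 * s * t * Q f g + t\<^sup>2 * q g"
    and q_nonneg: "f \<in> D \<Longrightarrow> 0 \<le> q f"
    and weak: "f \<in> D \<Longrightarrow> (\<And>n. u n \<in> D) \<Longrightarrow> (\<lambda>n. L2_inner S (u n) (u n)) \<longlonglongrightarrow> 0 \<Longrightarrow>
      (\<lambda>n. Q f (u n)) \<longlonglongrightarrow> 0"
begin

lemma D_diff: "f \<in> D \<Longrightarrow> g \<in> D \<Longrightarrow> (\<lambda>x. f x - g x) \<in> D"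
  using D_lincomb[of f g 1 "-1"] by simp

lemma q_diff: "f \<in> D \<Longrightarrow> g \<in> D \<Longrightarrow> q (\<lambda>x. f x - g x) = q f - 2 * Q f g + q g"
  using q_lincomb[of f g 1 "-1"] by simp

lemma q_diff_commute:
  assumes "f \<in> D" "g \<in> D"
  shows "q (\<lambda>x. f x - g x) = q (\<lambda>x. g x - f x)"
  using q_lincomb[of "\<lambda>x. f x - g x" "\<lambda>x. f x - g x" "-1" 0] assms D_diff by simp

text \<open>The form is only known to be semidefinite, so \<open>q g = 0\<close> needs its own
  argument: there \<open>q (f + t g)\<close> is affine in \<open>t\<close> and nonnegative for all
  \<open>t\<close>, which forces the slope to vanish. Otherwise the form is evaluated at
  \<open>q g * f - Q f g * g\<close>.\<close>

lemma Cauchy_Schwarz_form: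
  assumes f: "f \<in> D" and g: "g \<in> D"
  shows "(Q f g)\<^sup>2 \<le> q f * q g"
proof (cases "q g = 0")
  case False
  then have pos: "q g > 0"
    using q_nonneg[OF g] by simp
  have "0 \<le> q (\<lambda>x. q g * f x + (- Q f g) * g x)"
    using q_nonneg[OF D_lincomb[OF f g, of "q g" "- Q f g"]] .
  also have "\<dots> = q g * (q f * q g - (Q f g)\<^sup>2)"
    unfolding q_lincomb[OF f g] by (simp add: power2_eq_square algebra_simps)
  finally show ?thesis
    using pos by (simp add: zero_le_mult_iff)
next
  case True
  have "Q f g = 0"
  proof (rule ccontr)
    assume "Q f g \<noteq> 0"
    \<comment> \<open>At this value of \<open>t\<close> the affine function
      \<open>q f + 2 * t * Q f g\<close> would equal -1.\<close>
    then have "2 * (- (q f + 1) / (2 * Q f g)) * Q f g = - (q f + 1)"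
      by simp
    moreover have "0 \<le> q f + 2 * t * Q f g" for t
      using q_nonneg[OF D_lincomb[OF f g, of 1 t]] q_lincomb[OF f g, of 1 t] True by simp
    from this[of "- (q f + 1) / (2 * Q f g)"] have "0 \<le> q f + 2 * (- (q f + 1) / (2 * Q f g)) * Q f g" .
    ultimately show False
      by linarith
  qed
  then show ?thesis
    using True by simp
qed

lemma sqrt_form_triangle:
  assumes f: "f \<in> D" and g: "g \<in> D"
  shows "sqrt (q (\<lambda>x. f x - g x)) \<le> sqrt (q f) + sqrt (q g)"
proof (rule real_le_lsqrt)
  have "- Q f g \<le> sqrt (q f * q g)"
    using Cauchy_Schwarz_form[OF f g] by (intro real_le_rsqrt) simp
  then show "q (\<lambda>x. f x - g x) \<le> (sqrt (q f) + sqrt (q g))\<^sup>2"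
    using q_nonneg[OF f] q_nonneg[OF g] by (simp add: q_diff[OF f g] power2_sum real_sqrt_mult)
qed (use q_nonneg f g in auto)

lemma sqrt_form_Lipschitz:
  assumes f: "f \<in> D" and g: "g \<in> D"
  shows "\<bar>sqrt (q f) - sqrt (q g)\<bar> \<le> sqrt (q (\<lambda>x. f x - g x))"
proof -
  have "sqrt (q f) \<le> sqrt (q (\<lambda>x. f x - g x)) + sqrt (q g)" if "f \<in> D" "g \<in> D" for f g
  proof -
    have "q (\<lambda>x. 0 - g x) = q g"
      using q_lincomb[OF that(2,2), of "-1" 0] by simp
    moreover have "(\<lambda>x. 0 - g x) \<in> D"
      using D_lincomb[OF that(2,2), of "-1" 0] by simp
    ultimately show ?thesis
      using sqrt_form_triangle[OF D_diff[OF that], of "\<lambda>x. 0 - g x"] by simp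
  qed
  from this[OF f g] this[OF g f] show ?thesis
    unfolding q_diff_commute[OF g f] by linarith
qed

text \<open>Let \<open>m \<rightarrow> \<infinity>\<close> in \<open>q u\<^sub>n \<le> q u\<^sub>n + q u\<^sub>m = q (u\<^sub>n - u\<^sub>m) + 2 Q u\<^sub>n u\<^sub>m\<close>.\<close>

lemma form_null_sequence:
  assumes u: "\<And>n. u n \<in> D" and L2: "(\<lambda>n. L2_inner S (u n) (u n)) \<longlonglongrightarrow> 0"
    and Cauchy: "\<And>e. e > 0 \<Longrightarrow> \<exists>N. \<forall>m\<ge>N. \<forall>n\<ge>N. q (\<lambda>x. u m x - u n x) < e"
  shows "(\<lambda>n. q (u n)) \<longlonglongrightarrow> 0"
proof (rule LIMSEQ_I)
  fix e :: real assume "e > 0"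
  then obtain N where N: "\<And>m n. m \<ge> N \<Longrightarrow> n \<ge> N \<Longrightarrow> q (\<lambda>x. u m x - u n x) < e / 2"
    using Cauchy[of "e / 2"] by auto
  have "q (u n) \<le> e / 2" if n: "n \<ge> N" for n
  proof (rule LIMSEQ_le_const)
    show "(\<lambda>m. e / 2 + 2 * Q (u n) (u m)) \<longlonglongrightarrow> e / 2"
      using tendsto_add[OF tendsto_const tendsto_mult_left[OF weak[OF u u L2]]] by fastforce
    have "q (u n) \<le> e / 2 + 2 * Q (u n) (u m)" if "m \<ge> N" for m
      using N[OF n that] q_diff[OF u u, of n m] q_nonneg[OF u, of m] by simp
    then show "\<exists>N. \<forall>m\<ge>N. q (u n) \<le> e / 2 + 2 * Q (u n) (u m)"
      by blast
  qed
  then show "\<exists>no. \<forall>n\<ge>no. norm (q (u n) - 0) < e"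
    using q_nonneg[OF u] \<open>e > 0\<close> by (intro exI[of _ N]) fastforce
qed

lemma form_approx_convergent:
  assumes "form_approx S D q u f"
  shows "convergent (\<lambda>n. sqrt (q (u n)))"
proof -
  have u: "u n \<in> D" for n
    using assms by (simp add: form_approx_def)
  have "Cauchy (\<lambda>n. sqrt (q (u n)))"
  proof (rule metric_CauchyI)
    fix e :: real assume e: "e > 0"
    then obtain N where N: "\<And>m n. m \<ge> N \<Longrightarrow> n \<ge> N \<Longrightarrow> q (\<lambda>x. u m x - u n x) < e\<^sup>2"
      using assms unfolding form_approx_def by (meson zero_less_power)
    have "dist (sqrt (q (u m))) (sqrt (q (u n))) < e" if "m \<ge> N" "n \<ge> N" for m n
      using sqrt_form_Lipschitz[OF u u, of m n] real_sqrt_less_mono[OF N[OF that]] e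
      by (simp add: dist_real_def)
    then show "\<exists>N. \<forall>m\<ge>N. \<forall>n\<ge>N. dist (sqrt (q (u m))) (sqrt (q (u n))) < e"
      by blast
  qed
  then show ?thesis
    by (rule Cauchy_convergent)
qed

text \<open>The difference of two approximating sequences tends to zero in \<open>L2\<close> and is
  again Cauchy for the form, so \<open>form_null_sequence\<close> applies. This is where closability
  turns into independence of the sequence.\<close>

lemma form_approx_diff_null:
  assumes f: "f \<in> L2 S" and uf: "form_approx S D q u f" and vf: "form_approx S D q v f"
  shows "(\<lambda>n. q (\<lambda>x. u n x - v n x)) \<longlonglongrightarrow> 0"
proof -
  have u: "u n \<in> D" and v: "v n \<in> D" for n
    using uf vf by (simp_all add: form_approx_def)
  show ?thesis
  proof (rule form_null_sequence)
    show "(\<lambda>x. u n x - v n x) \<in> D" for n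
      by (intro D_diff u v)
    let ?I = "\<lambda>u n. L2_inner S (\<lambda>x. u n x - f x) (\<lambda>x. u n x - f x)"
    have lim: "(\<lambda>n. 2 * ?I u n + 2 * ?I v n) \<longlonglongrightarrow> 0"
      using uf vf unfolding form_approx_def by (auto intro!: tendsto_eq_intros)
    show "(\<lambda>n. L2_inner S (\<lambda>x. u n x - v n x) (\<lambda>x. u n x - v n x)) \<longlonglongrightarrow> 0"
      by (rule tendsto_sandwich[OF _ _ tendsto_const lim])
        (auto intro!: always_eventually L2_inner_self_nonneg L2_inner_diff_le D_L2 u v f)
    fix e :: real assume e: "e > 0"
    then have e4: "e / 4 > 0"
      by simp
    obtain M where M: "\<And>m n. m \<ge> M \<Longrightarrow> n \<ge> M \<Longrightarrow> q (\<lambda>x. u m x - u n x) < e / 4"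
      using uf e4 unfolding form_approx_def by meson
    obtain N where N: "\<And>m n. m \<ge> N \<Longrightarrow> n \<ge> N \<Longrightarrow> q (\<lambda>x. v m x - v n x) < e / 4"
      using vf e4 unfolding form_approx_def by meson
    have "q (\<lambda>x. (u m x - v m x) - (u n x - v n x)) < e" if "m \<ge> max M N" "n \<ge> max M N" for m n
    proof -
      let ?f = "\<lambda>x. u m x - u n x" and ?g = "\<lambda>x. v m x - v n x"
      have fg: "?f \<in> D" "?g \<in> D"
        by (intro D_diff u v)+
      have "0 \<le> q (\<lambda>x. 1 * ?f x + 1 * ?g x)"
        by (intro q_nonneg D_lincomb fg)
      then have "q (\<lambda>x. ?f x - ?g x) \<le> 2 * q ?f + 2 * q ?g"
        unfolding q_lincomb[OF fg] q_diff[OF fg] by simp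
      then show ?thesis
        using M[of m n] N[of m n] that by (simp add: algebra_simps)
    qed
    then show "\<exists>N. \<forall>m\<ge>N. \<forall>n\<ge>N. q (\<lambda>x. (u m x - v m x) - (u n x - v n x)) < e"
      by blast
  qed
qed

text \<open>Since \<open>sqrt (q f)\<close> is a seminorm, its reverse triangle inequality yields
  both facts that the definite description requires: the values along one sequence converge, and
  sequences with form-null difference share their limit.\<close>

lemma closure_form_tendsto:
  assumes f: "f \<in> L2 S" and uf: "form_approx S D q u f"
  shows "(\<lambda>n. q (u n)) \<longlonglongrightarrow> closure_form S D q f"
proof -
  obtain l where l: "(\<lambda>n. sqrt (q (u n))) \<longlonglongrightarrow> l"
    using form_approx_convergent[OF uf] by (auto simp: convergent_def)
  have u: "u n \<in> D" for n
    using uf by (simp add: form_approx_def)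
  have lim: "(\<lambda>n. q (v n)) \<longlonglongrightarrow> l\<^sup>2" if vf: "form_approx S D q v f" for v
  proof -
    have v: "v n \<in> D" for n
      using vf by (simp add: form_approx_def)
    have "(\<lambda>n. sqrt (q (\<lambda>x. u n x - v n x))) \<longlonglongrightarrow> 0"
      using tendsto_real_sqrt[OF form_approx_diff_null[OF f uf vf]] by simp
    then have "(\<lambda>n. sqrt (q (u n)) - sqrt (q (v n))) \<longlonglongrightarrow> 0"
      by (rule Lim_null_comparison[rotated])
        (auto intro!: always_eventually sqrt_form_Lipschitz u v)
    from tendsto_power[OF tendsto_diff[OF l this], of 2]
    show ?thesis
      using q_nonneg[OF v] by simp
  qed
  have "closure_form S D q f = l\<^sup>2"
    unfolding closure_form_def
  proof (rule the_equality)
    show "\<forall>u. form_approx S D q u f \<longrightarrow> (\<lambda>n. q (u n)) \<longlonglongrightarrow> l\<^sup>2"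
      using lim by blast
    show "v = l\<^sup>2" if "\<forall>u. form_approx S D q u f \<longrightarrow> (\<lambda>n. q (u n)) \<longlonglongrightarrow> v" for v
      using that uf lim[OF uf] LIMSEQ_unique by blast
  qed
  then show ?thesis
    using lim[OF uf] by simp
qed

lemma form_approx_const:
  assumes "f \<in> D"
  shows "form_approx S D q (\<lambda>_. f) f"
proof -
  have "q (\<lambda>_. 0) = 0"
    using q_lincomb[OF assms assms, of 0 0] by simp
  then show ?thesis
    using assms by (simp add: form_approx_def L2_inner_def)
qed

lemma closure_form_eq: "f \<in> D \<Longrightarrow> closure_form S D q f = q f"
  using closure_form_tendsto[OF D_L2 form_approx_const] by (simp add: LIMSEQ_const_iff)

lemma subset_closure_dom: "D \<subseteq> closure_dom S D q"
  unfolding closure_dom_def using D_L2 form_approx_const by blast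

end

section \<open>The Grushin form on test functions\<close>

lemma integral_by_parts_pd:
  fixes a g w :: "'a::euclidean_space \<Rightarrow> real"
  assumes a: "C_on (Suc 0) UNIV a" and g: "C_on (Suc 0) UNIV g" "compact K" "\<And>x. x \<notin> K \<Longrightarrow> g x = 0"
    and w: "w \<in> borel_measurable borel" "\<And>x. \<bar>w x\<bar> \<le> B" "\<And>x t. w (x + t *\<^sub>R v) = w x" and v: "v \<in> Basis"
  shows "(\<integral>x. w x * (a x * pd g v x) \<partial>lborel) = (\<integral>x. - (w x * pd a v x) * g x \<partial>lborel)"
proof -
  have "((\<lambda>x. a x * g x) has_derivative
      (\<lambda>h. a x * frechet_derivative g (at x) h + frechet_derivative a (at x) h * g x)) (at x)" for x
    by (intro has_derivative_mult C_on_has_derivative[OF a] C_on_has_derivative[OF g(1)]) auto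
  then have pd: "pd (\<lambda>x. a x * g x) v x = a x * pd g v x + pd a v x * g x" for x
    by (rule frechet_derivative_at[THEN fun_cong, symmetric])
  have "C_k (Suc 0) (\<lambda>x. a x * g x)"
    unfolding C_k_iff_C_on by (intro C_on_mult a g) auto
  then have "(\<integral>x. w x * pd (\<lambda>x. a x * g x) v x \<partial>lborel) = 0"
    using g(3) by (intro integral_pd_eq_0[OF _ g(2) _ w v]) auto
  moreover have cont: "continuous_on UNIV a" "continuous_on UNIV g"
      "continuous_on UNIV (pd a v)" "continuous_on UNIV (pd g v)"
    using a g(1) v C_on_imp_continuous_on[OF a] C_on_imp_continuous_on[OF g(1)] by auto
  have "integrable lborel (\<lambda>x. a x * pd g v x)" "integrable lborel (\<lambda>x. pd a v x * g x)"
    by (rule integrable_compact_support[OF _ g(2)];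
        use cont g(3) pd_eq_0_outside[OF compact_imp_closed[OF g(2)] g(3)] in
          \<open>auto intro!: continuous_on_mult\<close>)+
  then have "integrable lborel (\<lambda>x. w x * (a x * pd g v x))" "integrable lborel (\<lambda>x. w x * (pd a v x * g x))"
    by (intro integrable_bounded_mult[OF _ w(1,2)]; simp)+
  ultimately show ?thesis
    unfolding pd by (simp add: distrib_left mult.assoc)
qed

text \<open>Cauchy-Schwarz in the form
  \<open>\<bar>w * g\<bar> \<le> t * w\<^sup>2 + g\<^sup>2 / t\<close>. First \<open>t\<close> is
  fixed so that the first integral is at most \<open>e / 2\<close>, then \<open>n\<close> is taken
  large for the second. The summand 1 in the denominator of \<open>t\<close> covers
  \<open>A = 0\<close>.\<close>

lemma integral_mult_null_sequence:
  fixes w :: "'a \<Rightarrow> real"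
  assumes w: "w \<in> borel_measurable M" "integrable M (\<lambda>x. (w x)\<^sup>2)"
    and g: "\<And>n. g n \<in> borel_measurable M" "\<And>n. integrable M (\<lambda>x. (g n x)\<^sup>2)"
    and lim: "(\<lambda>n. \<integral>x. (g n x)\<^sup>2 \<partial>M) \<longlonglongrightarrow> 0"
  shows "(\<lambda>n. \<integral>x. w x * g n x \<partial>M) \<longlonglongrightarrow> 0"
proof (rule LIMSEQ_I)
  fix e :: real assume e: "e > 0"
  define A where "A = (\<integral>x. (w x)\<^sup>2 \<partial>M)"
  define t where "t = e / (2 * (A + 1))"
  have A: "A \<ge> 0"
    by (simp add: A_def)
  then have t: "t > 0"
    using e by (simp add: t_def)
  have tA: "t * A \<le> e / 2"
    using A e by (simp add: t_def field_simps)
  obtain N where N: "\<And>n. n \<ge> N \<Longrightarrow> (\<integral>x. (g n x)\<^sup>2 \<partial>M) < t * (e / 2)"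
    using LIMSEQ_D[OF lim, of "t * (e / 2)"] e t by force
  have "\<bar>\<integral>x. w x * g n x \<partial>M\<bar> < e" if n: "n \<ge> N" for n
  proof -
    have "\<bar>w x * g n x\<bar> \<le> t * (w x)\<^sup>2 + (g n x)\<^sup>2 / t" for x
    proof -
      have "0 \<le> (t * \<bar>w x\<bar> - \<bar>g n x\<bar>)\<^sup>2 / t"
        using t by simp
      also have "\<dots> = t * \<bar>w x\<bar>\<^sup>2 + \<bar>g n x\<bar>\<^sup>2 / t - 2 * (\<bar>w x\<bar> * \<bar>g n x\<bar>)"
        using t by (simp add: power2_diff add_divide_distrib diff_divide_distrib)
          (simp add: power2_eq_square)
      also have "\<dots> = t * (w x)\<^sup>2 + (g n x)\<^sup>2 / t - 2 * \<bar>w x * g n x\<bar>"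
        by (simp add: abs_mult)
      finally show ?thesis
        by linarith
    qed
    then have "\<bar>\<integral>x. w x * g n x \<partial>M\<bar> \<le> (\<integral>x. t * (w x)\<^sup>2 + (g n x)\<^sup>2 / t \<partial>M)"
      using w g t by (intro order_trans[OF integral_abs_bound] integral_mono'[where f = "\<lambda>x. t * (w x)\<^sup>2 + (g n x)\<^sup>2 / t"]) auto
    also have "\<dots> = t * A + (\<integral>x. (g n x)\<^sup>2 \<partial>M) / t"
      using w g by (simp add: A_def)
    also have "\<dots> < e / 2 + e / 2"
      using N[OF n] tA t by (intro add_le_less_mono) (simp_all add: pos_divide_less_eq mult.commute)
    also have "\<dots> = e"
      by simp
    finally show ?thesis .
  qed
  then show "\<exists>no. \<forall>n\<ge>no. norm ((\<integral>x. w x * g n x \<partial>M) - 0) < e"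
    by auto
qed

lemma test_functions_pd_smooth:
  assumes "f \<in> test_functions S" "v \<in> Basis"
  shows "C_on k UNIV (pd f v)"
  using test_functions_smooth[OF assms(1), of "Suc k"] assms(2) by simp

lemma borel_measurable_test_function:
  "f \<in> test_functions S \<Longrightarrow> f \<in> borel_measurable borel"
  using test_functions_smooth[of f S 0] by (intro borel_measurable_continuous_onI) simp

lemma test_functions_sq_integrable:
  assumes "f \<in> test_functions S"
  shows "integrable lborel (\<lambda>x. (f x)\<^sup>2)"
proof -
  obtain K where K: "compact K" "\<And>x. x \<notin> K \<Longrightarrow> f x = 0"
    using test_functions_compact_support[OF assms] by metis
  show ?thesis
    by (rule integrable_compact_support[OF _ K(1)])
      (use test_functions_smooth[OF assms, of 0] K in \<open>auto intro: continuous_on_power\<close>)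
qed

lemma test_functions_L2: "f \<in> test_functions Omega \<Longrightarrow> f \<in> L2 Omega"
  using lebesgue_on_Omega_conv_lborel(1)[of "\<lambda>x. (f x)\<^sup>2"] test_functions_sq_integrable[of f Omega]
    borel_measurable_test_function[of f Omega]
  by (auto simp: L2_def intro!: measurable_restrict_space1 measurable_completion)

lemma L2_inner_test_function:
  assumes "f \<in> test_functions Omega"
  shows "L2_inner Omega f f = (\<integral>x. (f x)\<^sup>2 \<partial>lborel)"
  unfolding L2_inner_self
  using borel_measurable_test_function[OF assms] by (intro lebesgue_on_Omega_conv_lborel(2)) auto

text \<open>A basis vector of the product is \<open>(i, 0)\<close> or \<open>(0, j)\<close>, so the
  test \<open>snd v = 0\<close> tells the two kinds apart. With one coefficient per direction, both
  gradient terms merge into a single sum over \<open>Basis\<close>.\<close>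

definition grushin_weight ::
  "real \<Rightarrow> real \<Rightarrow> ('a::euclidean_space \<Rightarrow> real) \<Rightarrow> 'a \<times> 'b::euclidean_space \<Rightarrow> 'a \<times> 'b \<Rightarrow> real" where
  "grushin_weight \<delta> \<delta>' b v x = (if snd v = 0 then c_Omega \<delta> \<delta>' x else b (fst x))"

definition grushin_bilinear ::
  "real \<Rightarrow> real \<Rightarrow> ('a::euclidean_space \<Rightarrow> real) \<Rightarrow>
   ('a \<times> 'b::euclidean_space \<Rightarrow> real) \<Rightarrow> ('a \<times> 'b \<Rightarrow> real) \<Rightarrow> real" where
  "grushin_bilinear \<delta> \<delta>' b f g =
     (\<Sum>v\<in>Basis. \<integral>x. grushin_weight \<delta> \<delta>' b v x * (pd f v x * pd g v x) \<partial>lborel)"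

locale bounded_borel_coefficient =
  fixes b :: "'a::euclidean_space \<Rightarrow> real" and B :: real
  assumes b_measurable [measurable]: "b \<in> borel_measurable borel"
    and b_nonneg: "0 \<le> b y" and b_le: "b y \<le> B"
begin

lemma borel_measurable_b_fst [measurable]:
  "(\<lambda>x :: 'a \<times> 'b::euclidean_space. b (fst x)) \<in> borel_measurable borel"
proof -
  have "(fst :: 'a \<times> 'b \<Rightarrow> 'a) \<in> borel_measurable borel"
    by (intro borel_measurable_continuous_onI continuous_intros)
  then show ?thesis
    by measurable
qed

lemma grushin_weight_nonneg: "0 \<le> grushin_weight \<delta> \<delta>' b v x"
  by (simp add: grushin_weight_def c_Omega_nonneg b_nonneg)

lemma integrable_grushin_weight:
  fixes f g :: "'a \<times> 'b::euclidean_space \<Rightarrow> real"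
  assumes f: "f \<in> test_functions Omega" and g: "g \<in> test_functions Omega" and v: "v \<in> Basis"
  shows "integrable lborel (\<lambda>x. grushin_weight \<delta> \<delta>' b v x * (pd f v x * pd g v x))"
proof -
  obtain K where K: "compact K" "K \<subseteq> Omega" "\<And>x. x \<notin> K \<Longrightarrow> f x = 0"
    using test_functions_compact_support[OF f] by metis
  have smooth: "C_on k UNIV (\<lambda>x. pd f v x * pd g v x)" for k
    by (intro C_on_mult test_functions_pd_smooth[OF f v] test_functions_pd_smooth[OF g v]) simp
  have 0: "pd f v x = 0" if "x \<notin> K" for x
    by (rule pd_eq_0_outside[OF compact_imp_closed[OF K(1)] K(3) that])
  show ?thesis
  proof (cases "snd v = 0")
    case True
    have "C_on 0 UNIV (\<lambda>x. c_Omega \<delta> \<delta>' x * (pd f v x * pd g v x))"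
      by (rule C_on_mult_compact_support[OF open_Omega C_on_c_Omega smooth K(1,2)]) (simp add: 0)
    then show ?thesis
      using True 0 by (intro integrable_compact_support[OF _ K(1)]) (simp_all add: grushin_weight_def)
  next
    case False
    have "integrable lborel (\<lambda>x. pd f v x * pd g v x)"
      using smooth[of 0] 0 by (intro integrable_compact_support[OF _ K(1)]) simp_all
    then have "integrable lborel (\<lambda>x. b (fst x) * (pd f v x * pd g v x))"
      using b_nonneg b_le by (intro integrable_bounded_mult[where B = B and w = "\<lambda>x. b (fst x)"]) (auto simp: abs_of_nonneg)
    then show ?thesis
      using False by (simp add: grushin_weight_def)
  qed
qed

text \<open>The witness \<open>w\<close> is the part of the operator belonging to direction
  \<open>v\<close>, applied to \<open>f\<close>. For \<open>x\<^sub>1\<close> directions the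
  coefficient \<open>c\<close> is smooth on \<open>Omega\<close> and is differentiated together with
  \<open>f\<close>; for \<open>x\<^sub>2\<close> directions \<open>b\<close> stays in front, because
  translation along \<open>v\<close> leaves \<open>fst x\<close> unchanged.\<close>

lemma grushin_weight_adjoint:
  fixes f :: "'a \<times> 'b::euclidean_space \<Rightarrow> real"
  assumes f: "f \<in> test_functions Omega" and v: "v \<in> Basis"
  obtains w where "w \<in> borel_measurable borel" "integrable lborel (\<lambda>x. (w x)\<^sup>2)"
    "\<And>g. g \<in> test_functions Omega \<Longrightarrow>
       (\<integral>x. grushin_weight \<delta> \<delta>' b v x * (pd f v x * pd g v x) \<partial>lborel) = (\<integral>x. w x * g x \<partial>lborel)"
proof -
  obtain K where K: "compact K" "K \<subseteq> Omega" "\<And>x. x \<notin> K \<Longrightarrow> f x = 0"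
    using test_functions_compact_support[OF f] by metis
  have 0: "pd f v x = 0" if "x \<notin> K" for x
    by (rule pd_eq_0_outside[OF compact_imp_closed[OF K(1)] K(3) that])
  show ?thesis
  proof (cases "snd v = 0")
    case True
    define a where "a x = c_Omega \<delta> \<delta>' x * pd f v x" for x
    have a: "C_on k UNIV a" for k
      unfolding a_def
      by (rule C_on_mult_compact_support[OF open_Omega C_on_c_Omega test_functions_pd_smooth[OF f v] K(1,2) 0])
    have cont: "continuous_on UNIV (pd a v)"
      using a[of "Suc 0"] v by simp
    have a0: "pd a v x = 0" if "x \<notin> K" for x
      by (rule pd_eq_0_outside[OF compact_imp_closed[OF K(1)] _ that]) (simp add: a_def 0)
    show ?thesis
    proof (rule that[of "\<lambda>x. - pd a v x"])
      show "(\<lambda>x. - pd a v x) \<in> borel_measurable borel"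
        using cont by (intro borel_measurable_continuous_onI continuous_on_minus)
      show "integrable lborel (\<lambda>x. (- pd a v x)\<^sup>2)"
        using cont a0 by (intro integrable_compact_support[OF _ K(1)]) (auto intro: continuous_on_power)
      fix g :: "'a \<times> 'b \<Rightarrow> real" assume g: "g \<in> test_functions Omega"
      obtain L where L: "compact L" "\<And>x. x \<notin> L \<Longrightarrow> g x = 0"
        using test_functions_compact_support[OF g] by metis
      \<comment> \<open>The coefficient has been absorbed into the smooth function \<open>a\<close>,
        so the weight in the integration by parts is the constant 1.\<close>
      have "(\<integral>x. 1 * (a x * pd g v x) \<partial>lborel) = (\<integral>x. - (1 * pd a v x) * g x \<partial>lborel)"
        by (rule integral_by_parts_pd[OF a test_functions_smooth[OF g] L, where B = 1]) (use v in auto)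
      then show "(\<integral>x. grushin_weight \<delta> \<delta>' b v x * (pd f v x * pd g v x) \<partial>lborel)
          = (\<integral>x. - pd a v x * g x \<partial>lborel)"
        using True by (simp add: grushin_weight_def a_def mult.assoc)
    qed
  next
    case False
    then have v1: "fst v = 0"
      using v by (auto simp: Basis_prod_def)
    have cont: "continuous_on UNIV (pd (pd f v) v)"
      using test_functions_pd_smooth[OF f v, of "Suc 0"] v by simp
    have f0: "pd (pd f v) v x = 0" if "x \<notin> K" for x
      by (rule pd_eq_0_outside[OF compact_imp_closed[OF K(1)] _ that]) (simp add: 0)
    have [measurable]: "pd (pd f v) v \<in> borel_measurable borel"
      using cont by (rule borel_measurable_continuous_onI)
    have bB: "\<bar>b y\<bar> \<le> B" for y
      using b_nonneg[of y] b_le[of y] by simp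
    show ?thesis
    proof (rule that[of "\<lambda>x. - (b (fst x) * pd (pd f v) v x)"])
      show "(\<lambda>x. - (b (fst x) * pd (pd f v) v x)) \<in> borel_measurable borel"
        by measurable
      have "integrable lborel (\<lambda>x. (b (fst x))\<^sup>2 * (pd (pd f v) v x)\<^sup>2)"
      proof (rule integrable_bounded_mult)
        show "integrable lborel (\<lambda>x. (pd (pd f v) v x)\<^sup>2)"
          using cont f0 by (intro integrable_compact_support[OF _ K(1)]) (auto intro: continuous_on_power)
        show "\<bar>(b (fst x))\<^sup>2\<bar> \<le> B\<^sup>2" for x :: "'a \<times> 'b"
          using power_mono[OF b_le b_nonneg, of "fst x" 2] by simp
      qed measurable
      then show "integrable lborel (\<lambda>x. (- (b (fst x) * pd (pd f v) v x))\<^sup>2)"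
        by (simp add: power_mult_distrib)
      fix g :: "'a \<times> 'b \<Rightarrow> real" assume g: "g \<in> test_functions Omega"
      obtain L where L: "compact L" "\<And>x. x \<notin> L \<Longrightarrow> g x = 0"
        using test_functions_compact_support[OF g] by metis
      have "(\<integral>x. b (fst x) * (pd f v x * pd g v x) \<partial>lborel)
          = (\<integral>x. - (b (fst x) * pd (pd f v) v x) * g x \<partial>lborel)"
        by (rule integral_by_parts_pd[OF test_functions_pd_smooth[OF f v] test_functions_smooth[OF g] L _ bB])
          (use v v1 in auto)
      then show "(\<integral>x. grushin_weight \<delta> \<delta>' b v x * (pd f v x * pd g v x) \<partial>lborel)
          = (\<integral>x. - (b (fst x) * pd (pd f v) v x) * g x \<partial>lborel)"
        using False by (simp add: grushin_weight_def)
    qed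
  qed
qed

text \<open>The analytic content is the axiom \<open>weak\<close>: by
  \<open>grushin_weight_adjoint\<close>, pairing with \<open>f\<close> is a finite sum of integrals
  against fixed square-integrable functions. The other axioms are algebra and integrability.\<close>

lemma symmetric_form_grushin:
  "symmetric_form (Omega :: ('a \<times> 'b::euclidean_space) set) (test_functions Omega)
     (\<lambda>f. grushin_bilinear \<delta> \<delta>' b f f) (grushin_bilinear \<delta> \<delta>' b)"
proof
  fix f g :: "'a \<times> 'b \<Rightarrow> real" and s t :: real
  assume f: "f \<in> test_functions Omega"
  show "f \<in> L2 Omega"
    using f by (rule test_functions_L2)
  show "0 \<le> grushin_bilinear \<delta> \<delta>' b f f"
    unfolding grushin_bilinear_def
    by (intro sum_nonneg integral_nonneg_AE AE_I2 mult_nonneg_nonneg grushin_weight_nonneg zero_le_square)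
  assume g: "g \<in> test_functions Omega"
  show "(\<lambda>x. s * f x + t * g x) \<in> test_functions Omega"
    using f g by (rule test_functions_lincomb)
  have "grushin_bilinear \<delta> \<delta>' b (\<lambda>x. s * f x + t * g x) (\<lambda>x. s * f x + t * g x) =
      (\<Sum>v\<in>Basis. s\<^sup>2 * (\<integral>x. grushin_weight \<delta> \<delta>' b v x * (pd f v x * pd f v x) \<partial>lborel) +
        2 * s * t * (\<integral>x. grushin_weight \<delta> \<delta>' b v x * (pd f v x * pd g v x) \<partial>lborel) +
        t\<^sup>2 * (\<integral>x. grushin_weight \<delta> \<delta>' b v x * (pd g v x * pd g v x) \<partial>lborel))"
    unfolding grushin_bilinear_def pd_lincomb[OF f g]
  proof (intro sum.cong refl)
    fix v :: "'a \<times> 'b" assume v: "v \<in> Basis"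
    note int = integrable_grushin_weight[OF f f v, of \<delta> \<delta>'] integrable_grushin_weight[OF f g v, of \<delta> \<delta>']
      integrable_grushin_weight[OF g g v, of \<delta> \<delta>']
    have "grushin_weight \<delta> \<delta>' b v x * ((s * pd f v x + t * pd g v x) * (s * pd f v x + t * pd g v x)) =
        s\<^sup>2 * (grushin_weight \<delta> \<delta>' b v x * (pd f v x * pd f v x)) +
        2 * s * t * (grushin_weight \<delta> \<delta>' b v x * (pd f v x * pd g v x)) +
        t\<^sup>2 * (grushin_weight \<delta> \<delta>' b v x * (pd g v x * pd g v x))" for x
      by (simp add: power2_eq_square algebra_simps)
    then show "(\<integral>x. grushin_weight \<delta> \<delta>' b v x * ((s * pd f v x + t * pd g v x) * (s * pd f v x + t * pd g v x)) \<partial>lborel) =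
        s\<^sup>2 * (\<integral>x. grushin_weight \<delta> \<delta>' b v x * (pd f v x * pd f v x) \<partial>lborel) +
        2 * s * t * (\<integral>x. grushin_weight \<delta> \<delta>' b v x * (pd f v x * pd g v x) \<partial>lborel) +
        t\<^sup>2 * (\<integral>x. grushin_weight \<delta> \<delta>' b v x * (pd g v x * pd g v x) \<partial>lborel)"
      using int by simp
  qed
  then show "grushin_bilinear \<delta> \<delta>' b (\<lambda>x. s * f x + t * g x) (\<lambda>x. s * f x + t * g x) =
      s\<^sup>2 * grushin_bilinear \<delta> \<delta>' b f f + 2 * s * t * grushin_bilinear \<delta> \<delta>' b f g +
      t\<^sup>2 * grushin_bilinear \<delta> \<delta>' b g g"
    unfolding sum.distrib sum_distrib_left[symmetric] grushin_bilinear_def[symmetric] .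
next
  fix f :: "'a \<times> 'b \<Rightarrow> real" and u :: "nat \<Rightarrow> 'a \<times> 'b \<Rightarrow> real"
  assume f: "f \<in> test_functions Omega" and u: "\<And>n. u n \<in> test_functions Omega"
    and lim: "(\<lambda>n. L2_inner Omega (u n) (u n)) \<longlonglongrightarrow> 0"
  have "(\<lambda>n. \<integral>x. grushin_weight \<delta> \<delta>' b v x * (pd f v x * pd (u n) v x) \<partial>lborel) \<longlonglongrightarrow> 0"
    if v: "v \<in> Basis" for v
  proof -
    obtain w where w: "w \<in> borel_measurable borel" "integrable lborel (\<lambda>x. (w x)\<^sup>2)"
      and eq: "\<And>g. g \<in> test_functions Omega \<Longrightarrow>
       (\<integral>x. grushin_weight \<delta> \<delta>' b v x * (pd f v x * pd g v x) \<partial>lborel) = (\<integral>x. w x * g x \<partial>lborel)"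
      using grushin_weight_adjoint[OF f v, of \<delta> \<delta>'] by blast
    have "(\<lambda>n. \<integral>x. w x * u n x \<partial>lborel) \<longlonglongrightarrow> 0"
    proof (rule integral_mult_null_sequence)
      show "w \<in> borel_measurable lborel"
        using w(1) by simp
      show "u n \<in> borel_measurable lborel" for n
        using borel_measurable_test_function[OF u] by simp
      show "integrable lborel (\<lambda>x. (u n x)\<^sup>2)" for n
        using u by (rule test_functions_sq_integrable)
      show "(\<lambda>n. \<integral>x. (u n x)\<^sup>2 \<partial>lborel) \<longlonglongrightarrow> 0"
        using lim by (simp only: L2_inner_test_function[OF u])
    qed fact
    then show ?thesis
      using eq u by simp
  qed
  then show "(\<lambda>n. grushin_bilinear \<delta> \<delta>' b f (u n)) \<longlonglongrightarrow> 0"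
    unfolding grushin_bilinear_def by (intro tendsto_null_sum)
qed

end

lemma sum_Basis_prod:
  fixes f :: "'a::euclidean_space \<times> 'b::euclidean_space \<Rightarrow> real"
  shows "(\<Sum>v\<in>Basis. f v) = (\<Sum>i\<in>Basis. f (i, 0)) + (\<Sum>j\<in>Basis. f (0, j))"
proof -
  have "inj_on (\<lambda>u. (u :: 'a, 0 :: 'b)) Basis" "inj_on (\<lambda>u. (0 :: 'a, u :: 'b)) Basis"
    by (auto intro!: inj_onI)
  then show ?thesis
    unfolding Basis_prod_def
    by (subst sum.union_disjoint) (auto simp: Basis_prod_def sum.reindex)
qed

lemma inner_grad1: "grad1 f x \<bullet> grad1 f x = (\<Sum>i\<in>Basis. pd f (i, 0) x * pd f (i, 0) x)"
  by (subst euclidean_inner) (simp add: grad1_def inner_sum_left_Basis)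

lemma inner_grad2: "grad2 f x \<bullet> grad2 f x = (\<Sum>j\<in>Basis. pd f (0, j) x * pd f (0, j) x)"
  by (subst euclidean_inner) (simp add: grad2_def inner_sum_left_Basis)

text \<open>Links the form as defined, with the original coefficient \<open>b0\<close> on
  \<open>Omega\<close>, to the bilinear form over \<open>lborel\<close> in which all calculations
  take place; the integrands differ on a null set only.\<close>

lemma (in bounded_borel_coefficient) grushin_form0_eq:
  fixes f :: "'a \<times> 'b::euclidean_space \<Rightarrow> real"
  assumes f: "f \<in> test_functions Omega" and b0: "AE y in lborel. b0 y = b y"
  shows "grushin_form0 \<delta> \<delta>' b0 f = grushin_bilinear \<delta> \<delta>' b f f"
proof -
  have meas: "pd f v \<in> borel_measurable borel" if "v \<in> Basis" for v
    using test_functions_pd_smooth[OF f that, of 0] by (intro borel_measurable_continuous_onI) simp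
  have B1: "(i, 0 :: 'b) \<in> Basis" if "i \<in> Basis" for i :: 'a
    using that by (simp add: Basis_prod_def)
  have B2: "(0 :: 'a, j) \<in> Basis" if "j \<in> Basis" for j :: 'b
    using that by (simp add: Basis_prod_def)
  have "L2_inner Omega (grad1 f) (\<lambda>x. c_Omega \<delta> \<delta>' x *\<^sub>R grad1 f x)
      = (\<integral>x. (\<Sum>i\<in>Basis. c_Omega \<delta> \<delta>' x * (pd f (i, 0) x * pd f (i, 0) x)) \<partial>lborel)"
    unfolding L2_inner_def
    by (rule lebesgue_on_Omega_conv_lborel(2))
      (auto simp: inner_grad1 sum_distrib_left intro!: borel_measurable_sum borel_measurable_times meas B1)
  also have "\<dots> = (\<Sum>i\<in>Basis. \<integral>x. grushin_weight \<delta> \<delta>' b (i, 0) x * (pd f (i, 0) x * pd f (i, 0) x) \<partial>lborel)"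
    using integrable_grushin_weight[OF f f B1, of _ \<delta> \<delta>'] by (subst Bochner_Integration.integral_sum) (auto simp: grushin_weight_def)
  finally have 1: "L2_inner Omega (grad1 f) (\<lambda>x. c_Omega \<delta> \<delta>' x *\<^sub>R grad1 f x) =
      (\<Sum>i\<in>Basis. \<integral>x. grushin_weight \<delta> \<delta>' b (i, 0) x * (pd f (i, 0) x * pd f (i, 0) x) \<partial>lborel)" .
  have "L2_inner Omega (grad2 f) (\<lambda>x. b0 (fst x) *\<^sub>R grad2 f x)
      = (\<integral>x. (\<Sum>j\<in>Basis. b (fst x) * (pd f (0, j) x * pd f (0, j) x)) \<partial>lborel)"
    unfolding L2_inner_def
  proof (rule lebesgue_on_Omega_conv_lborel(2))
    show "AE x in lborel. grad2 f x \<bullet> b0 (fst x) *\<^sub>R grad2 f x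
        = (\<Sum>j\<in>Basis. b (fst x) * (pd f (0, j) x * pd f (0, j) x))"
      using AE_fst[OF b0] by eventually_elim (simp add: inner_grad2 sum_distrib_left)
  qed (intro borel_measurable_sum borel_measurable_times meas B2 borel_measurable_b_fst)
  also have "\<dots> = (\<Sum>j\<in>Basis. \<integral>x. grushin_weight \<delta> \<delta>' b (0, j) x * (pd f (0, j) x * pd f (0, j) x) \<partial>lborel)"
    using integrable_grushin_weight[OF f f B2, of _ \<delta> \<delta>']
    by (subst Bochner_Integration.integral_sum) (auto simp: grushin_weight_def nonzero_Basis intro!: sum.cong)
  finally show ?thesis
    unfolding grushin_form0_def grushin_bilinear_def sum_Basis_prod 1 by simp
qed

lemma (in bounded_borel_coefficient) symmetric_form_grushin_form0:
  assumes b0: "AE y in lborel. b0 y = b y"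
  shows "symmetric_form (Omega :: ('a \<times> 'b::euclidean_space) set) (test_functions Omega)
     (grushin_form0 \<delta> \<delta>' b0) (grushin_bilinear \<delta> \<delta>' b)"
proof -
  interpret bilinear: symmetric_form "Omega :: ('a \<times> 'b) set" "test_functions Omega"
    "\<lambda>f. grushin_bilinear \<delta> \<delta>' b f f" "grushin_bilinear \<delta> \<delta>' b"
    by (rule symmetric_form_grushin)
  note eq = grushin_form0_eq[OF _ b0, where 'b = 'b, of _ \<delta> \<delta>']
  show ?thesis
    by unfold_locales
      (simp_all only: eq bilinear.D_lincomb bilinear.D_L2 bilinear.q_lincomb bilinear.q_nonneg bilinear.weak)
qed

section \<open>The Hardy inequality on test functions\<close>

definition hardy_weight ::
  "real \<Rightarrow> real \<Rightarrow> 'a::euclidean_space \<times> 'b::euclidean_space \<Rightarrow> real" where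
  "hardy_weight \<delta> \<delta>' x = c_Omega \<delta> \<delta>' x / (norm (fst x))\<^sup>2"

lemma hardy_weighted_sq: "(hardy_weighted \<delta> \<delta>' f x)\<^sup>2 = hardy_weight \<delta> \<delta>' x * (f x)\<^sup>2"
  using c_Omega_nonneg[of \<delta> \<delta>' x]
  by (simp add: hardy_weighted_def hardy_weight_def d_Omega_eq power_mult_distrib divide_inverse power_inverse)

lemma hardy_weight_nonneg: "0 \<le> hardy_weight \<delta> \<delta>' x"
  by (simp add: hardy_weight_def c_Omega_nonneg)

lemma borel_measurable_hardy_weight [measurable]:
  "(hardy_weight \<delta> \<delta>' :: 'a::euclidean_space \<times> 'b::euclidean_space \<Rightarrow> real) \<in> borel_measurable borel"
proof -
  have [measurable]: "(\<lambda>x :: 'a \<times> 'b. norm (fst x)) \<in> borel_measurable borel"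
    by (intro borel_measurable_continuous_onI continuous_intros)
  show ?thesis
    unfolding hardy_weight_def[abs_def] by measurable
qed

lemma hardy_weight_radial:
  "x \<in> Omega \<Longrightarrow> hardy_weight \<delta> \<delta>' x = norm (fst x) powr (\<delta> - 2) * (1 + norm (fst x)) powr (\<delta>' - \<delta>)"
  by (simp add: hardy_weight_def c_Omega_def c_fun_def d_Omega_eq Omega_iff powr_diff)

lemma C_on_hardy_weight: "C_on k Omega (hardy_weight \<delta> \<delta>')"
proof -
  have "C_on k {0<..} (\<lambda>s. c_fun \<delta> \<delta>' s * s powr (-2))"
    by (intro C_on_mult C_on_c_fun C_on_powr open_greaterThan)
  from C_on_radial[OF this] show ?thesis
    by (rule C_on_cong[OF open_Omega, rotated])
      (simp add: hardy_weight_def c_Omega_def d_Omega_eq Omega_iff powr_minus divide_inverse)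
qed

text \<open>The logarithmic derivative of the weight, times \<open>s\<close>, is
  \<open>\<delta> - 2 + (\<delta>' - \<delta>) * (s / (1 + s))\<close>. Apart from the -2 this is a
  convex combination of \<open>\<delta>\<close> and \<open>\<delta>'\<close>, hence at least their
  minimum.\<close>

lemma hardy_weight_has_derivative:
  fixes x :: "'a::euclidean_space \<times> 'b::euclidean_space"
  assumes x: "x \<in> Omega"
  obtains k' where "(hardy_weight \<delta> \<delta>' has_derivative (\<lambda>v. k' * (fst v \<bullet> fst x / norm (fst x)))) (at x)"
    and "(min \<delta> \<delta>' - 2) * hardy_weight \<delta> \<delta>' x \<le> norm (fst x) * k'"
proof -
  define s where "s = norm (fst x)"
  have s: "s > 0"
    using x by (simp add: s_def Omega_iff)
  define k' where "k' = (\<delta> - 2) * s powr (\<delta> - 2 - 1) * (1 + s) powr (\<delta>' - \<delta>)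
    + s powr (\<delta> - 2) * ((\<delta>' - \<delta>) * (1 + s) powr (\<delta>' - \<delta> - 1))"
  have "((\<lambda>y. 1 + y) has_real_derivative 1) (at s)"
    by (auto intro!: derivative_eq_intros)
  then have D1: "((\<lambda>y. (1 + y) powr (\<delta>' - \<delta>)) has_real_derivative
      (\<delta>' - \<delta>) * (1 + s) powr (\<delta>' - \<delta> - 1) * 1) (at s)"
    using s by (intro DERIV_chain2[OF has_real_derivative_powr]) auto
  have D2: "((\<lambda>y. y powr (\<delta> - 2)) has_real_derivative (\<delta> - 2) * s powr (\<delta> - 2 - 1)) (at s)"
    using s by (rule has_real_derivative_powr)
  have "((\<lambda>y. y powr (\<delta> - 2) * (1 + y) powr (\<delta>' - \<delta>)) has_real_derivative k') (at s)"
    by (rule DERIV_cong[OF DERIV_mult[OF D2 D1]]) (simp add: k'_def)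
  then have D: "((\<lambda>y. y powr (\<delta> - 2) * (1 + y) powr (\<delta>' - \<delta>)) has_derivative (\<lambda>h. k' * h)) (at s)"
    by (simp add: has_field_derivative_def)
  have "((\<lambda>x. norm (fst x)) has_derivative (\<lambda>v. fst v \<bullet> sgn (fst x))) (at x)"
    using has_derivative_compose[OF has_derivative_fst[OF has_derivative_ident] has_derivative_norm] x
    by (simp add: Omega_iff)
  from has_derivative_compose[OF this D[unfolded s_def]]
  have "((\<lambda>x. norm (fst x) powr (\<delta> - 2) * (1 + norm (fst x)) powr (\<delta>' - \<delta>)) has_derivative
      (\<lambda>v. k' * (fst v \<bullet> sgn (fst x)))) (at x)" .
  then have "(hardy_weight \<delta> \<delta>' has_derivative (\<lambda>v. k' * (fst v \<bullet> sgn (fst x)))) (at x)"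
    by (rule has_derivative_transform_within_open[OF _ open_Omega x]) (simp add: hardy_weight_radial)
  then have 1: "(hardy_weight \<delta> \<delta>' has_derivative (\<lambda>v. k' * (fst v \<bullet> fst x / norm (fst x)))) (at x)"
    by (simp add: sgn_div_norm divide_inverse mult.commute)
  have "s powr (\<delta> - 2 - 1) = s powr (\<delta> - 2) / s"
      "(1 + s) powr (\<delta>' - \<delta> - 1) = (1 + s) powr (\<delta>' - \<delta>) / (1 + s)"
    using s powr_diff[of s "\<delta> - 2" 1] powr_diff[of "1 + s" "\<delta>' - \<delta>" 1] by simp_all
  then have "s * k' = (\<delta> - 2) * (s powr (\<delta> - 2) * (1 + s) powr (\<delta>' - \<delta>))
      + s * (s powr (\<delta> - 2) * ((\<delta>' - \<delta>) * ((1 + s) powr (\<delta>' - \<delta>) / (1 + s))))"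
    using s by (simp add: k'_def distrib_left)
  also have "\<dots> = (\<delta> - 2 + (\<delta>' - \<delta>) * (s / (1 + s))) * hardy_weight \<delta> \<delta>' x"
    using x s by (simp add: hardy_weight_radial s_def[symmetric] field_simps)
  finally have 2: "s * k' = (\<delta> - 2 + (\<delta>' - \<delta>) * (s / (1 + s))) * hardy_weight \<delta> \<delta>' x" .
  have "min \<delta> \<delta>' * (1 + s) \<le> \<delta> + \<delta>' * s"
    using s mult_right_mono[of "min \<delta> \<delta>'" \<delta>' s] min.cobounded1[of \<delta> \<delta>']
    by (auto simp: distrib_left intro: add_mono)
  then have "min \<delta> \<delta>' \<le> (\<delta> + \<delta>' * s) / (1 + s)"
    using s by (simp add: pos_le_divide_eq)
  also have "\<dots> = \<delta> + (\<delta>' - \<delta>) * (s / (1 + s))"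
    using s by (simp add: field_simps)
  finally have "(min \<delta> \<delta>' - 2) * hardy_weight \<delta> \<delta>' x \<le> s * k'"
    unfolding 2 by (intro mult_right_mono hardy_weight_nonneg) simp
  with 1 show ?thesis
    using that unfolding s_def by blast
qed

lemma integrable_hardy_weight:
  fixes f :: "'a::euclidean_space \<times> 'b::euclidean_space \<Rightarrow> real"
  assumes f: "f \<in> test_functions Omega"
  shows "integrable lborel (\<lambda>x. hardy_weight \<delta> \<delta>' x * (f x)\<^sup>2)"
proof -
  obtain K where K: "compact K" "K \<subseteq> Omega" "\<And>x. x \<notin> K \<Longrightarrow> f x = 0"
    using test_functions_compact_support[OF f] by metis
  have "C_on 0 UNIV (\<lambda>x. (f x)\<^sup>2)"
    using test_functions_smooth[OF f, of 0] by (auto intro: continuous_on_power)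
  then have "C_on 0 UNIV (\<lambda>x. hardy_weight \<delta> \<delta>' x * (f x)\<^sup>2)"
    by (rule C_on_mult_compact_support[OF open_Omega C_on_hardy_weight _ K(1,2)]) (simp add: K)
  then show ?thesis
    using K by (intro integrable_compact_support[OF _ K(1)]) auto
qed

text \<open>With \<open>F\<^sub>i = h x\<^sub>i f\<^sup>2\<close> and \<open>h = c / |x\<^sub>1|\<^sup>2\<close>, expand \<open>c |\<nabla>f + (m/2) f x\<^sub>1 / |x\<^sub>1|\<^sup>2|\<^sup>2 \<ge> 0\<close> and use
  \<open>div (h x\<^sub>1) \<ge> m h\<close>.\<close>

lemma hardy_pointwise:
  fixes f :: "'a::euclidean_space \<times> 'b::euclidean_space \<Rightarrow> real"
  assumes m: "m = real DIM('a) + min \<delta> \<delta>' - 2" "m > 0"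
    and x: "x \<in> Omega" and f: "f \<in> test_functions Omega"
  shows "m\<^sup>2 / 4 * (hardy_weight \<delta> \<delta>' x * (f x)\<^sup>2)
      - m / 2 * (\<Sum>i\<in>Basis. pd (\<lambda>x. hardy_weight \<delta> \<delta>' x * (fst x \<bullet> i) * (f x)\<^sup>2) (i, 0) x)
    \<le> (\<Sum>i\<in>Basis. c_Omega \<delta> \<delta>' x * (pd f (i, 0) x * pd f (i, 0) x))"
proof -
  define s where "s = norm (fst x)"
  define h where "h = hardy_weight \<delta> \<delta>' x"
  have s: "s > 0"
    using x by (simp add: s_def Omega_iff)
  have c: "c_Omega \<delta> \<delta>' x = h * s\<^sup>2"
    using s by (simp add: h_def hardy_weight_def s_def)
  have h: "h \<ge> 0"
    by (simp add: h_def hardy_weight_nonneg)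
  obtain k' where k': "(hardy_weight \<delta> \<delta>' has_derivative (\<lambda>v. k' * (fst v \<bullet> fst x / norm (fst x)))) (at x)"
    and le: "(min \<delta> \<delta>' - 2) * hardy_weight \<delta> \<delta>' x \<le> norm (fst x) * k'"
    using hardy_weight_has_derivative[OF x] by metis
  have pdF: "pd (\<lambda>x. hardy_weight \<delta> \<delta>' x * (fst x \<bullet> i) * (f x)\<^sup>2) (i, 0) x
      = (k' * ((fst x \<bullet> i) * (fst x \<bullet> i)) / s + h) * (f x)\<^sup>2 + 2 * h * f x * ((fst x \<bullet> i) * pd f (i, 0) x)"
    if i: "i \<in> Basis" for i
  proof -
    have "((\<lambda>x. hardy_weight \<delta> \<delta>' x * (fst x \<bullet> i) * (f x * f x)) has_derivative
        (\<lambda>v. hardy_weight \<delta> \<delta>' x * (fst x \<bullet> i)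
            * (f x * frechet_derivative f (at x) v + frechet_derivative f (at x) v * f x)
          + (hardy_weight \<delta> \<delta>' x * (fst v \<bullet> i) + k' * (fst v \<bullet> fst x / norm (fst x)) * (fst x \<bullet> i))
            * (f x * f x))) (at x)"
      by (intro has_derivative_mult k' test_functions_has_derivative[OF f]
          has_derivative_inner_left has_derivative_fst has_derivative_ident)
    from frechet_derivative_at[OF this, THEN fun_cong, of "(i, 0)", symmetric]
    show ?thesis
      using i by (simp add: power2_eq_square h_def s_def inner_commute algebra_simps)
  qed
  have sum1: "(\<Sum>i\<in>Basis. (fst x \<bullet> i) * (fst x \<bullet> i)) = s\<^sup>2"
    by (simp add: s_def power2_norm_eq_inner euclidean_inner[symmetric])
  define T where "T = (\<Sum>i\<in>Basis. (fst x \<bullet> i) * pd f (i, 0) x)"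
  define G where "G = (\<Sum>i\<in>Basis. pd f (i, 0) x * pd f (i, 0) x)"
  have "(\<Sum>i\<in>Basis. pd (\<lambda>x. hardy_weight \<delta> \<delta>' x * (fst x \<bullet> i) * (f x)\<^sup>2) (i, 0) x)
      = (\<Sum>i\<in>Basis. (k' * (f x)\<^sup>2 / s) * ((fst x \<bullet> i) * (fst x \<bullet> i)) + h * (f x)\<^sup>2
          + 2 * h * f x * ((fst x \<bullet> i) * pd f (i, 0) x))"
    by (intro sum.cong refl) (simp add: pdF distrib_right)
  also have "\<dots> = (k' * (f x)\<^sup>2 / s) * s\<^sup>2 + DIM('a) * (h * (f x)\<^sup>2) + 2 * h * f x * T"
    by (simp only: sum.distrib sum_distrib_left[symmetric] sum1 T_def sum_constant) (simp add: algebra_simps)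
  also have "\<dots> = (s * k' + DIM('a) * h) * (f x)\<^sup>2 + 2 * h * f x * T"
    using s by (simp add: power2_eq_square field_simps)
  finally have div: "(\<Sum>i\<in>Basis. pd (\<lambda>x. hardy_weight \<delta> \<delta>' x * (fst x \<bullet> i) * (f x)\<^sup>2) (i, 0) x)
      = (s * k' + DIM('a) * h) * (f x)\<^sup>2 + 2 * h * f x * T" .
  have "m * h \<le> s * k' + DIM('a) * h"
    using le unfolding m s_def[symmetric] h_def[symmetric] by (simp add: algebra_simps)
  then have ge: "m * h * (f x)\<^sup>2 \<le> (s * k' + DIM('a) * h) * (f x)\<^sup>2"
    by (rule mult_right_mono) simp
  \<comment> \<open>As \<open>c = h * s\<^sup>2\<close>, moving one factor \<open>s\<close> into the
    square leaves the coefficient \<open>h\<close>, which multiplies \<open>(f x)\<^sup>2\<close> in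
    the claim.\<close>
  have "0 \<le> h * (\<Sum>i\<in>Basis. (s * pd f (i, 0) x + (m / 2) * f x * (fst x \<bullet> i) / s)\<^sup>2)"
    using h by (intro mult_nonneg_nonneg sum_nonneg) auto
  also have "(\<Sum>i\<in>Basis. (s * pd f (i, 0) x + (m / 2) * f x * (fst x \<bullet> i) / s)\<^sup>2)
      = (\<Sum>i\<in>Basis. s\<^sup>2 * (pd f (i, 0) x * pd f (i, 0) x) + m * f x * ((fst x \<bullet> i) * pd f (i, 0) x)
          + (m\<^sup>2 / 4) * (f x)\<^sup>2 / s\<^sup>2 * ((fst x \<bullet> i) * (fst x \<bullet> i)))"
    using s by (intro sum.cong refl) (simp add: power2_eq_square field_simps)
  also have "\<dots> = s\<^sup>2 * G + m * f x * T + (m\<^sup>2 / 4) * (f x)\<^sup>2 / s\<^sup>2 * s\<^sup>2"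
    by (simp only: sum.distrib sum_distrib_left[symmetric] sum1 T_def G_def)
  also have "\<dots> = s\<^sup>2 * G + m * f x * T + (m\<^sup>2 / 4) * (f x)\<^sup>2"
    using s by simp
  finally have pos: "0 \<le> h * s\<^sup>2 * G + m * h * f x * T + (m\<^sup>2 / 4) * h * (f x)\<^sup>2"
    by (simp add: algebra_simps)
  \<comment> \<open>The divergence supplies \<open>m\<^sup>2 / 2\<close> times
    \<open>h * (f x)\<^sup>2\<close> and the square consumes half of it; the terms containing
    \<open>T\<close> cancel.\<close>
  have "m / 2 * (m * h * (f x)\<^sup>2) \<le> m / 2 * ((s * k' + DIM('a) * h) * (f x)\<^sup>2)"
    using ge m(2) by (intro mult_left_mono) auto
  then have "m\<^sup>2 / 4 * (h * (f x)\<^sup>2) - m / 2 * ((s * k' + DIM('a) * h) * (f x)\<^sup>2 + 2 * h * f x * T) \<le> h * s\<^sup>2 * G"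
    using pos by (simp add: power2_eq_square algebra_simps)
  then show ?thesis
    unfolding div c h_def[symmetric] sum_distrib_left[symmetric] G_def[symmetric] .
qed

text \<open>The pointwise bound is corrected by the divergence of a compactly supported smooth
  field, whose integral is zero. The contribution of the \<open>x\<^sub>2\<close> directions to the
  form is nonnegative and is dropped.\<close>

lemma (in bounded_borel_coefficient) hardy_test_functions:
  fixes f :: "'a \<times> 'b::euclidean_space \<Rightarrow> real"
  assumes m: "m = real DIM('a) + min \<delta> \<delta>' - 2" "m > 0" and f: "f \<in> test_functions Omega"
  shows "m\<^sup>2 / 4 * (\<integral>x. hardy_weight \<delta> \<delta>' x * (f x)\<^sup>2 \<partial>lborel) \<le> grushin_bilinear \<delta> \<delta>' b f f"
proof -
  obtain K where K: "compact K" "K \<subseteq> Omega" "\<And>x. x \<notin> K \<Longrightarrow> f x = 0"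
    using test_functions_compact_support[OF f] by metis
  have B1: "(i, 0 :: 'b) \<in> Basis" if "i \<in> Basis" for i :: 'a
    using that by (simp add: Basis_prod_def)
  define F where "F i x = hardy_weight \<delta> \<delta>' x * (fst x \<bullet> i) * (f x)\<^sup>2" for i :: 'a and x :: "'a \<times> 'b"
  have F0: "F i x = 0" if "x \<notin> K" for i x
    using K(3)[OF that] by (simp add: F_def)
  have smooth: "C_on k UNIV (F i)" for k i
  proof -
    have lin: "bounded_linear (\<lambda>x :: 'a \<times> 'b. fst x \<bullet> i)"
      by (intro bounded_linear_inner_left_comp bounded_linear_fst)
    have "C_on k UNIV (\<lambda>x. f x * f x)"
      by (intro C_on_mult test_functions_smooth[OF f]) simp
    moreover have "C_on k Omega (\<lambda>x :: 'a \<times> 'b. hardy_weight \<delta> \<delta>' x * (fst x \<bullet> i))"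
      by (intro C_on_mult C_on_hardy_weight C_on_linear lin open_Omega)
    ultimately have "C_on k UNIV (\<lambda>x. hardy_weight \<delta> \<delta>' x * (fst x \<bullet> i) * (f x * f x))"
      using C_on_mult_compact_support[OF open_Omega _ _ K(1,2)] K(3) by simp
    then show ?thesis
      by (simp add: F_def[abs_def] power2_eq_square)
  qed
  have pdF0: "pd (F i) v x = 0" if "x \<notin> K" for i v x
    by (rule pd_eq_0_outside[OF compact_imp_closed[OF K(1)] F0 that])
  have int_F: "integrable lborel (pd (F i) (i, 0))" if "i \<in> Basis" for i
    using smooth[of "Suc 0" i] B1[OF that] pdF0 by (intro integrable_compact_support[OF _ K(1)]) auto
  have F_eq_0: "(\<integral>x. pd (F i) (i, 0) x \<partial>lborel) = 0" if "i \<in> Basis" for i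
    using integral_pd_eq_0[where F = "F i" and w = "\<lambda>_. 1" and B = 1 and v = "(i, 0)", OF _ K(1) F0] smooth B1[OF that]
    by (simp add: C_k_iff_C_on del: C_k.simps C_on.simps)
  have int_G: "integrable lborel (\<lambda>x. c_Omega \<delta> \<delta>' x * (pd f (i, 0) x * pd f (i, 0) x))" if "i \<in> Basis" for i
    using integrable_grushin_weight[OF f f B1[OF that], of \<delta> \<delta>'] by (simp add: grushin_weight_def)
  have "m\<^sup>2 / 4 * (\<integral>x. hardy_weight \<delta> \<delta>' x * (f x)\<^sup>2 \<partial>lborel)
      = (\<integral>x. m\<^sup>2 / 4 * (hardy_weight \<delta> \<delta>' x * (f x)\<^sup>2) - m / 2 * (\<Sum>i\<in>Basis. pd (F i) (i, 0) x) \<partial>lborel)"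
    using integrable_hardy_weight[OF f, of \<delta> \<delta>'] int_F F_eq_0
    by (simp add: Bochner_Integration.integral_sum)
  also have "\<dots> \<le> (\<integral>x. (\<Sum>i\<in>Basis. c_Omega \<delta> \<delta>' x * (pd f (i, 0) x * pd f (i, 0) x)) \<partial>lborel)"
  proof (rule integral_mono)
    fix x :: "'a \<times> 'b"
    show "m\<^sup>2 / 4 * (hardy_weight \<delta> \<delta>' x * (f x)\<^sup>2) - m / 2 * (\<Sum>i\<in>Basis. pd (F i) (i, 0) x)
        \<le> (\<Sum>i\<in>Basis. c_Omega \<delta> \<delta>' x * (pd f (i, 0) x * pd f (i, 0) x))"
    \<comment> \<open>\<open>hardy_pointwise\<close> requires a point of \<open>Omega\<close>. Off
      the support, in particular where \<open>x\<^sub>1 = 0\<close>, the left side vanishes.\<close>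
    proof (cases "x \<in> K")
      case True
      then show ?thesis
        using hardy_pointwise[OF m _ f, of x] K(2) unfolding F_def[abs_def] by blast
    next
      case False
      then show ?thesis
        by (simp add: K(3) pdF0 sum_nonneg c_Omega_nonneg)
    qed
  qed (use integrable_hardy_weight[OF f, of \<delta> \<delta>'] int_F int_G in auto)
  also have "\<dots> = (\<Sum>i\<in>Basis. \<integral>x. grushin_weight \<delta> \<delta>' b (i, 0) x * (pd f (i, 0) x * pd f (i, 0) x) \<partial>lborel)"
    using int_G by (simp add: Bochner_Integration.integral_sum grushin_weight_def)
  also have "\<dots> \<le> grushin_bilinear \<delta> \<delta>' b f f"
    unfolding grushin_bilinear_def sum_Basis_prod
    by (simp, intro sum_nonneg integral_nonneg_AE AE_I2) (simp add: grushin_weight_nonneg)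
  finally show ?thesis .
qed

section \<open>The Hardy inequality on the closure\<close>

lemma form_approx_AE_subseq:
  fixes S :: "'a::euclidean_space set"
  assumes "form_approx S D q u f" "f \<in> L2 S" "D \<subseteq> L2 S"
  obtains r where "strict_mono r" "AE x in lebesgue_on S. (\<lambda>n. u (r n) x) \<longlonglongrightarrow> f x"
proof -
  have "integrable (lebesgue_on S) (\<lambda>x. (u n x - f x)\<^sup>2)" for n
    using assms by (intro L2_diff_sq_integrable) (auto simp: form_approx_def)
  moreover have "(\<lambda>n. LINT x|lebesgue_on S. norm ((u n x - f x)\<^sup>2)) \<longlonglongrightarrow> 0"
    using assms(1) by (simp add: form_approx_def L2_inner_self)
  ultimately obtain r where r: "strict_mono r" "AE x in lebesgue_on S. (\<lambda>n. (u (r n) x - f x)\<^sup>2) \<longlonglongrightarrow> 0"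
    using tendsto_L1_AE_subseq[of "lebesgue_on S" "\<lambda>n x. (u n x - f x)\<^sup>2"] by auto
  have "AE x in lebesgue_on S. (\<lambda>n. u (r n) x) \<longlonglongrightarrow> f x"
    using r(2)
  proof eventually_elim
    case (elim x)
    from tendsto_real_sqrt[OF elim] have "(\<lambda>n. \<bar>u (r n) x - f x\<bar>) \<longlonglongrightarrow> 0"
      by simp
    then show ?case
      using LIM_zero_iff tendsto_rabs_zero_iff by blast
  qed
  with r(1) show ?thesis
    by (rule that)
qed

text \<open>Extended nonnegative integrals are used because finiteness of the weighted integral of
  \<open>\<phi>\<close> is itself part of the claim: the bound obtained from Fatou's lemma gives
  membership in \<open>L2\<close> and the inequality at once.\<close>

lemma (in bounded_borel_coefficient) hardy_closure:
  fixes \<phi> :: "'a \<times> 'b::euclidean_space \<Rightarrow> real"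
  assumes m: "m = real DIM('a) + min \<delta> \<delta>' - 2" "m > 0"
    and b0: "AE y in lborel. b0 y = b y" and \<phi>: "\<phi> \<in> grushin_dom \<delta> \<delta>' b0"
  shows "hardy_weighted \<delta> \<delta>' \<phi> \<in> L2 Omega"
    and "m\<^sup>2 / 4 * L2_inner Omega (hardy_weighted \<delta> \<delta>' \<phi>) (hardy_weighted \<delta> \<delta>' \<phi>) \<le> grushin_form \<delta> \<delta>' b0 \<phi>"
proof -
  interpret symmetric_form "Omega :: ('a \<times> 'b) set" "test_functions Omega"
    "grushin_form0 \<delta> \<delta>' b0" "grushin_bilinear \<delta> \<delta>' b"
    using b0 by (rule symmetric_form_grushin_form0)
  let ?M = "lebesgue_on Omega :: ('a \<times> 'b) measure"
  let ?h = "hardy_weighted \<delta> \<delta>'"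
  obtain u where L2: "\<phi> \<in> L2 Omega" and u: "form_approx Omega (test_functions Omega) (grushin_form0 \<delta> \<delta>' b0) u \<phi>"
    using \<phi> by (auto simp: grushin_dom_def closure_dom_def)
  have u_test: "u n \<in> test_functions Omega" for n
    using u by (simp add: form_approx_def)
  obtain r where r: "strict_mono r" "AE x in ?M. (\<lambda>n. u (r n) x) \<longlonglongrightarrow> \<phi> x"
    using form_approx_AE_subseq[OF u L2] test_functions_L2 by blast
  have lim: "(\<lambda>n. grushin_form0 \<delta> \<delta>' b0 (u (r n))) \<longlonglongrightarrow> grushin_form \<delta> \<delta>' b0 \<phi>"
    using LIMSEQ_subseq_LIMSEQ[OF closure_form_tendsto[OF L2 u] r(1)] by (simp add: o_def grushin_form_def)
  have h_meas [measurable]: "hardy_weight \<delta> \<delta>' \<in> borel_measurable ?M"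
    by (intro measurable_restrict_space1 measurable_completion) simp
  have \<phi>_meas [measurable]: "\<phi> \<in> borel_measurable ?M"
    using L2 by (simp add: L2_def)
  have u_meas [measurable]: "u n \<in> borel_measurable ?M" for n
    using test_functions_L2[OF u_test] by (simp add: L2_def)
  have bound: "(\<integral>\<^sup>+x. ennreal ((?h (u n) x)\<^sup>2) \<partial>?M) \<le> ennreal (4 / m\<^sup>2 * grushin_form0 \<delta> \<delta>' b0 (u n))" for n
  proof -
    have int: "integrable ?M (\<lambda>x. (?h (u n) x)\<^sup>2)"
        "(LINT x|?M. (?h (u n) x)\<^sup>2) = (\<integral>x. hardy_weight \<delta> \<delta>' x * (u n x)\<^sup>2 \<partial>lborel)"
      using lebesgue_on_Omega_conv_lborel[of "\<lambda>x. hardy_weight \<delta> \<delta>' x * (u n x)\<^sup>2" "\<lambda>x. (?h (u n) x)\<^sup>2"]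
        integrable_hardy_weight[OF u_test, of \<delta> \<delta>' n] borel_measurable_test_function[OF u_test]
      by (auto simp: hardy_weighted_sq)
    have "(\<integral>\<^sup>+x. ennreal ((?h (u n) x)\<^sup>2) \<partial>?M) = ennreal (LINT x|?M. (?h (u n) x)\<^sup>2)"
      using int(1) by (intro nn_integral_eq_integral) auto
    also have "\<dots> \<le> ennreal (4 / m\<^sup>2 * grushin_form0 \<delta> \<delta>' b0 (u n))"
      using hardy_test_functions[OF m u_test, of n] m(2)
      by (intro ennreal_leI) (simp add: int(2) grushin_form0_eq[OF u_test b0] field_simps)
    finally show ?thesis .
  qed
  have "(\<integral>\<^sup>+x. ennreal ((?h \<phi> x)\<^sup>2) \<partial>?M) = (\<integral>\<^sup>+x. liminf (\<lambda>n. ennreal ((?h (u (r n)) x)\<^sup>2)) \<partial>?M)"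
  proof (rule nn_integral_cong_AE)
    show "AE x in ?M. ennreal ((?h \<phi> x)\<^sup>2) = liminf (\<lambda>n. ennreal ((?h (u (r n)) x)\<^sup>2))"
      using r(2)
    proof eventually_elim
      case (elim x)
      have "(\<lambda>n. (?h (u (r n)) x)\<^sup>2) \<longlonglongrightarrow> (?h \<phi> x)\<^sup>2"
        unfolding hardy_weighted_sq by (intro tendsto_intros elim)
      then show ?case
        by (intro lim_imp_Liminf[symmetric] tendsto_ennrealI) auto
    qed
  qed
  also have "\<dots> \<le> liminf (\<lambda>n. \<integral>\<^sup>+x. ennreal ((?h (u (r n)) x)\<^sup>2) \<partial>?M)"
    by (intro nn_integral_liminf) (simp add: hardy_weighted_sq)
  also have "\<dots> \<le> liminf (\<lambda>n. ennreal (4 / m\<^sup>2 * grushin_form0 \<delta> \<delta>' b0 (u (r n))))"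
    by (intro Liminf_mono always_eventually allI bound)
  also have "\<dots> = ennreal (4 / m\<^sup>2 * grushin_form \<delta> \<delta>' b0 \<phi>)"
    by (intro lim_imp_Liminf tendsto_ennrealI tendsto_mult_left lim) simp
  finally have le: "(\<integral>\<^sup>+x. ennreal ((?h \<phi> x)\<^sup>2) \<partial>?M) \<le> ennreal (4 / m\<^sup>2 * grushin_form \<delta> \<delta>' b0 \<phi>)" .
  have meas: "?h \<phi> \<in> borel_measurable ?M"
  proof -
    have "(c_Omega \<delta> \<delta>' :: 'a \<times> 'b \<Rightarrow> real) \<in> borel_measurable ?M"
      "(d_Omega :: 'a \<times> 'b \<Rightarrow> real) \<in> borel_measurable ?M"
      by (intro measurable_restrict_space1 measurable_completion;
          simp add: d_Omega_eq[abs_def] borel_measurable_continuous_onI continuous_intros)+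
    then show ?thesis
      unfolding hardy_weighted_def[abs_def] by measurable
  qed
  have int: "integrable ?M (\<lambda>x. (?h \<phi> x)\<^sup>2)"
    using meas le by (intro integrableI_bounded) (auto simp: le_less_trans)
  with meas show "?h \<phi> \<in> L2 Omega"
    by (simp add: L2_def)
  \<comment> \<open>\<open>ennreal\<close> sends negative numbers to zero, so the inequality returns
    to the reals only once its right side is known to be nonnegative.\<close>
  have "0 \<le> grushin_form \<delta> \<delta>' b0 \<phi>"
    using lim by (rule LIMSEQ_le_const) (auto intro: q_nonneg u_test)
  moreover have "ennreal (LINT x|?M. (?h \<phi> x)\<^sup>2) \<le> ennreal (4 / m\<^sup>2 * grushin_form \<delta> \<delta>' b0 \<phi>)"
    using le int by (subst nn_integral_eq_integral[symmetric]) auto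
  ultimately have "(LINT x|?M. (?h \<phi> x)\<^sup>2) \<le> 4 / m\<^sup>2 * grushin_form \<delta> \<delta>' b0 \<phi>"
    by (simp add: ennreal_le_iff)
  then show "m\<^sup>2 / 4 * L2_inner Omega (?h \<phi>) (?h \<phi>) \<le> grushin_form \<delta> \<delta>' b0 \<phi>"
    using m(2) by (simp add: L2_inner_self field_simps)
qed

section \<open>Cutoff functions in logarithmic scale\<close>

text \<open>The standard mollifier profile \<open>exp (- 1 / (1 - u\<^sup>2))\<close> on the
  interval from -1 to 1, extended by zero.\<close>

definition cutoff :: "real \<Rightarrow> real" where
  "cutoff u = bump 0 (1 - u\<^sup>2)"

definition dcutoff :: "real \<Rightarrow> real" where
  "dcutoff u = - 2 * u * bump 2 (1 - u\<^sup>2)"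

lemma cutoff_has_derivative: "(cutoff has_real_derivative dcutoff u) (at u)"
proof -
  have "((\<lambda>u. 1 - u\<^sup>2) has_real_derivative - 2 * u) (at u)"
    by (auto intro!: derivative_eq_intros)
  from DERIV_chain2[OF bump_has_derivative[of 0] this] show ?thesis
    unfolding cutoff_def[abs_def] dcutoff_def
    by (rule DERIV_cong) (simp add: numeral_2_eq_2)
qed

lemma C_on_one_minus_square: "C_on k UNIV (\<lambda>u::real. 1 - u * u)"
  by (intro C_on_diff C_on_mult C_on_const C_on_linear bounded_linear_ident open_UNIV)

lemma C_on_cutoff: "C_on k UNIV cutoff"
  unfolding cutoff_def[abs_def] power2_eq_square
  by (rule C_on_compose[OF open_UNIV open_UNIV _ C_on_bump C_on_one_minus_square]) simp

lemma continuous_cutoff: "continuous_on UNIV cutoff"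
  using C_on_cutoff[of 0] by simp

lemma continuous_dcutoff: "continuous_on UNIV dcutoff"
proof -
  have "C_on 0 UNIV (\<lambda>u::real. bump 2 (1 - u * u))"
    by (rule C_on_compose[OF open_UNIV open_UNIV _ C_on_bump C_on_one_minus_square]) simp
  then show ?thesis
    unfolding dcutoff_def[abs_def] power2_eq_square
    by (intro continuous_on_mult) (auto intro: continuous_intros)
qed

lemma one_le_square_if_abs: "1 \<le> \<bar>u\<bar> \<Longrightarrow> 1 \<le> u\<^sup>2" for u :: real
  using abs_le_square_iff[of 1 u] by simp

lemma cutoff_eq_0: "1 \<le> \<bar>u\<bar> \<Longrightarrow> cutoff u = 0"
  using one_le_square_if_abs[of u] by (simp add: cutoff_def bump_def)

lemma dcutoff_eq_0: "1 \<le> \<bar>u\<bar> \<Longrightarrow> dcutoff u = 0"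
  using one_le_square_if_abs[of u] by (simp add: dcutoff_def bump_def)

lemma cutoff_pos: "\<bar>u\<bar> < 1 \<Longrightarrow> 0 < cutoff u"
  using abs_square_less_1[of u] by (simp add: cutoff_def bump_def)

text \<open>The constant is 2 times \<open>fact 4\<close>: the factor 2 is the derivative of
  \<open>u\<^sup>2\<close>, and \<open>bump_le_square\<close> with \<open>n = 2\<close> bounds the
  other factor by 24.\<close>

lemma dcutoff_bound: "\<bar>dcutoff u\<bar> \<le> 48"
proof (cases "\<bar>u\<bar> \<le> 1")
  case True
  have "u\<^sup>2 \<le> 1"
    using True abs_square_le_1 by blast
  then have "(1 - u\<^sup>2)\<^sup>2 \<le> 1"
    using abs_square_le_1[of "1 - u\<^sup>2"] by simp
  then have "bump 2 (1 - u\<^sup>2) \<le> 24"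
    using bump_le_square[of 2 "1 - u\<^sup>2"] by (simp add: fact_numeral)
  then have "\<bar>u\<bar> * bump 2 (1 - u\<^sup>2) \<le> 1 * 24"
    using True bump_nonneg[of 2 "1 - u\<^sup>2"] by (intro mult_mono) auto
  then show ?thesis
    using bump_nonneg[of 2 "1 - u\<^sup>2"] by (simp add: dcutoff_def abs_mult)
qed (simp add: dcutoff_eq_0)

lemma cutoff_ge_half:
  assumes "\<bar>u\<bar> \<le> 1 / 2"
  shows "cutoff (1 / 2) \<le> cutoff u"
proof -
  have "u\<^sup>2 \<le> (1 / 2)\<^sup>2"
    using assms abs_le_square_iff[of u "1 / 2"] by simp
  then have "3 / 4 \<le> 1 - u\<^sup>2"
    by (simp add: power2_eq_square)
  then have "0 < 1 - u\<^sup>2"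
    by linarith
  moreover have "inverse (1 - u\<^sup>2) \<le> inverse (3 / 4)"
    using \<open>3 / 4 \<le> 1 - u\<^sup>2\<close> by (intro le_imp_inverse_le) auto
  ultimately show ?thesis
    by (simp add: cutoff_def bump_def power2_eq_square)
qed

text \<open>No multiple of \<open>cutoff\<^sup>2\<close> bounds \<open>dcutoff\<^sup>2\<close> near \<open>\<plusminus>1\<close>; two shifted copies do, and shifts in
  logarithmic scale do not change the integrals.\<close>

lemma dcutoff_le_cutoff:
  "(dcutoff u)\<^sup>2 \<le> (48 / cutoff (1 / 2))\<^sup>2 * ((cutoff (u - 1 / 2))\<^sup>2 + (cutoff (u + 1 / 2))\<^sup>2)"
proof (cases "\<bar>u\<bar> \<le> 1")
  case True
  define c where "c = cutoff (1 / 2)"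
  have c: "c > 0"
    by (simp add: c_def cutoff_pos)
  \<comment> \<open>For \<open>\<bar>u\<bar> \<le> 1\<close> one of the two shifted points has
    absolute value at most 1/2.\<close>
  have "c \<le> cutoff (u - 1 / 2) \<or> c \<le> cutoff (u + 1 / 2)"
    unfolding c_def using True cutoff_ge_half[of "u - 1 / 2"] cutoff_ge_half[of "u + 1 / 2"] by linarith
  then have "c\<^sup>2 \<le> (cutoff (u - 1 / 2))\<^sup>2 \<or> c\<^sup>2 \<le> (cutoff (u + 1 / 2))\<^sup>2"
    using c power_mono[of c _ 2] by auto
  then have le: "c\<^sup>2 \<le> (cutoff (u - 1 / 2))\<^sup>2 + (cutoff (u + 1 / 2))\<^sup>2"
    by (auto intro: add_increasing add_increasing2)
  have "(dcutoff u)\<^sup>2 \<le> 48\<^sup>2"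
    using dcutoff_bound[of u] abs_le_square_iff[of "dcutoff u" 48] by simp
  also have "\<dots> = (48 / c)\<^sup>2 * c\<^sup>2"
    using c by (simp add: power_divide)
  also have "\<dots> \<le> (48 / c)\<^sup>2 * ((cutoff (u - 1 / 2))\<^sup>2 + (cutoff (u + 1 / 2))\<^sup>2)"
    using le by (rule mult_left_mono) simp
  finally show ?thesis
    unfolding c_def .
qed (simp add: dcutoff_eq_0)

section \<open>Scaling, positivity and products of Lebesgue integrals\<close>

lemma integral_lborel_scale:
  fixes f :: "'a::euclidean_space \<Rightarrow> real"
  assumes [measurable]: "f \<in> borel_measurable borel" and r: "r > 0"
  shows "(\<integral>x. f x \<partial>lborel) = r ^ DIM('a) * (\<integral>x. f (r *\<^sub>R x) \<partial>lborel)"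
proof -
  have "(\<integral>x. f x \<partial>lborel) = (\<integral>x. f x \<partial>(density (distr lborel borel (\<lambda>x. 0 + r *\<^sub>R x)) (\<lambda>_. ennreal (\<bar>r\<bar> ^ DIM('a)))))"
    using lborel_affine[of r "0 :: 'a"] r by simp
  also have "\<dots> = (\<integral>x. r ^ DIM('a) * f x \<partial>(distr lborel borel (\<lambda>x. 0 + r *\<^sub>R x)))"
    using r by (subst integral_density) auto
  also have "\<dots> = (\<integral>x. r ^ DIM('a) * f (r *\<^sub>R x) \<partial>lborel)"
    by (subst integral_distr) auto
  finally show ?thesis
    by simp
qed

text \<open>A vanishing integral would make the closed zero set of \<open>f\<close> have full
  measure, and a closed set of full Lebesgue measure is the whole space.\<close>

lemma integral_pos_if_continuous:
  fixes f :: "'a::euclidean_space \<Rightarrow> real"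
  assumes "continuous_on UNIV f" "integrable lborel f" "\<And>x. 0 \<le> f x" "0 < f y"
  shows "0 < (\<integral>x. f x \<partial>lborel)"
proof (rule ccontr)
  assume "\<not> 0 < (\<integral>x. f x \<partial>lborel)"
  moreover have "0 \<le> (\<integral>x. f x \<partial>lborel)"
    by (rule integral_nonneg_AE) (simp add: assms(3))
  ultimately have "(\<integral>x. f x \<partial>lborel) = 0"
    by linarith
  then have "AE x in lborel. f x = 0"
    using integral_nonneg_eq_0_iff_AE[of lborel f] assms(2,3) by auto
  then have "AE x in lebesgue. x \<in> {x. f x = 0}"
    by (auto dest: AE_completion)
  moreover have "closed {x. f x = 0}"
    using closed_Collect_eq[OF assms(1) continuous_on_const[of UNIV 0]] .
  ultimately show False
    using mem_closed_if_AE_lebesgue[of "{x. f x = 0}" y] assms(4) by auto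
qed

lemma integral_lborel_product:
  fixes p :: "'a::euclidean_space \<Rightarrow> real" and q :: "'b::euclidean_space \<Rightarrow> real"
  assumes p: "integrable lborel p" and q: "integrable lborel q"
  shows "integrable lborel (\<lambda>x. p (fst x) * q (snd x))"
    and "(\<integral>x. p (fst x) * q (snd x) \<partial>lborel) = (\<integral>x. p x \<partial>lborel) * (\<integral>x. q x \<partial>lborel)"
proof -
  note [measurable] = borel_measurable_integrable[OF p] borel_measurable_integrable[OF q]
  have "integrable (lborel \<Otimes>\<^sub>M lborel) (\<lambda>x. p (fst x) * q (snd x))"
  proof (rule lborel_pair.Fubini_integrable)
    show "integrable lborel (\<lambda>x. \<integral>y. norm (p (fst (x, y)) * q (snd (x, y))) \<partial>lborel)"
      using p q by (simp add: abs_mult)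
    show "AE x in lborel. integrable lborel (\<lambda>y. p (fst (x, y)) * q (snd (x, y)))"
      using q by simp
  qed measurable
  note int = this
  then show "integrable lborel (\<lambda>x. p (fst x) * q (snd x))"
    by (simp only: lborel_prod)
  have "(\<integral>x. p (fst x) * q (snd x) \<partial>lborel) = (\<integral>x. p (fst x) * q (snd x) \<partial>(lborel \<Otimes>\<^sub>M lborel))"
    by (simp only: lborel_prod)
  also have "\<dots> = (\<integral>x. \<integral>y. p x * q y \<partial>lborel \<partial>lborel)"
    using lborel_pair.integral_fst'[OF int] by simp
  also have "\<dots> = (\<integral>x. p x \<partial>lborel) * (\<integral>x. q x \<partial>lborel)"
    using p q by simp
  finally show "(\<integral>x. p (fst x) * q (snd x) \<partial>lborel) = (\<integral>x. p x \<partial>lborel) * (\<integral>x. q x \<partial>lborel)" .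
qed

text \<open>A profile \<open>H\<close> in the variable \<open>ln (norm y)\<close>, stretched by
  \<open>1 / \<epsilon>\<close> and centred at \<open>t\<close>, so that dilations of
  \<open>y\<close> become shifts of \<open>t\<close>. At the origin the value is 0 because
  \<open>0 powr p = 0\<close>.\<close>

definition log_radial :: "real \<Rightarrow> (real \<Rightarrow> real) \<Rightarrow> real \<Rightarrow> real \<Rightarrow> 'a::euclidean_space \<Rightarrow> real" where
  "log_radial p H \<epsilon> t y = norm y powr p * H (\<epsilon> * (ln (norm y) - t))"

definition log_annulus :: "real \<Rightarrow> real \<Rightarrow> 'a::euclidean_space set" where
  "log_annulus \<epsilon> t = {y. exp (t - 1 / \<epsilon>) \<le> norm y \<and> norm y \<le> exp (t + 1 / \<epsilon>)}"

lemma compact_log_annulus: "compact (log_annulus \<epsilon> t)"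
proof -
  have "log_annulus \<epsilon> t = cball 0 (exp (t + 1 / \<epsilon>)) - ball (0 :: 'a) (exp (t - 1 / \<epsilon>))"
    by (auto simp: log_annulus_def)
  then show ?thesis
    by (simp add: compact_diff)
qed

lemma log_annulus_nonzero: "y \<in> log_annulus \<epsilon> t \<Longrightarrow> y \<noteq> 0"
  by (auto simp: log_annulus_def)

lemma outside_log_annulus:
  assumes "\<epsilon> > 0" "y \<noteq> 0" "y \<notin> log_annulus \<epsilon> t"
  shows "1 \<le> \<bar>\<epsilon> * (ln (norm y) - t)\<bar>"
proof -
  have "norm y > 0"
    using assms(2) by simp
  then have "ln (norm y) < t - 1 / \<epsilon> \<or> t + 1 / \<epsilon> < ln (norm y)"
    using assms(3) exp_less_cancel_iff[of "ln (norm y)" "t - 1 / \<epsilon>"]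
      exp_less_cancel_iff[of "t + 1 / \<epsilon>" "ln (norm y)"]
    by (auto simp: log_annulus_def not_le)
  then have "1 / \<epsilon> \<le> \<bar>ln (norm y) - t\<bar>"
    by linarith
  then have "1 \<le> \<epsilon> * \<bar>ln (norm y) - t\<bar>"
    using assms(1) by (simp add: field_simps)
  then show ?thesis
    using assms(1) by (simp add: abs_mult)
qed

context
  fixes \<epsilon> :: real and H :: "real \<Rightarrow> real"
  assumes \<epsilon>: "\<epsilon> > 0" and H: "continuous_on UNIV H" "\<And>u. 1 \<le> \<bar>u\<bar> \<Longrightarrow> H u = 0"
begin

lemma log_radial_outside: "y \<notin> log_annulus \<epsilon> t \<Longrightarrow> log_radial p H \<epsilon> t y = 0"
  using outside_log_annulus[OF \<epsilon>, of y t] H(2) by (cases "y = 0") (auto simp: log_radial_def)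

lemma continuous_log_radial: "continuous_on UNIV (log_radial p H \<epsilon> t :: 'a::euclidean_space \<Rightarrow> real)"
proof -
  have "continuous_on (- {0}) (\<lambda>y :: 'a. \<epsilon> * (ln (norm y) - t))"
    by (intro continuous_intros) auto
  then have "continuous_on (- {0}) (\<lambda>y :: 'a. H (\<epsilon> * (ln (norm y) - t)))"
    by (rule continuous_on_compose2[OF H(1)]) simp
  then have 1: "continuous_on (- {0}) (log_radial p H \<epsilon> t :: 'a \<Rightarrow> real)"
    unfolding log_radial_def[abs_def] by (intro continuous_on_mult continuous_on_powr continuous_intros) auto
  have 2: "continuous_on (- log_annulus \<epsilon> t) (log_radial p H \<epsilon> t :: 'a \<Rightarrow> real)"
    by (rule continuous_on_eq[of _ "\<lambda>_. 0"]) (auto simp: log_radial_outside)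
  have "continuous_on (- {0} \<union> - log_annulus \<epsilon> t) (log_radial p H \<epsilon> t :: 'a \<Rightarrow> real)"
    by (intro continuous_on_open_Un 1 2 open_Compl compact_imp_closed[OF compact_log_annulus]) simp
  moreover have "- {0} \<union> - log_annulus \<epsilon> t = (UNIV :: 'a set)"
    using log_annulus_nonzero by blast
  ultimately show ?thesis
    by simp
qed

lemma integrable_log_radial: "integrable lborel (log_radial p H \<epsilon> t :: 'a::euclidean_space \<Rightarrow> real)"
  by (rule integrable_compact_support[OF continuous_log_radial compact_log_annulus log_radial_outside])

text \<open>Substituting \<open>exp \<tau> *\<^sub>R y\<close> moves the logarithm by
  \<open>\<tau>\<close>, and the Jacobian cancels the factor produced by the power of the
  norm.\<close>

lemma integral_log_radial_shift:
  "(\<integral>y. log_radial (- real DIM('a)) H \<epsilon> (t + \<tau>) (y :: 'a::euclidean_space) \<partial>lborel)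
    = (\<integral>y. log_radial (- real DIM('a)) H \<epsilon> t (y :: 'a) \<partial>lborel)"
proof -
  have meas: "(log_radial (- real DIM('a)) H \<epsilon> (t + \<tau>) :: 'a \<Rightarrow> real) \<in> borel_measurable borel"
    by (intro borel_measurable_continuous_onI continuous_log_radial)
  have "exp \<tau> ^ DIM('a) * log_radial (- real DIM('a)) H \<epsilon> (t + \<tau>) (exp \<tau> *\<^sub>R y)
      = log_radial (- real DIM('a)) H \<epsilon> t y" for y :: 'a
  proof (cases "y = 0")
    case False
    then show ?thesis
      by (simp add: log_radial_def powr_mult ln_mult powr_minus powr_realpow algebra_simps)
  qed (simp add: log_radial_def)
  then show ?thesis
    unfolding integral_lborel_scale[OF meas exp_gt_zero[of \<tau>]]
    by (simp only: integral_mult_right_zero[symmetric])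
qed

end

text \<open>Near zero \<open>(1 + s) powr (\<delta>' - \<delta>)\<close> is close to 1. Near
  infinity one writes \<open>c_fun \<delta> \<delta>' s = s powr \<delta>' * (1 + inverse s) powr
  (\<delta>' - \<delta>)\<close> and argues in the same way with \<open>inverse s\<close>. The
  half-width \<open>N\<close> is prescribed before \<open>t\<close> is chosen.\<close>

lemma c_fun_almost_power:
  assumes "\<delta> \<ge> 0" "\<delta>' \<ge> 0" "\<kappa> > 1"
  obtains t L where "L > 0"
    "\<And>s. exp (t - N) \<le> s \<Longrightarrow> s \<le> exp (t + N) \<Longrightarrow>
      L * s powr min \<delta> \<delta>' \<le> c_fun \<delta> \<delta>' s \<and> c_fun \<delta> \<delta>' s \<le> \<kappa> * (L * s powr min \<delta> \<delta>')"
proof -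
  define p where "p = \<bar>\<delta>' - \<delta>\<bar>"
  have p: "p \<ge> 0"
    by (simp add: p_def)
  \<comment> \<open>Solves \<open>(1 + s0) powr (p + 1) = \<kappa>\<close>; using
    \<open>p + 1\<close> instead of \<open>p\<close> avoids a division by zero when
    \<open>\<delta> = \<delta>'\<close>.\<close>
  define s0 where "s0 = \<kappa> powr (1 / (p + 1)) - 1"
  have s0: "s0 > 0"
    using assms(3) p by (simp add: s0_def)
  have small: "1 \<le> (1 + s) powr p \<and> (1 + s) powr p \<le> \<kappa>" if "0 \<le> s" "s \<le> s0" for s
  proof
    show "1 \<le> (1 + s) powr p"
      using that p by (simp add: ge_one_powr_ge_zero)
    have "(1 + s) powr p \<le> (\<kappa> powr (1 / (p + 1))) powr p"
      using that p by (intro powr_mono2) (auto simp: s0_def)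
    also have "\<dots> = \<kappa> powr (p / (p + 1))"
      by (simp add: powr_powr)
    also have "\<dots> \<le> \<kappa> powr 1"
      using assms(3) p by (intro powr_mono) (auto simp: divide_le_eq)
    finally show "(1 + s) powr p \<le> \<kappa>"
      using assms(3) by simp
  qed
  show ?thesis
  proof (cases "\<delta> \<le> \<delta>'")
    case True
    show ?thesis
    \<comment> \<open>This \<open>t\<close> places the upper end \<open>exp (t + N)\<close> of the
      range exactly at \<open>s0\<close>.\<close>
    proof (rule that[of 1 "ln s0 - N"])
      fix s assume s: "exp (ln s0 - N - N) \<le> s" "s \<le> exp (ln s0 - N + N)"
      have "0 < s"
        using s(1) exp_gt_zero less_le_trans by blast
      moreover have "s \<le> s0"
        using s(2) s0 by simp
      ultimately have "1 \<le> (1 + s) powr (\<delta>' - \<delta>) \<and> (1 + s) powr (\<delta>' - \<delta>) \<le> \<kappa>"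
        using small[of s] True by (simp add: p_def)
      then show "1 * s powr min \<delta> \<delta>' \<le> c_fun \<delta> \<delta>' s \<and> c_fun \<delta> \<delta>' s \<le> \<kappa> * (1 * s powr min \<delta> \<delta>')"
        using True mult_left_mono[of 1 "(1 + s) powr (\<delta>' - \<delta>)" "s powr \<delta>"]
          mult_left_mono[of "(1 + s) powr (\<delta>' - \<delta>)" \<kappa> "s powr \<delta>"]
        by (simp add: c_fun_def min_def mult.commute)
    qed simp
  next
    case False
    show ?thesis
    \<comment> \<open>Here the lower end is \<open>inverse s0\<close>. The correction factor is now
      below 1, so \<open>L = 1 / \<kappa>\<close> is what makes the lower bound hold.\<close>
    proof (rule that[of "1 / \<kappa>" "N - ln s0"])
      fix s assume s: "exp (N - ln s0 - N) \<le> s" "s \<le> exp (N - ln s0 + N)"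
      have "0 < s"
        using s(1) exp_gt_zero less_le_trans by blast
      moreover have "inverse s0 \<le> s"
        using s(1) s0 by (simp add: exp_minus)
      ultimately have s': "0 \<le> inverse s" "inverse s \<le> s0"
        using s0 le_imp_inverse_le[of "inverse s0" s] by auto
      define w where "w = (1 + inverse s) powr p"
      have w: "1 \<le> w" "w \<le> \<kappa>"
        using small[OF s'] by (auto simp: w_def)
      have "c_fun \<delta> \<delta>' s = s powr \<delta> * ((1 + inverse s) * s) powr (\<delta>' - \<delta>)"
        using \<open>0 < s\<close> by (simp add: c_fun_def distrib_right add.commute)
      also have "\<dots> = s powr \<delta> * s powr (\<delta>' - \<delta>) * (1 + inverse s) powr (\<delta>' - \<delta>)"
        using \<open>0 < s\<close> by (simp add: powr_mult)
      also have "s powr \<delta> * s powr (\<delta>' - \<delta>) = s powr \<delta>'"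
        by (simp add: powr_add[symmetric])
      also have "(1 + inverse s) powr (\<delta>' - \<delta>) = inverse w"
        using False by (simp add: w_def p_def powr_minus[symmetric])
      finally have c: "c_fun \<delta> \<delta>' s = s powr \<delta>' * inverse w" .
      have "inverse \<kappa> \<le> inverse w" "inverse w \<le> 1"
        using w by (auto intro: le_imp_inverse_le inverse_le_1_iff[THEN iffD2])
      then show "1 / \<kappa> * s powr min \<delta> \<delta>' \<le> c_fun \<delta> \<delta>' s \<and> c_fun \<delta> \<delta>' s \<le> \<kappa> * (1 / \<kappa> * s powr min \<delta> \<delta>')"
        using False assms(3) mult_left_mono[of "inverse \<kappa>" "inverse w" "s powr \<delta>'"]
          mult_left_mono[of "inverse w" 1 "s powr \<delta>'"]
        by (simp add: c min_def divide_inverse mult.commute mult.assoc[symmetric])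
    qed (use assms(3) in simp)
  qed
qed

section \<open>Near-optimal test functions\<close>

lemma integrable_sq_norm_scaled:
  fixes H :: "real \<Rightarrow> real"
  assumes H: "continuous_on UNIV H" "\<And>u. 1 \<le> \<bar>u\<bar> \<Longrightarrow> H u = 0" and R: "R > 0"
  shows "continuous_on UNIV (\<lambda>z :: 'b::euclidean_space. (H (norm z / R))\<^sup>2)"
    and "integrable lborel (\<lambda>z :: 'b. (H (norm z / R))\<^sup>2)"
    and "(\<integral>z. (H (norm (z :: 'b) / R))\<^sup>2 \<partial>lborel) = R ^ DIM('b) * (\<integral>z. (H (norm (z :: 'b)))\<^sup>2 \<partial>lborel)"
proof -
  show cont: "continuous_on UNIV (\<lambda>z :: 'b. (H (norm z / R))\<^sup>2)"
    using R by (intro continuous_on_power continuous_on_compose2[OF H(1)] continuous_intros) auto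
  show "integrable lborel (\<lambda>z :: 'b. (H (norm z / R))\<^sup>2)"
  proof (rule integrable_compact_support[OF cont compact_cball])
    show "(H (norm z / R))\<^sup>2 = 0" if "z \<notin> cball 0 R" for z :: 'b
      using that R H(2)[of "norm z / R"] by simp
  qed
  show "(\<integral>z. (H (norm (z :: 'b) / R))\<^sup>2 \<partial>lborel) = R ^ DIM('b) * (\<integral>z. (H (norm (z :: 'b)))\<^sup>2 \<partial>lborel)"
    using integral_lborel_scale[OF borel_measurable_continuous_onI[OF cont] R] R by simp
qed

text \<open>The power \<open>s powr (- m / 2)\<close> has \<open>x\<^sub>1\<close>-gradient
  \<open>- (m / 2) * s powr (- m / 2)\<close> times \<open>x\<^sub>1 / s\<^sup>2\<close>, so it is
  the equality case of the square behind the Hardy inequality; the two cutoffs give it compact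
  support in \<open>Omega\<close>.\<close>

definition trial ::
  "real \<Rightarrow> real \<Rightarrow> real \<Rightarrow> real \<Rightarrow> 'a::euclidean_space \<times> 'b::euclidean_space \<Rightarrow> real" where
  "trial m \<epsilon> t R x = log_radial (- m / 2) cutoff \<epsilon> t (fst x) * cutoff (norm (snd x) / R)"

definition trial_support :: "real \<Rightarrow> real \<Rightarrow> real \<Rightarrow> ('a::euclidean_space \<times> 'b::euclidean_space) set" where
  "trial_support \<epsilon> t R = log_annulus \<epsilon> t \<times> cball 0 R"

context
  fixes m \<epsilon> t R :: real
  assumes \<epsilon>: "\<epsilon> > 0" and R: "R > 0"
begin

lemma compact_trial_support: "compact (trial_support \<epsilon> t R)"
  unfolding trial_support_def by (intro compact_Times compact_log_annulus compact_cball)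

lemma trial_support_subset: "trial_support \<epsilon> t R \<subseteq> Omega"
  by (auto simp: trial_support_def Omega_iff log_annulus_def)

lemma trial_eq_0:
  assumes "x \<notin> trial_support \<epsilon> t R"
  shows "trial m \<epsilon> t R x = 0"
proof (cases "fst x \<in> log_annulus \<epsilon> t")
  case True
  then have "1 \<le> \<bar>norm (snd x) / R\<bar>"
    using assms R by (auto simp: trial_support_def mem_Times_iff)
  then show ?thesis
    by (simp add: trial_def cutoff_eq_0)
qed (simp add: trial_def log_radial_outside[OF \<epsilon> continuous_cutoff cutoff_eq_0])

text \<open>The right side composes \<open>bump 0\<close> with a polynomial in \<open>z\<close>.
  Smoothness and derivatives are thereby available also at \<open>z = 0\<close>, where the norm is
  not differentiable.\<close>

lemma cutoff_norm_eq: "cutoff (norm z / R) = bump 0 (1 - (z \<bullet> z) * (1 / R\<^sup>2))"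
  by (simp add: cutoff_def power_divide power2_norm_eq_inner)

lemma trial_test_function: "trial m \<epsilon> t R \<in> test_functions (Omega :: ('a::euclidean_space \<times> 'b::euclidean_space) set)"
proof (rule test_functionsI)
  fix k
  have "C_on k {0<..} (\<lambda>s. \<epsilon> * (ln s - t))"
    by (intro C_on_cmult C_on_diff C_on_ln C_on_const open_greaterThan)
  then have "C_on k {0<..} (\<lambda>s. cutoff (\<epsilon> * (ln s - t)))"
    by (rule C_on_compose[OF open_greaterThan open_UNIV _ C_on_cutoff, rotated]) simp
  then have "C_on k {0<..} (\<lambda>s. s powr (- m / 2) * cutoff (\<epsilon> * (ln s - t)))"
    by (intro C_on_mult C_on_powr open_greaterThan)
  from C_on_radial[OF this] have 1: "C_on k (Omega :: ('a \<times> 'b) set) (\<lambda>x. log_radial (- m / 2) cutoff \<epsilon> t (fst x))"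
    by (simp add: log_radial_def)
  have "C_on k (Omega :: ('a \<times> 'b) set) (\<lambda>x. \<Sum>j\<in>Basis. (snd x \<bullet> j) * (snd x \<bullet> j))"
    by (intro C_on_sum C_on_mult C_on_linear open_Omega bounded_linear_inner_left_comp bounded_linear_snd)
  then have "C_on k (Omega :: ('a \<times> 'b) set) (\<lambda>x. 1 - (snd x \<bullet> snd x) * (1 / R\<^sup>2))"
    unfolding euclidean_inner[symmetric] by (intro C_on_diff C_on_mult C_on_const open_Omega)
  then have 2: "C_on k (Omega :: ('a \<times> 'b) set) (\<lambda>x. cutoff (norm (snd x) / R))"
    unfolding cutoff_norm_eq by (rule C_on_compose[OF open_Omega open_UNIV _ C_on_bump, rotated]) simp
  have "C_on k (Omega :: ('a \<times> 'b) set) (trial m \<epsilon> t R)"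
    unfolding trial_def[abs_def] by (intro C_on_mult 1 2 open_Omega)
  then have "C_on k UNIV (trial m \<epsilon> t R :: 'a \<times> 'b \<Rightarrow> real)"
    by (rule C_on_extend[OF open_Omega _ compact_trial_support trial_support_subset]) (rule trial_eq_0)
  then show "C_k k (trial m \<epsilon> t R :: 'a \<times> 'b \<Rightarrow> real)"
    by (simp add: C_k_iff_C_on)
qed (use compact_trial_support trial_support_subset trial_eq_0 in auto)

lemma trial_gradient:
  fixes x :: "'a::euclidean_space \<times> 'b::euclidean_space"
  assumes x: "x \<in> Omega"
  defines "s \<equiv> norm (fst x)"
  shows "(\<Sum>i\<in>Basis. pd (trial m \<epsilon> t R) (i, 0) x * pd (trial m \<epsilon> t R) (i, 0) x)
      = (s powr (- m / 2) / s * (\<epsilon> * dcutoff (\<epsilon> * (ln s - t)) - m / 2 * cutoff (\<epsilon> * (ln s - t))))\<^sup>2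
        * (cutoff (norm (snd x) / R))\<^sup>2" (is "?A = (?g')\<^sup>2 * _")
    and "(\<Sum>j\<in>Basis. pd (trial m \<epsilon> t R) (0, j) x * pd (trial m \<epsilon> t R) (0, j) x)
      = (log_radial (- m / 2) cutoff \<epsilon> t (fst x))\<^sup>2 * (dcutoff (norm (snd x) / R))\<^sup>2 / R\<^sup>2"
proof -
  have s: "s > 0"
    using x by (simp add: s_def Omega_iff)
  let ?G = "\<lambda>s. cutoff (\<epsilon> * (ln s - t))"
  let ?\<beta>' = "bump 2 (1 - (snd x \<bullet> snd x) * (1 / R\<^sup>2)) * (- 2 / R\<^sup>2)"
  have "((\<lambda>s. \<epsilon> * (ln s - t)) has_real_derivative \<epsilon> * (1 / s)) (at s)"
    using s by (auto intro!: derivative_eq_intros)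
  note DERIV_chain2[OF cutoff_has_derivative this]
  from DERIV_mult[OF has_real_derivative_powr[OF s, of "- m / 2"] this]
  have "((\<lambda>s. s powr (- m / 2) * ?G s) has_real_derivative ?g') (at s)"
    by (rule DERIV_cong) (use s in \<open>simp add: powr_diff algebra_simps\<close>)
  then have D: "((\<lambda>s. s powr (- m / 2) * ?G s) has_derivative (\<lambda>h. ?g' * h)) (at s)"
    unfolding has_field_derivative_def .
  have "((\<lambda>x. norm (fst x)) has_derivative (\<lambda>v. fst v \<bullet> sgn (fst x))) (at x)"
    using has_derivative_compose[OF has_derivative_fst[OF has_derivative_ident] has_derivative_norm] x
    by (simp add: Omega_iff)
  from has_derivative_compose[OF this D[unfolded s_def]]
  have 1: "((\<lambda>x. log_radial (- m / 2) cutoff \<epsilon> t (fst x)) has_derivative (\<lambda>v. ?g' * (fst v \<bullet> sgn (fst x)))) (at x)"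
    by (simp add: log_radial_def s_def)
  have "((\<lambda>x :: 'a \<times> 'b. 1 - (snd x \<bullet> snd x) * r) has_derivative (\<lambda>v. - 2 * r * (snd v \<bullet> snd x))) (at x)" for r
    by (auto intro!: derivative_eq_intros simp: inner_commute algebra_simps)
  from this[of "1 / R\<^sup>2"]
  have "((\<lambda>x :: 'a \<times> 'b. 1 - (snd x \<bullet> snd x) * (1 / R\<^sup>2)) has_derivative (\<lambda>v. - 2 / R\<^sup>2 * (snd v \<bullet> snd x))) (at x)"
    by simp
  from has_derivative_compose[OF this bump_has_derivative[of 0, unfolded has_field_derivative_def]]
  have 2: "((\<lambda>x :: 'a \<times> 'b. cutoff (norm (snd x) / R)) has_derivative (\<lambda>v. ?\<beta>' * (snd v \<bullet> snd x))) (at x)"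
    unfolding cutoff_norm_eq by (simp add: numeral_2_eq_2 mult.assoc)
  have pd: "pd (trial m \<epsilon> t R) v x = log_radial (- m / 2) cutoff \<epsilon> t (fst x) * (?\<beta>' * (snd v \<bullet> snd x))
      + ?g' * (fst v \<bullet> sgn (fst x)) * cutoff (norm (snd x) / R)" for v
    unfolding trial_def[abs_def]
    by (rule frechet_derivative_at[OF has_derivative_mult[OF 1 2], THEN fun_cong, symmetric])
  have "?A = (?g' * cutoff (norm (snd x) / R))\<^sup>2 * (\<Sum>i\<in>Basis. (sgn (fst x) \<bullet> i) * (sgn (fst x) \<bullet> i))"
    unfolding sum_distrib_left
    by (intro sum.cong refl) (simp add: pd power2_eq_square inner_commute algebra_simps)
  also have "(\<Sum>i\<in>Basis. (sgn (fst x) \<bullet> i) * (sgn (fst x) \<bullet> i)) = 1"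
    using x by (simp only: euclidean_inner[symmetric]) (simp add: power2_norm_eq_inner[symmetric] norm_sgn Omega_iff)
  finally show "?A = (?g')\<^sup>2 * (cutoff (norm (snd x) / R))\<^sup>2"
    by (simp only: power_mult_distrib mult_1_right)
  have "(\<Sum>j\<in>Basis. pd (trial m \<epsilon> t R) (0, j) x * pd (trial m \<epsilon> t R) (0, j) x)
      = (log_radial (- m / 2) cutoff \<epsilon> t (fst x) * ?\<beta>')\<^sup>2 * (\<Sum>j\<in>Basis. (snd x \<bullet> j) * (snd x \<bullet> j))"
    unfolding sum_distrib_left
    by (intro sum.cong refl) (simp add: pd power2_eq_square inner_commute algebra_simps)
  also have "\<dots> = (log_radial (- m / 2) cutoff \<epsilon> t (fst x) * ?\<beta>')\<^sup>2 * (norm (snd x))\<^sup>2"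
    by (simp only: euclidean_inner[symmetric] power2_norm_eq_inner)
  also have "\<dots> = (log_radial (- m / 2) cutoff \<epsilon> t (fst x))\<^sup>2 * (?\<beta>' * norm (snd x))\<^sup>2"
    by (simp only: power_mult_distrib mult.assoc)
  also have "?\<beta>' * norm (snd x) = dcutoff (norm (snd x) / R) / R"
    by (simp add: dcutoff_def power_divide power2_norm_eq_inner power2_eq_square[of R])
  finally show "(\<Sum>j\<in>Basis. pd (trial m \<epsilon> t R) (0, j) x * pd (trial m \<epsilon> t R) (0, j) x)
      = (log_radial (- m / 2) cutoff \<epsilon> t (fst x))\<^sup>2 * (dcutoff (norm (snd x) / R))\<^sup>2 / R\<^sup>2"
    by (simp add: power_divide)
qed

end

section \<open>Optimality of the constant\<close>

text \<open>The right side exceeds the left by exactly \<open>\<epsilon> * (p + q)\<^sup>2\<close>.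
  The coefficient of \<open>p\<^sup>2\<close> tends to 1 and that of \<open>q\<^sup>2\<close> to 0
  with \<open>\<epsilon>\<close>.\<close>

lemma square_combination_le:
  fixes \<epsilon> :: real
  assumes "\<epsilon> > 0"
  shows "(\<epsilon> * q - p)\<^sup>2 \<le> (1 + \<epsilon>) * p\<^sup>2 + (\<epsilon> + \<epsilon>\<^sup>2) * q\<^sup>2"
proof -
  have "0 \<le> \<epsilon> * (p + q)\<^sup>2"
    using assms by simp
  then show ?thesis
    by (simp add: power2_eq_square algebra_simps)
qed

lemma le_if_le_add_inverse_square:
  fixes x y z :: real
  assumes "\<And>R. R > 0 \<Longrightarrow> x \<le> y + z / R\<^sup>2"
  shows "x \<le> y"
proof (rule tendsto_lowerbound)
  show "((\<lambda>R. y + z / R\<^sup>2) \<longlongrightarrow> y) at_top"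
  proof -
    have "filterlim (\<lambda>R::real. R\<^sup>2) at_top at_top"
      by (intro filterlim_pow_at_top filterlim_ident) simp
    then have "((\<lambda>R. z / R\<^sup>2) \<longlongrightarrow> 0) at_top"
      by (intro tendsto_divide_0[OF tendsto_const] filterlim_at_top_imp_at_infinity)
    from tendsto_add[OF tendsto_const this] show ?thesis
      by simp
  qed
  show "\<forall>\<^sub>F R in at_top. x \<le> y + z / R\<^sup>2"
    using eventually_gt_at_top[of 0] by eventually_elim (rule assms)
qed simp

text \<open>By the choice of \<open>m\<close>, the exponents of \<open>c\<close>, of the squared
  power and of \<open>1 / s\<^sup>2\<close> add up to minus the dimension of the first factor. The
  \<open>c\<close> part of the energy and the Hardy term thus both live on the dilation-invariant
  density; the \<open>b\<close> part keeps the exponent \<open>- m\<close> but carries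
  \<open>1 / R\<^sup>2\<close>.\<close>

lemma (in bounded_borel_coefficient) trial_energy_le:
  fixes m \<epsilon> t R \<kappa> L \<delta> \<delta>' :: real
  defines "f \<equiv> (trial m \<epsilon> t R :: 'a \<times> 'b::euclidean_space \<Rightarrow> real)"
  defines "J0 \<equiv> log_radial (- real DIM('a)) (\<lambda>u. (cutoff u)\<^sup>2) \<epsilon> t :: 'a \<Rightarrow> real"
  defines "J1 \<equiv> log_radial (- real DIM('a)) (\<lambda>u. (dcutoff u)\<^sup>2) \<epsilon> t :: 'a \<Rightarrow> real"
  defines "P \<equiv> log_radial (- m) (\<lambda>u. (cutoff u)\<^sup>2) \<epsilon> t :: 'a \<Rightarrow> real"
  assumes m: "m = real DIM('a) + min \<delta> \<delta>' - 2" and \<epsilon>: "\<epsilon> > 0" and R: "R > 0" and x: "x \<in> trial_support \<epsilon> t R"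
    and c: "L * norm (fst x) powr min \<delta> \<delta>' \<le> c_fun \<delta> \<delta>' (norm (fst x))"
      "c_fun \<delta> \<delta>' (norm (fst x)) \<le> \<kappa> * (L * norm (fst x) powr min \<delta> \<delta>')"
    and \<kappa>L: "\<kappa> \<ge> 0" "L \<ge> 0"
  shows "(\<Sum>i\<in>Basis. c_Omega \<delta> \<delta>' x * (pd f (i, 0) x * pd f (i, 0) x))
      + (\<Sum>j\<in>Basis. b (fst x) * (pd f (0, j) x * pd f (0, j) x))
    \<le> \<kappa> * L * ((1 + \<epsilon>) * (m\<^sup>2 / 4) * J0 (fst x) + (\<epsilon> + \<epsilon>\<^sup>2) * J1 (fst x)) * (cutoff (norm (snd x) / R))\<^sup>2
      + B / R\<^sup>2 * P (fst x) * (dcutoff (norm (snd x) / R))\<^sup>2" (is "?E1 + ?E2 \<le> ?U1 + ?U2")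
    and "L * (J0 (fst x) * (cutoff (norm (snd x) / R))\<^sup>2) \<le> hardy_weight \<delta> \<delta>' x * (f x)\<^sup>2"
proof -
  define s where "s = norm (fst x)"
  have x\<Omega>: "x \<in> Omega"
    using trial_support_subset[OF \<epsilon> R] x by blast
  then have s: "s > 0"
    by (simp add: s_def Omega_iff)
  define G where "G = cutoff (\<epsilon> * (ln s - t))"
  define G' where "G' = dcutoff (\<epsilon> * (ln s - t))"
  define X where "X = (cutoff (norm (snd x) / R))\<^sup>2"
  have J: "J0 (fst x) = s powr (- real DIM('a)) * G\<^sup>2" "J1 (fst x) = s powr (- real DIM('a)) * G'\<^sup>2"
    "P (fst x) = s powr (- m) * G\<^sup>2" "log_radial (- m / 2) cutoff \<epsilon> t (fst x) = s powr (- m / 2) * G"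
    by (simp_all add: J0_def J1_def P_def log_radial_def G_def G'_def s_def)
  have half: "(s powr (- m / 2))\<^sup>2 = s powr (- m)"
    using s by (simp add: power2_eq_square powr_add[symmetric])
  have "s powr (- real DIM('a)) = s powr min \<delta> \<delta>' * s powr (- m) * s powr (- 2)"
    by (simp add: powr_add[symmetric] m)
  also have "s powr (- 2) = 1 / s\<^sup>2"
    using s by (simp add: powr_minus divide_inverse)
  finally have d: "s powr (- real DIM('a)) = s powr min \<delta> \<delta>' * s powr (- m) / s\<^sup>2"
    by simp
  have "?E1 = c_fun \<delta> \<delta>' s * ((s powr (- m / 2) / s * (\<epsilon> * G' - m / 2 * G))\<^sup>2 * X)"
    unfolding sum_distrib_left[symmetric] f_def trial_gradient(1)[OF \<epsilon> R x\<Omega>]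
    by (simp add: c_Omega_def d_Omega_eq s_def G_def G'_def X_def)
  also have "\<dots> \<le> \<kappa> * (L * s powr min \<delta> \<delta>') * ((s powr (- m / 2) / s * (\<epsilon> * G' - m / 2 * G))\<^sup>2 * X)"
    using c(2) by (intro mult_right_mono) (simp_all add: s_def X_def)
  also have "\<dots> = \<kappa> * L * X * s powr (- real DIM('a)) * (\<epsilon> * G' - m / 2 * G)\<^sup>2"
    unfolding d by (simp add: power_mult_distrib power_divide half[simplified])
  also have "\<dots> \<le> \<kappa> * L * X * s powr (- real DIM('a)) * ((1 + \<epsilon>) * (m / 2 * G)\<^sup>2 + (\<epsilon> + \<epsilon>\<^sup>2) * G'\<^sup>2)"
    using \<kappa>L by (intro mult_left_mono square_combination_le \<epsilon>) (simp_all add: X_def)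
  also have "\<dots> = ?U1"
    unfolding J X_def[symmetric] by (simp add: power_mult_distrib power_divide algebra_simps)
  finally have 1: "?E1 \<le> ?U1" .
  have "?E2 = b (fst x) * ((s powr (- m / 2) * G)\<^sup>2 * (dcutoff (norm (snd x) / R))\<^sup>2 / R\<^sup>2)"
    unfolding sum_distrib_left[symmetric] f_def trial_gradient(2)[OF \<epsilon> R x\<Omega>] J ..
  also have "\<dots> \<le> B * ((s powr (- m / 2) * G)\<^sup>2 * (dcutoff (norm (snd x) / R))\<^sup>2 / R\<^sup>2)"
    by (intro mult_right_mono b_le) simp
  also have "\<dots> = ?U2"
    unfolding J by (simp add: power_mult_distrib half[simplified])
  finally show "?E1 + ?E2 \<le> ?U1 + ?U2"
    using 1 by simp
  have "L * (J0 (fst x) * X) = L * s powr min \<delta> \<delta>' * (s powr (- m) * G\<^sup>2 * X / s\<^sup>2)"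
    unfolding J d by simp
  also have "\<dots> \<le> c_fun \<delta> \<delta>' s * (s powr (- m) * G\<^sup>2 * X / s\<^sup>2)"
    using c(1) by (intro mult_right_mono) (simp_all add: s_def X_def)
  also have "\<dots> = hardy_weight \<delta> \<delta>' x * (f x)\<^sup>2"
    unfolding f_def trial_def J
    by (simp add: hardy_weight_def c_Omega_def d_Omega_eq s_def[symmetric] power_mult_distrib half[simplified] X_def)
  finally show "L * (J0 (fst x) * (cutoff (norm (snd x) / R))\<^sup>2) \<le> hardy_weight \<delta> \<delta>' x * (f x)\<^sup>2"
    unfolding X_def .
qed

text \<open>The assumed inequality is tested on \<open>trial\<close>. Its integrals split into
  products, all second factors scale like the same power of \<open>R\<close>, and \<open>W1\<close>
  is at most a constant, independent of \<open>\<epsilon>\<close> and \<open>t\<close>, times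
  \<open>W0\<close>, so \<open>L * W0 * X0\<close> can be divided out.\<close>

lemma (in bounded_borel_coefficient) hardy_constant_le:
  fixes a m \<epsilon> \<kappa> \<delta> \<delta>' :: real
  assumes hardy: "\<And>f :: 'a \<times> 'b::euclidean_space \<Rightarrow> real. f \<in> test_functions Omega \<Longrightarrow>
      a * (\<integral>x. hardy_weight \<delta> \<delta>' x * (f x)\<^sup>2 \<partial>lborel) \<le> grushin_bilinear \<delta> \<delta>' b f f"
    and a: "a \<ge> 0" and \<delta>: "\<delta> \<ge> 0" "\<delta>' \<ge> 0" and m: "m = real DIM('a) + min \<delta> \<delta>' - 2"
    and \<epsilon>: "\<epsilon> > 0" and \<kappa>: "\<kappa> > 1"
  shows "a \<le> \<kappa> * ((1 + \<epsilon>) * (m\<^sup>2 / 4) + (\<epsilon> + \<epsilon>\<^sup>2) * (2 * (48 / cutoff (1 / 2))\<^sup>2))"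
proof -
  obtain t L where L: "L > 0" and c: "\<And>s. exp (t - 1 / \<epsilon>) \<le> s \<Longrightarrow> s \<le> exp (t + 1 / \<epsilon>) \<Longrightarrow>
      L * s powr min \<delta> \<delta>' \<le> c_fun \<delta> \<delta>' s \<and> c_fun \<delta> \<delta>' s \<le> \<kappa> * (L * s powr min \<delta> \<delta>')"
    using c_fun_almost_power[OF \<delta> \<kappa>, of "1 / \<epsilon>"] by metis
  define H where "H u = (cutoff u)\<^sup>2" for u
  define H' where "H' u = (dcutoff u)\<^sup>2" for u
  have H: "continuous_on UNIV H" "\<And>u. 1 \<le> \<bar>u\<bar> \<Longrightarrow> H u = 0"
    unfolding H_def by (auto intro!: continuous_on_power continuous_cutoff cutoff_eq_0)
  have H': "continuous_on UNIV H'" "\<And>u. 1 \<le> \<bar>u\<bar> \<Longrightarrow> H' u = 0"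
    unfolding H'_def by (auto intro!: continuous_on_power continuous_dcutoff dcutoff_eq_0)
  define J where "J \<tau> = (log_radial (- real DIM('a)) H \<epsilon> \<tau> :: 'a \<Rightarrow> real)" for \<tau>
  define J1 where "J1 = (log_radial (- real DIM('a)) H' \<epsilon> t :: 'a \<Rightarrow> real)"
  define P where "P = (log_radial (- m) H \<epsilon> t :: 'a \<Rightarrow> real)"
  define W0 where "W0 = (\<integral>y. J t y \<partial>lborel)"
  define W1 where "W1 = (\<integral>y. J1 y \<partial>lborel)"
  define W where "W = (\<integral>y. P y \<partial>lborel)"
  define X0 where "X0 = (\<integral>z. (cutoff (norm (z :: 'b)))\<^sup>2 \<partial>lborel)"
  define X1 where "X1 = (\<integral>z. (dcutoff (norm (z :: 'b)))\<^sup>2 \<partial>lborel)"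
  have int_J: "integrable lborel (J \<tau>)" for \<tau>
    unfolding J_def by (rule integrable_log_radial[OF \<epsilon> H])
  have int_J1: "integrable lborel J1"
    unfolding J1_def by (rule integrable_log_radial[OF \<epsilon> H'])
  have int_P: "integrable lborel P"
    unfolding P_def by (rule integrable_log_radial[OF \<epsilon> H])
  have H_nonneg: "0 \<le> H u" "0 \<le> H' u" for u
    by (simp_all add: H_def H'_def)
  have nonneg: "0 \<le> J \<tau> y" "0 \<le> J1 y" "0 \<le> P y" for \<tau> y
    by (simp_all add: J_def J1_def P_def log_radial_def H_nonneg)
  obtain e :: 'a where e: "e \<in> Basis"
    using nonempty_Basis by blast
  have W0: "W0 > 0"
    unfolding W0_def
  proof (rule integral_pos_if_continuous[OF _ int_J nonneg(1)])
    show "continuous_on UNIV (J t)"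
      unfolding J_def by (rule continuous_log_radial[OF \<epsilon> H])
    \<comment> \<open>A vector of norm \<open>exp t\<close> puts the cutoff at its centre.\<close>
    show "0 < J t (exp t *\<^sub>R e)"
      using e cutoff_pos[of 0] by (simp add: J_def log_radial_def H_def)
  qed
  have X0: "X0 > 0"
    unfolding X0_def
    using integrable_sq_norm_scaled(1,2)[OF continuous_cutoff cutoff_eq_0, of 1, where 'b = 'b] cutoff_pos[of 0]
    by (intro integral_pos_if_continuous[of _ 0]) simp_all
  have W1: "W1 \<le> 2 * (48 / cutoff (1 / 2))\<^sup>2 * W0"
  proof -
    let ?C = "(48 / cutoff (1 / 2))\<^sup>2"
    have shift: "(\<integral>y. J (t + \<tau>) y \<partial>lborel) = W0" for \<tau>
      unfolding J_def W0_def by (rule integral_log_radial_shift[OF \<epsilon> H])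
    \<comment> \<open>A shift of the profile by 1/2 corresponds to a shift of \<open>t\<close> by
      \<open>1 / (2 * \<epsilon>)\<close>, which leaves the integral equal to
      \<open>W0\<close>.\<close>
    have le: "J1 y \<le> ?C * (J (t + 1 / (2 * \<epsilon>)) y + J (t + - 1 / (2 * \<epsilon>)) y)" for y
    proof -
      define u where "u = \<epsilon> * (ln (norm y) - t)"
      have u: "\<epsilon> * (ln (norm y) - (t + 1 / (2 * \<epsilon>))) = u - 1 / 2" "\<epsilon> * (ln (norm y) - (t + - 1 / (2 * \<epsilon>))) = u + 1 / 2"
        using \<epsilon> by (simp_all add: u_def field_simps)
      have "norm y powr (- real DIM('a)) * H' u
          \<le> norm y powr (- real DIM('a)) * (?C * (H (u - 1 / 2) + H (u + 1 / 2)))"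
        unfolding H_def H'_def by (intro mult_left_mono dcutoff_le_cutoff) simp
      then show ?thesis
        unfolding J_def J1_def log_radial_def u u_def[symmetric] by (simp only: algebra_simps)
    qed
    have "W1 \<le> (\<integral>y. ?C * (J (t + 1 / (2 * \<epsilon>)) y + J (t + - 1 / (2 * \<epsilon>)) y) \<partial>lborel)"
      unfolding W1_def using int_J int_J1 le by (intro integral_mono) simp_all
    also have "\<dots> = ?C * (W0 + W0)"
      using int_J by (simp add: shift del: add_uminus_conv_diff)
    finally show ?thesis
      by simp
  qed
  have key: "a * L * W0 * X0 \<le> \<kappa> * L * ((1 + \<epsilon>) * (m\<^sup>2 / 4) * W0 + (\<epsilon> + \<epsilon>\<^sup>2) * W1) * X0 + B * W * X1 / R\<^sup>2"
    if R: "R > 0" for R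
  proof -
    let ?f = "trial m \<epsilon> t R :: 'a \<times> 'b \<Rightarrow> real"
    let ?U0 = "\<lambda>z :: 'b. (cutoff (norm z / R))\<^sup>2" and ?U1 = "\<lambda>z :: 'b. (dcutoff (norm z / R))\<^sup>2"
    define M where "M y = \<kappa> * L * ((1 + \<epsilon>) * (m\<^sup>2 / 4) * J t y + (\<epsilon> + \<epsilon>\<^sup>2) * J1 y)" for y
    have f: "?f \<in> test_functions Omega"
      by (rule trial_test_function[OF \<epsilon> R])
    note U0 = integrable_sq_norm_scaled[OF continuous_cutoff cutoff_eq_0 R, where 'b = 'b]
    note U1 = integrable_sq_norm_scaled[OF continuous_dcutoff dcutoff_eq_0 R, where 'b = 'b]
    have int_M: "integrable lborel M"
      unfolding M_def using int_J int_J1 by simp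
    have lower: "L * (W0 * (R ^ DIM('b) * X0)) \<le> (\<integral>x. hardy_weight \<delta> \<delta>' x * (?f x)\<^sup>2 \<partial>lborel)"
    proof -
      have "L * (W0 * (R ^ DIM('b) * X0)) = (\<integral>x. L * (J t (fst x) * ?U0 (snd x)) \<partial>lborel)"
        using integral_lborel_product(2)[OF int_J U0(2), of t] by (simp add: W0_def X0_def U0(3))
      also have "\<dots> \<le> (\<integral>x. hardy_weight \<delta> \<delta>' x * (?f x)\<^sup>2 \<partial>lborel)"
      proof (rule integral_mono)
        fix x :: "'a \<times> 'b"
        show "L * (J t (fst x) * ?U0 (snd x)) \<le> hardy_weight \<delta> \<delta>' x * (?f x)\<^sup>2"
        proof (cases "x \<in> trial_support \<epsilon> t R")
          case True
          then show ?thesis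
            using trial_energy_le(2)[OF m \<epsilon> R True, of L \<kappa>] c[of "norm (fst x)"] L \<kappa>
            by (simp add: J_def H_def[abs_def] trial_support_def mem_Times_iff log_annulus_def)
        next
          case False
          then have Z: "J t (fst x) * ?U0 (snd x) = 0"
            using log_radial_outside[OF \<epsilon> H, of "fst x" t] R cutoff_eq_0[of "norm (snd x) / R"]
            by (auto simp: J_def trial_support_def mem_Times_iff)
          show ?thesis
            unfolding Z by (simp add: hardy_weight_nonneg)
        qed
      qed (use integral_lborel_product(1)[OF int_J U0(2)] integrable_hardy_weight[OF f] in simp_all)
      finally show ?thesis .
    qed
    have B1: "(i, 0 :: 'b) \<in> Basis" if "i \<in> Basis" for i :: 'a
      using that by (simp add: Basis_prod_def)
    have B2: "(0 :: 'a, j) \<in> Basis" if "j \<in> Basis" for j :: 'b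
      using that by (simp add: Basis_prod_def)
    have int1: "integrable lborel (\<lambda>x. c_Omega \<delta> \<delta>' x * (pd ?f (i, 0) x * pd ?f (i, 0) x))" if "i \<in> Basis" for i
      using integrable_grushin_weight[OF f f B1[OF that], of \<delta> \<delta>'] by (simp add: grushin_weight_def)
    have int2: "integrable lborel (\<lambda>x. b (fst x) * (pd ?f (0, j) x * pd ?f (0, j) x))" if "j \<in> Basis" for j
      using integrable_grushin_weight[OF f f B2[OF that], of \<delta> \<delta>'] that
      by (simp add: grushin_weight_def nonzero_Basis)
    have "grushin_bilinear \<delta> \<delta>' b ?f ?f
        = (\<integral>x. (\<Sum>i\<in>Basis. c_Omega \<delta> \<delta>' x * (pd ?f (i, 0) x * pd ?f (i, 0) x))
          + (\<Sum>j\<in>Basis. b (fst x) * (pd ?f (0, j) x * pd ?f (0, j) x)) \<partial>lborel)"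
      unfolding grushin_bilinear_def sum_Basis_prod using int1 int2
      by (simp add: Bochner_Integration.integral_sum grushin_weight_def nonzero_Basis)
    also have "\<dots> \<le> (\<integral>x. M (fst x) * ?U0 (snd x) + B / R\<^sup>2 * (P (fst x) * ?U1 (snd x)) \<partial>lborel)"
    proof (rule integral_mono)
      fix x :: "'a \<times> 'b"
      show "(\<Sum>i\<in>Basis. c_Omega \<delta> \<delta>' x * (pd ?f (i, 0) x * pd ?f (i, 0) x))
          + (\<Sum>j\<in>Basis. b (fst x) * (pd ?f (0, j) x * pd ?f (0, j) x))
        \<le> M (fst x) * ?U0 (snd x) + B / R\<^sup>2 * (P (fst x) * ?U1 (snd x))"
      proof (cases "x \<in> trial_support \<epsilon> t R")
        case True
        then show ?thesis
          using trial_energy_le(1)[OF m \<epsilon> R True, of L \<kappa>] c[of "norm (fst x)"] L \<kappa>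
          by (simp add: M_def J_def J1_def P_def H_def[abs_def] H'_def[abs_def] mult.assoc
              trial_support_def mem_Times_iff log_annulus_def)
      next
        case False
        have "pd ?f v x = 0" for v
          by (rule pd_eq_0_outside[OF compact_imp_closed[OF compact_trial_support[OF \<epsilon> R]] trial_eq_0[OF \<epsilon> R] False])
        moreover have "0 \<le> M y" for y
          unfolding M_def using \<epsilon> \<kappa> L nonneg by (intro mult_nonneg_nonneg add_nonneg_nonneg) auto
        moreover have "0 \<le> B"
          using b_nonneg[of 0] b_le[of 0] by linarith
        ultimately show ?thesis
          using nonneg by simp
      qed
    qed (use int1 int2 integral_lborel_product(1)[OF int_M U0(2)] integral_lborel_product(1)[OF int_P U1(2)] in simp_all)
    also have "\<dots> = (\<integral>y. M y \<partial>lborel) * (R ^ DIM('b) * X0) + B / R\<^sup>2 * (W * (R ^ DIM('b) * X1))"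
      using integral_lborel_product[OF int_M U0(2)] integral_lborel_product[OF int_P U1(2)]
      by (simp add: W_def X0_def X1_def U0(3) U1(3))
    also have "(\<integral>y. M y \<partial>lborel) = \<kappa> * L * ((1 + \<epsilon>) * (m\<^sup>2 / 4) * W0 + (\<epsilon> + \<epsilon>\<^sup>2) * W1)"
      unfolding M_def W0_def W1_def using int_J int_J1 by simp
    finally have upper: "grushin_bilinear \<delta> \<delta>' b ?f ?f
        \<le> R ^ DIM('b) * (\<kappa> * L * ((1 + \<epsilon>) * (m\<^sup>2 / 4) * W0 + (\<epsilon> + \<epsilon>\<^sup>2) * W1) * X0 + B * W * X1 / R\<^sup>2)"
      by (simp add: algebra_simps)
    have "R ^ DIM('b) * (a * L * W0 * X0) = a * (L * (W0 * (R ^ DIM('b) * X0)))"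
      by simp
    also have "\<dots> \<le> a * (\<integral>x. hardy_weight \<delta> \<delta>' x * (?f x)\<^sup>2 \<partial>lborel)"
      by (intro mult_left_mono lower a)
    also have "\<dots> \<le> grushin_bilinear \<delta> \<delta>' b ?f ?f"
      by (rule hardy[OF f])
    also note upper
    finally show ?thesis
      using R by simp
  qed
  \<comment> \<open>\<open>W\<close> and \<open>X1\<close> are independent of \<open>R\<close>, so
    letting \<open>R\<close> tend to infinity removes the term with \<open>B\<close>.\<close>
  have "a * L * W0 * X0 \<le> \<kappa> * L * ((1 + \<epsilon>) * (m\<^sup>2 / 4) * W0 + (\<epsilon> + \<epsilon>\<^sup>2) * W1) * X0"
    using key by (rule le_if_le_add_inverse_square)
  also have "\<dots> \<le> \<kappa> * L * ((1 + \<epsilon>) * (m\<^sup>2 / 4) * W0 + (\<epsilon> + \<epsilon>\<^sup>2) * (2 * (48 / cutoff (1 / 2))\<^sup>2 * W0)) * X0"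
    using W1 \<epsilon> \<kappa> L X0 by (intro mult_right_mono mult_left_mono add_left_mono) auto
  also have "\<dots> = \<kappa> * ((1 + \<epsilon>) * (m\<^sup>2 / 4) + (\<epsilon> + \<epsilon>\<^sup>2) * (2 * (48 / cutoff (1 / 2))\<^sup>2)) * (L * W0 * X0)"
    by (simp only: algebra_simps)
  finally have "a * (L * W0 * X0)
      \<le> \<kappa> * ((1 + \<epsilon>) * (m\<^sup>2 / 4) + (\<epsilon> + \<epsilon>\<^sup>2) * (2 * (48 / cutoff (1 / 2))\<^sup>2)) * (L * W0 * X0)"
    by (simp only: mult.assoc)
  moreover have "0 < L * W0 * X0"
    using L W0 X0 by simp
  ultimately show ?thesis
    by (simp only: mult_le_cancel_right_pos)
qed

text \<open>The bound of \<open>hardy_constant_le\<close> with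
  \<open>\<kappa> = 1 + \<epsilon>\<close> tends to \<open>m\<^sup>2 / 4\<close> as
  \<open>\<epsilon>\<close> decreases to zero. That bound multiplies an estimate by \<open>a\<close>
  and so requires \<open>a \<ge> 0\<close>; for negative \<open>a\<close> the claim is
  immediate.\<close>

lemma (in bounded_borel_coefficient) hardy_constant_optimal:
  fixes a m \<delta> \<delta>' :: real
  assumes hardy: "\<And>f :: 'a \<times> 'b::euclidean_space \<Rightarrow> real. f \<in> test_functions Omega \<Longrightarrow>
      a * (\<integral>x. hardy_weight \<delta> \<delta>' x * (f x)\<^sup>2 \<partial>lborel) \<le> grushin_bilinear \<delta> \<delta>' b f f"
    and \<delta>: "\<delta> \<ge> 0" "\<delta>' \<ge> 0" and m: "m = real DIM('a) + min \<delta> \<delta>' - 2"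
  shows "a \<le> m\<^sup>2 / 4"
proof (cases "a \<ge> 0")
  case True
  let ?F = "\<lambda>\<epsilon>. (1 + \<epsilon>) * ((1 + \<epsilon>) * (m\<^sup>2 / 4) + (\<epsilon> + \<epsilon>\<^sup>2) * (2 * (48 / cutoff (1 / 2))\<^sup>2))"
  show ?thesis
  proof (rule tendsto_lowerbound)
    have "(?F \<longlongrightarrow> (1 + 0) * ((1 + 0) * (m\<^sup>2 / 4) + (0 + 0\<^sup>2) * (2 * (48 / cutoff (1 / 2))\<^sup>2))) (at_right 0)"
      by (intro tendsto_intros)
    then show "(?F \<longlongrightarrow> m\<^sup>2 / 4) (at_right 0)"
      by simp
    show "\<forall>\<^sub>F \<epsilon> in at_right 0. a \<le> ?F \<epsilon>"
      unfolding eventually_at_filter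
      by (intro always_eventually allI impI hardy_constant_le[OF hardy True \<delta> m]) auto
  qed simp
next
  case False
  moreover have "0 \<le> m\<^sup>2 / 4"
    by simp
  ultimately show ?thesis
    by linarith
qed

theorem mainTheorem14:
  fixes \<delta> \<delta>' a\<^sub>1 :: real
    and b :: "'a::euclidean_space \<Rightarrow> real"
  assumes "\<delta> \<ge> 0" and "\<delta>' \<ge> 0"
    and "b \<in> borel_measurable (lebesgue_on (UNIV - {0}))"
    and "\<And>y. y \<noteq> 0 \<Longrightarrow> b y > 0"
    and "bounded (b ` (UNIV - {0}))"
    and "real DIM('a) + min \<delta> \<delta>' - 2 > 0"
    and a1: "a\<^sub>1 = (real DIM('a) + min \<delta> \<delta>' - 2)\<^sup>2 / 4"
  shows "(\<forall>\<phi> \<in> (grushin_dom \<delta> \<delta>' b :: ('a \<times> 'b::euclidean_space \<Rightarrow> real) set).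
            hardy_weighted \<delta> \<delta>' \<phi> \<in> L2 Omega \<and>
            grushin_form \<delta> \<delta>' b \<phi> \<ge>
              a\<^sub>1 * L2_inner Omega (hardy_weighted \<delta> \<delta>' \<phi>) (hardy_weighted \<delta> \<delta>' \<phi>))
       \<and> (\<forall>a :: real.
            (\<forall>\<phi> \<in> (grushin_dom \<delta> \<delta>' b :: ('a \<times> 'b \<Rightarrow> real) set).
               grushin_form \<delta> \<delta>' b \<phi> \<ge>
                 a * L2_inner Omega (hardy_weighted \<delta> \<delta>' \<phi>) (hardy_weighted \<delta> \<delta>' \<phi>))
            \<longrightarrow> a \<le> a\<^sub>1)"
proof -
  \<comment> \<open>All estimates are made for the Borel version \<open>b'\<close>; the form built
    from \<open>b\<close> agrees with its form on test functions.\<close>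
  obtain b' B where b': "b' \<in> borel_measurable borel" "\<And>y. 0 \<le> b' y" "\<And>y. b' y \<le> B"
    and b_eq: "AE y in lborel. b y = b' y"
    using bounded_borel_version[OF assms(3-5)] by metis
  interpret bounded_borel_coefficient b' B
    using b' by unfold_locales
  interpret symmetric_form "Omega :: ('a \<times> 'b) set" "test_functions Omega"
    "grushin_form0 \<delta> \<delta>' b" "grushin_bilinear \<delta> \<delta>' b'"
    using b_eq by (rule symmetric_form_grushin_form0)
  have "a \<le> a\<^sub>1"
    if a: "\<forall>\<phi> \<in> (grushin_dom \<delta> \<delta>' b :: ('a \<times> 'b \<Rightarrow> real) set).
      a * L2_inner Omega (hardy_weighted \<delta> \<delta>' \<phi>) (hardy_weighted \<delta> \<delta>' \<phi>) \<le> grushin_form \<delta> \<delta>' b \<phi>" for a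
    unfolding a1
  proof (rule hardy_constant_optimal[OF _ assms(1,2) refl])
    fix f :: "'a \<times> 'b \<Rightarrow> real" assume f: "f \<in> test_functions Omega"
    \<comment> \<open>An admissible constant is tested on test functions only: they lie in the
      domain, and there the closure takes the value of the original form.\<close>
    have "f \<in> grushin_dom \<delta> \<delta>' b"
      using f subset_closure_dom by (auto simp: grushin_dom_def)
    then have "a * L2_inner Omega (hardy_weighted \<delta> \<delta>' f) (hardy_weighted \<delta> \<delta>' f) \<le> grushin_form \<delta> \<delta>' b f"
      using a by blast
    also have "grushin_form \<delta> \<delta>' b f = grushin_bilinear \<delta> \<delta>' b' f f"
      by (simp only: grushin_form_def closure_form_eq[OF f] grushin_form0_eq[OF f b_eq])
    also have "L2_inner Omega (hardy_weighted \<delta> \<delta>' f) (hardy_weighted \<delta> \<delta>' f)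
        = (\<integral>x. hardy_weight \<delta> \<delta>' x * (f x)\<^sup>2 \<partial>lborel)"
      unfolding L2_inner_self hardy_weighted_sq using borel_measurable_test_function[OF f]
      by (intro lebesgue_on_Omega_conv_lborel(2)) auto
    finally show "a * (\<integral>x. hardy_weight \<delta> \<delta>' x * (f x)\<^sup>2 \<partial>lborel) \<le> grushin_bilinear \<delta> \<delta>' b' f f" .
  qed
  moreover have "hardy_weighted \<delta> \<delta>' \<phi> \<in> L2 Omega"
    "a\<^sub>1 * L2_inner Omega (hardy_weighted \<delta> \<delta>' \<phi>) (hardy_weighted \<delta> \<delta>' \<phi>) \<le> grushin_form \<delta> \<delta>' b \<phi>"
    if "\<phi> \<in> grushin_dom \<delta> \<delta>' b" for \<phi> :: "'a \<times> 'b \<Rightarrow> real"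
    using hardy_closure[OF refl assms(6) b_eq that] unfolding a1 by auto
  ultimately show ?thesis
    by blast
qed

end
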